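(* Let $(u_k)$, $(\tilde u_k)$, $(\hat u_k)$ be sequences generated by the AAPicard-Newton iteration with depth $m=1$ (described in the context) with relaxation parameter $\beta_{k+1}=1$ for all $k$. Suppose there is a constant $C_A>0$ with $|1-\alpha_k|+|\alpha_k|\le C_A$ for all $k$, and suppose $\sigma<1$ and $\sigma C_A<1$. Then for all $k\ge 0$ $$\|\nabla \hat u_{k+1}\|\le C_A\,\nu^{-1}\|f\|_{-1},\qquad \|\nabla u_{k+1}\|\le \frac{1+\sigma C_A^2}{1-\sigma C_A}\,\nu^{-1}\|f\|_{-1}.$$
   Context: Let $\Omega\subset\mathbb R^d$, $d\in\{2,3\}$, be a bounded open connected set. $(\cdot,\cdot)$ and $\|\cdot\|$ are the $L^2(\Omega)$ inner product and norm. $X=H_0^1(\Omega)^d$, $Q=\{q\in L^2(\Omega):\int_\Omega q\,dx=0\}$, $V=\{v\in X:(\nabla\cdot v,q)=0\ \forall q\in Q\}$. $\nu>0$ is the viscosity, $f\in H^{-1}(\Omega)^d$, $\langle\cdot,\cdot\rangle$ is the duality pairing between $H^{-1}$ and $X$, and $\|f\|_{-1}=\sup_{0\ne v\in X}\langle f,v\rangle/\|\nabla v\|$. Set $b^*(v,w,z)=(v\cdot\nabla w,z)+\tfrac12((\nabla\cdot v)w,z)$ for $v,w,z\in X$; it satisfies $b^*(u,v,v)=0$ and $b^*(v,w,z)\le M\|\nabla v\|\|\nabla w\|\|\nabla z\|$ for all arguments in $X$, where $M$ depends only on $\Omega$. Put $\sigma=M\nu^{-2}\|f\|_{-1}$.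 AAPicard-Newton iteration with depth $m=1$: given $u_0\in V$, for $k=0,1,2,\dots$ with damping factors $0<\beta_{k+1}\le1$: Step 1 (Picard): $\tilde u_{k+1}\in V$ satisfies $\nu(\nabla\tilde u_{k+1},\nabla v)+b^*(u_k,\tilde u_{k+1},v)=\langle f,v\rangle$ for all $v\in V$. Step 2 (Anderson): for $k\ge1$, with $w_{k+1}^\alpha=(1-\alpha_{k+1})(\tilde u_{k+1}-u_k)+\alpha_{k+1}(\tilde u_k-u_{k-1})$, where $\alpha_{k+1}\in\mathbb R$ minimizes $\|\nabla w_{k+1}^\alpha\|$, set $\hat u_{k+1}=(1-\alpha_{k+1})\tilde u_{k+1}+\alpha_{k+1}\tilde u_k-(1-\beta_{k+1})w_{k+1}^\alpha$. For $k=0$ there is no acceleration: $\hat u_1=\tilde u_1$, $\alpha_1=0$. Step 3 (Newton): $u_{k+1}\in V$ satisfies $\nu(\nabla u_{k+1},\nabla v)+b^*(\hat u_{k+1},u_{k+1},v)+b^*(u_{k+1},\hat u_{k+1},v)-b^*(\hat u_{k+1},\hat u_{k+1},v)=\langle f,v\rangle$ for all $v\in V$. *)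

theory Defs
  imports "HOL-Analysis.Analysis"
begin

section \<open>Lebesgue space\<close>

text \<open>Elements of function spaces are represented by functions on all of \<open>\<real>\<^sup>d\<close>; only their values
  on \<open>\<Omega>\<close> matter, and only up to null sets. The codomain may be \<open>\<real>\<close> (scalars), \<open>\<real>\<^sup>d\<close> (vector
  fields) or \<open>\<real>\<^sup>d\<^sup>\<times>\<^sup>d\<close> (gradients of vector fields, where the inner product is the Frobenius one).\<close>

definition L2 :: "(real^'d) set \<Rightarrow> (real^'d \<Rightarrow> 'b::euclidean_space) set" where
  "L2 \<Omega> = {u \<in> borel_measurable (lebesgue_on \<Omega>). integrable (lebesgue_on \<Omega>) (\<lambda>x. (norm (u x))\<^sup>2)}"

definition L2_inner ::
  "(real^'d) set \<Rightarrow> (real^'d \<Rightarrow> 'b::euclidean_space) \<Rightarrow> (real^'d \<Rightarrow> 'b) \<Rightarrow> real" where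
  "L2_inner \<Omega> u v = (\<integral>x. u x \<bullet> v x \<partial>lebesgue_on \<Omega>)"

definition L2_norm :: "(real^'d) set \<Rightarrow> (real^'d \<Rightarrow> 'b::euclidean_space) \<Rightarrow> real" where
  "L2_norm \<Omega> u = sqrt (L2_inner \<Omega> u u)"


section \<open>Test functions and weak gradients\<close>

definition partial :: "'d \<Rightarrow> (real^'d \<Rightarrow> real) \<Rightarrow> real^'d \<Rightarrow> real" where
  "partial i \<phi> x = frechet_derivative \<phi> (at x) (axis i 1)"

primrec times_differentiable :: "nat \<Rightarrow> (real^'d \<Rightarrow> real) \<Rightarrow> bool" where
  "times_differentiable 0 \<phi> \<longleftrightarrow> True"
| "times_differentiable (Suc n) \<phi> \<longleftrightarrow>
     (\<forall>x. \<phi> differentiable (at x)) \<and> (\<forall>i. times_differentiable n (partial i \<phi>))"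

text \<open>\<open>C\<^sub>c\<^sup>\<infinity>(\<Omega>)\<close>: infinitely differentiable functions whose support is a compact subset of \<open>\<Omega>\<close>.\<close>

definition test_functions :: "(real^'d) set \<Rightarrow> (real^'d \<Rightarrow> real) set" where
  "test_functions \<Omega> = {\<phi>. (\<forall>n. times_differentiable n \<phi>) \<and>
     compact (closure {x. \<phi> x \<noteq> 0}) \<and> closure {x. \<phi> x \<noteq> 0} \<subseteq> \<Omega>}"

definition is_weak_gradient ::
  "(real^'d) set \<Rightarrow> (real^'d \<Rightarrow> real) \<Rightarrow> (real^'d \<Rightarrow> real^'d) \<Rightarrow> bool" where
  "is_weak_gradient \<Omega> u G \<longleftrightarrow> G \<in> L2 \<Omega> \<and>
     (\<forall>\<phi>\<in>test_functions \<Omega>. \<forall>i.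
        L2_inner \<Omega> u (partial i \<phi>) = - L2_inner \<Omega> (\<lambda>x. G x $ i) \<phi>)"

text \<open>A representative of the weak gradient, which is unique up to null sets.\<close>

definition weak_grad :: "(real^'d) set \<Rightarrow> (real^'d \<Rightarrow> real) \<Rightarrow> real^'d \<Rightarrow> real^'d" where
  "weak_grad \<Omega> u = (SOME G. is_weak_gradient \<Omega> u G)"


section \<open>Sobolev spaces\<close>

definition H1 :: "(real^'d) set \<Rightarrow> (real^'d \<Rightarrow> real) set" where
  "H1 \<Omega> = {u \<in> L2 \<Omega>. \<exists>G. is_weak_gradient \<Omega> u G}"

definition H1_norm :: "(real^'d) set \<Rightarrow> (real^'d \<Rightarrow> real) \<Rightarrow> real" where
  "H1_norm \<Omega> u = sqrt ((L2_norm \<Omega> u)\<^sup>2 + (L2_norm \<Omega> (weak_grad \<Omega> u))\<^sup>2)"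

text \<open>\<open>H\<^sub>0\<^sup>1(\<Omega>)\<close>: the closure of \<open>C\<^sub>c\<^sup>\<infinity>(\<Omega>)\<close> in \<open>H\<^sup>1(\<Omega>)\<close>.\<close>

definition H10 :: "(real^'d) set \<Rightarrow> (real^'d \<Rightarrow> real) set" where
  "H10 \<Omega> = {u \<in> H1 \<Omega>. \<forall>\<epsilon>>0. \<exists>\<phi>\<in>test_functions \<Omega>. H1_norm \<Omega> (\<lambda>x. u x - \<phi> x) < \<epsilon>}"

definition vel_space :: "(real^'d) set \<Rightarrow> (real^'d \<Rightarrow> real^'d) set" where
  "vel_space \<Omega> = {v. \<forall>i. (\<lambda>x. v x $ i) \<in> H10 \<Omega>}"

text \<open>Row \<open>i\<close> of the matrix \<open>vgrad \<Omega> v x\<close> is the gradient of the \<open>i\<close>-th component of \<open>v\<close>.\<close>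

definition vgrad :: "(real^'d) set \<Rightarrow> (real^'d \<Rightarrow> real^'d) \<Rightarrow> real^'d \<Rightarrow> real^'d^'d" where
  "vgrad \<Omega> v x = (\<chi> i. weak_grad \<Omega> (\<lambda>y. v y $ i) x)"

definition divergence :: "(real^'d) set \<Rightarrow> (real^'d \<Rightarrow> real^'d) \<Rightarrow> real^'d \<Rightarrow> real" where
  "divergence \<Omega> v x = trace (vgrad \<Omega> v x)"

definition pressure_space :: "(real^'d) set \<Rightarrow> (real^'d \<Rightarrow> real) set" where
  "pressure_space \<Omega> = {q \<in> L2 \<Omega>. (\<integral>x. q x \<partial>lebesgue_on \<Omega>) = 0}"

definition divfree_space :: "(real^'d) set \<Rightarrow> (real^'d \<Rightarrow> real^'d) set" where
  "divfree_space \<Omega> =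
     {v \<in> vel_space \<Omega>. \<forall>q\<in>pressure_space \<Omega>. L2_inner \<Omega> (divergence \<Omega> v) q = 0}"

text \<open>\<open>H\<^sup>-\<^sup>1(\<Omega>)\<^sup>d\<close>: bounded linear functionals on \<open>H\<^sub>0\<^sup>1(\<Omega>)\<^sup>d\<close>. Boundedness makes the value independent of
  the representative. The duality pairing of \<open>f\<close> and \<open>v\<close> is the application \<open>f v\<close>.\<close>

definition Hminus1 :: "(real^'d) set \<Rightarrow> ((real^'d \<Rightarrow> real^'d) \<Rightarrow> real) set" where
  "Hminus1 \<Omega> = {f.
     (\<forall>v\<in>vel_space \<Omega>. \<forall>w\<in>vel_space \<Omega>. f (\<lambda>x. v x + w x) = f v + f w) \<and>
     (\<forall>c. \<forall>v\<in>vel_space \<Omega>. f (\<lambda>x. c *\<^sub>R v x) = c * f v) \<and>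
     (\<exists>C. \<forall>v\<in>vel_space \<Omega>. \<bar>f v\<bar> \<le> C * sqrt ((L2_norm \<Omega> v)\<^sup>2 + (L2_norm \<Omega> (vgrad \<Omega> v))\<^sup>2))}"

definition dual_norm :: "(real^'d) set \<Rightarrow> ((real^'d \<Rightarrow> real^'d) \<Rightarrow> real) \<Rightarrow> real" where
  "dual_norm \<Omega> f = Sup {f v / L2_norm \<Omega> (vgrad \<Omega> v) |v.
     v \<in> vel_space \<Omega> \<and> \<not> (AE x in lebesgue_on \<Omega>. v x = 0)}"


section \<open>The iteration\<close>

text \<open>The \<open>i\<close>-th component of \<open>v \<cdot> \<nabla>w\<close> is \<open>\<Sum>\<^sub>j v\<^sub>j \<partial>\<^sub>j w\<^sub>i\<close>, that is, \<open>v \<cdot> \<nabla>w = vgrad \<Omega> w x *v v x\<close>.\<close>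

definition bstar :: "(real^'d) set \<Rightarrow> (real^'d \<Rightarrow> real^'d) \<Rightarrow> (real^'d \<Rightarrow> real^'d) \<Rightarrow>
    (real^'d \<Rightarrow> real^'d) \<Rightarrow> real" where
  "bstar \<Omega> v w z = L2_inner \<Omega> (\<lambda>x. vgrad \<Omega> w x *v v x) z
     + 1/2 * L2_inner \<Omega> (\<lambda>x. divergence \<Omega> v x *\<^sub>R w x) z"

definition picard_step :: "(real^'d) set \<Rightarrow> real \<Rightarrow> ((real^'d \<Rightarrow> real^'d) \<Rightarrow> real) \<Rightarrow>
    (real^'d \<Rightarrow> real^'d) \<Rightarrow> (real^'d \<Rightarrow> real^'d) \<Rightarrow> bool" where
  "picard_step \<Omega> \<nu> f u ut \<longleftrightarrow> ut \<in> divfree_space \<Omega> \<and>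
     (\<forall>v\<in>divfree_space \<Omega>.
        \<nu> * L2_inner \<Omega> (vgrad \<Omega> ut) (vgrad \<Omega> v) + bstar \<Omega> u ut v = f v)"

definition newton_step :: "(real^'d) set \<Rightarrow> real \<Rightarrow> ((real^'d \<Rightarrow> real^'d) \<Rightarrow> real) \<Rightarrow>
    (real^'d \<Rightarrow> real^'d) \<Rightarrow> (real^'d \<Rightarrow> real^'d) \<Rightarrow> bool" where
  "newton_step \<Omega> \<nu> f uh u \<longleftrightarrow> u \<in> divfree_space \<Omega> \<and>
     (\<forall>v\<in>divfree_space \<Omega>.
        \<nu> * L2_inner \<Omega> (vgrad \<Omega> u) (vgrad \<Omega> v)
        + bstar \<Omega> uh u v + bstar \<Omega> u uh v - bstar \<Omega> uh uh v = f v)"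

text \<open>The combination \<open>w\<^sub>k\<^sub>+\<^sub>1\<^sup>a\<close> of the last two fixed-point residuals, for \<open>k \<ge> 1\<close>.\<close>

definition residual_comb :: "(nat \<Rightarrow> real^'d \<Rightarrow> real^'d) \<Rightarrow> (nat \<Rightarrow> real^'d \<Rightarrow> real^'d) \<Rightarrow>
    nat \<Rightarrow> real \<Rightarrow> real^'d \<Rightarrow> real^'d" where
  "residual_comb u ut k a x =
     (1 - a) *\<^sub>R (ut (k + 1) x - u k x) + a *\<^sub>R (ut k x - u (k - 1) x)"

definition anderson_step :: "(real^'d) set \<Rightarrow> (nat \<Rightarrow> real) \<Rightarrow> (nat \<Rightarrow> real) \<Rightarrow>
    (nat \<Rightarrow> real^'d \<Rightarrow> real^'d) \<Rightarrow> (nat \<Rightarrow> real^'d \<Rightarrow> real^'d) \<Rightarrow> (nat \<Rightarrow> real^'d \<Rightarrow> real^'d) \<Rightarrow>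
    nat \<Rightarrow> bool" where
  "anderson_step \<Omega> \<beta> \<alpha> u ut uh k \<longleftrightarrow>
     (if k = 0 then
        \<alpha> 1 = 0 \<and> (AE x in lebesgue_on \<Omega>. uh 1 x = ut 1 x)
      else
        (\<forall>a. L2_norm \<Omega> (vgrad \<Omega> (residual_comb u ut k (\<alpha> (k + 1))))
           \<le> L2_norm \<Omega> (vgrad \<Omega> (residual_comb u ut k a))) \<and>
        (AE x in lebesgue_on \<Omega>. uh (k + 1) x =
           (1 - \<alpha> (k + 1)) *\<^sub>R ut (k + 1) x + \<alpha> (k + 1) *\<^sub>R ut k x
           - (1 - \<beta> (k + 1)) *\<^sub>R residual_comb u ut k (\<alpha> (k + 1)) x))"

text \<open>The sequences \<open>ut\<close>, \<open>uh\<close>, \<open>\<alpha>\<close>, \<open>\<beta>\<close> start at index \<open>1\<close>; their values at \<open>0\<close> are irrelevant.\<close>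

definition AAPicard_Newton :: "(real^'d) set \<Rightarrow> real \<Rightarrow> ((real^'d \<Rightarrow> real^'d) \<Rightarrow> real) \<Rightarrow>
    (nat \<Rightarrow> real) \<Rightarrow> (nat \<Rightarrow> real) \<Rightarrow> (nat \<Rightarrow> real^'d \<Rightarrow> real^'d) \<Rightarrow>
    (nat \<Rightarrow> real^'d \<Rightarrow> real^'d) \<Rightarrow> (nat \<Rightarrow> real^'d \<Rightarrow> real^'d) \<Rightarrow> bool" where
  "AAPicard_Newton \<Omega> \<nu> f \<beta> \<alpha> u ut uh \<longleftrightarrow>
     u 0 \<in> divfree_space \<Omega> \<and>
     (\<forall>k. 0 < \<beta> (k + 1) \<and> \<beta> (k + 1) \<le> 1 \<and>
          picard_step \<Omega> \<nu> f (u k) (ut (k + 1)) \<and>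
          anderson_step \<Omega> \<beta> \<alpha> u ut uh k \<and>
          newton_step \<Omega> \<nu> f (uh (k + 1)) (u (k + 1)))"

end

theory Submission
  imports Defs
begin

text \<open>Testing the Picard equation with \<open>ut\<close> and using \<open>b\<^sup>*(u, v, v) = 0\<close> gives
  \<open>\<parallel>\<nabla>ut\<parallel> \<le> \<nu>\<^sup>-\<^sup>1 \<parallel>f\<parallel>\<close>; the Anderson step combines two such fields with coefficients of total modulus at
  most \<open>C\<^sub>A\<close>; testing the Newton equation with \<open>u\<close> leaves
  \<open>(\<nu> - M \<parallel>\<nabla>uh\<parallel>) \<parallel>\<nabla>u\<parallel> \<le> \<parallel>f\<parallel> + M \<parallel>\<nabla>uh\<parallel>\<^sup>2\<close>.

  The skew symmetry \<open>b\<^sup>*(u, v, v) = 0\<close> follows from density of the test functions in \<open>H\<^sub>0\<^sup>1\<close>, since by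
  Ladyzhenskaya's inequality \<open>H\<^sub>0\<^sup>1\<close> embeds into \<open>L\<^sup>4\<close> in dimensions two and three. The weak gradient is a
  choice among representatives, so its linearity rests on the fundamental lemma of the calculus of
  variations, and hence on the existence of bump functions. The Poincare inequality makes the supremum
  in the dual norm finite.\<close>

section \<open>Smooth functions\<close>

text \<open>A Bochner integral of a non-integrable function is zero by convention, so the integrals
  in \<open>bstar\<close> can be split into components only once integrability is known; this and
  the passage to limits are what L^4 is for. Its embedding constant never reaches the final
  estimate, because the quantitative bound on \<open>bstar\<close> is the assumption
  \<open>M_bound\<close>. That bound is one-sided: lower bounds come from negating the test field,
  and the sign of \<open>M\<close> is itself derived, from the vanishing of \<open>bstar\<close>
  with three equal nonzero arguments. All fields are representatives, and the Anderson step fixes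
  \<open>uh\<close> only almost everywhere, so membership in \<open>vel_space\<close> and gradient
  norms have to be invariant under changes on null sets. The constants come from r = C_A F / \<nu>,
  the bound for the gradient of \<open>uh\<close>, where F is the dual norm of f: then M r = \<nu>
  \<sigma> C_A gives the denominator 1 - \<sigma> C_A, and M r^2 = \<sigma> C_A^2 F gives the
  numerator 1 + \<sigma> C_A^2.\<close>

definition smooth :: "(real^'d \<Rightarrow> real) \<Rightarrow> bool" where
  "smooth \<phi> \<longleftrightarrow> (\<forall>n. times_differentiable n \<phi>)"

lemma partial_eqI: "(f has_derivative D) (at x) \<Longrightarrow> partial i f x = D (axis i 1)"
  unfolding partial_def using frechet_derivative_at by metis

lemma differentiable_has_derivative:
  "f differentiable (at x) \<Longrightarrow> (f has_derivative frechet_derivative f (at x)) (at x)"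
  using frechet_derivative_works by blast

lemma partial_add:
  assumes "\<And>x. f differentiable (at x)" "\<And>x. g differentiable (at x)"
  shows "partial i (\<lambda>x. f x + g x) = (\<lambda>x. partial i f x + partial i g x)"
proof
  fix x show "partial i (\<lambda>x. f x + g x) x = partial i f x + partial i g x"
    by (subst partial_eqI[OF has_derivative_add[OF differentiable_has_derivative differentiable_has_derivative]])
       (auto simp: assms partial_def)
qed

lemma partial_mult:
  assumes "\<And>x. f differentiable (at x)" "\<And>x. g differentiable (at x)"
  shows "partial i (\<lambda>x. f x * g x) = (\<lambda>x. f x * partial i g x + partial i f x * g x)"
proof
  fix x show "partial i (\<lambda>x. f x * g x) x = f x * partial i g x + partial i f x * g x"
    by (subst partial_eqI[OF has_derivative_mult[OF differentiable_has_derivative differentiable_has_derivative]])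
       (auto simp: assms partial_def)
qed

lemma partial_const [simp]: "partial i (\<lambda>x. c) = (\<lambda>x. 0)"
  by (rule ext, subst partial_eqI[OF has_derivative_const]) simp

lemma partial_coord: "partial i (\<lambda>x. x $ j) = (\<lambda>x. if i = j then 1 else 0)"
  by (rule ext, subst partial_eqI[OF bounded_linear.has_derivative[OF bounded_linear_vec_nth has_derivative_ident]])
     (auto simp: axis_def)

lemma times_differentiable_SucD: "times_differentiable (Suc n) f \<Longrightarrow> times_differentiable n f"
  by (induction n arbitrary: f) auto

lemma times_differentiable_const: "times_differentiable n (\<lambda>x. c)"
  by (induction n arbitrary: c) auto

lemma times_differentiable_add:
  "times_differentiable n f \<Longrightarrow> times_differentiable n g \<Longrightarrow> times_differentiable n (\<lambda>x. f x + g x)"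
  by (induction n arbitrary: f g) (auto simp: partial_add)

lemma times_differentiable_mult:
  "times_differentiable n f \<Longrightarrow> times_differentiable n g \<Longrightarrow> times_differentiable n (\<lambda>x. f x * g x)"
proof (induction n arbitrary: f g)
  case (Suc n)
  \<comment> \<open>The product rule multiplies a derivative of one factor by the other factor
    itself, which must therefore be available at the lower order as well.\<close>
  note f = times_differentiable_SucD[OF Suc.prems(1)] and g = times_differentiable_SucD[OF Suc.prems(2)]
  from Suc.prems f g show ?case
    by (auto simp: partial_mult intro!: times_differentiable_add Suc.IH)
qed simp

lemma times_differentiable_coord: "times_differentiable n (\<lambda>x. x $ j)"
  by (cases n) (auto simp: partial_coord times_differentiable_const
      intro!: bounded_linear_imp_differentiable bounded_linear_vec_nth)

lemma smooth_const: "smooth (\<lambda>x. c)"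
  and smooth_coord: "smooth (\<lambda>x. x $ j)"
  and smooth_add: "smooth f \<Longrightarrow> smooth g \<Longrightarrow> smooth (\<lambda>x. f x + g x)"
  and smooth_mult: "smooth f \<Longrightarrow> smooth g \<Longrightarrow> smooth (\<lambda>x. f x * g x)"
  by (auto simp: smooth_def times_differentiable_const times_differentiable_coord
      times_differentiable_add times_differentiable_mult)

lemma smooth_prod: "(\<And>i. i \<in> I \<Longrightarrow> smooth (f i)) \<Longrightarrow> smooth (\<lambda>x. \<Prod>i\<in>I. f i x)"
  by (induction I rule: infinite_finite_induct) (auto intro: smooth_const smooth_mult)

lemma smooth_differentiable: "smooth f \<Longrightarrow> f differentiable (at x)"
  unfolding smooth_def by (metis times_differentiable.simps(2))

lemma smooth_partial: "smooth f \<Longrightarrow> smooth (partial i f)"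
  unfolding smooth_def by (metis times_differentiable.simps(2))

lemma smooth_continuous: "smooth f \<Longrightarrow> continuous_on S f"
  using smooth_differentiable differentiable_imp_continuous_within
  by (blast intro: continuous_at_imp_continuous_on)

lemmas smooth_partial_add = partial_add[OF smooth_differentiable smooth_differentiable]
lemmas smooth_partial_mult = partial_mult[OF smooth_differentiable smooth_differentiable]

subsection \<open>Test functions\<close>

text \<open>Any compact \<open>K\<close> inside \<Omega> off which \<phi> vanishes will do, so
  supports never have to be computed.\<close>

lemma test_functionsI:
  assumes "smooth \<phi>" "compact K" "K \<subseteq> \<Omega>" "\<And>x. x \<notin> K \<Longrightarrow> \<phi> x = 0"
  shows "\<phi> \<in> test_functions \<Omega>"
proof -
  have "closure {x. \<phi> x \<noteq> 0} \<subseteq> K"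
    by (rule closure_minimal) (use assms in \<open>auto simp: compact_imp_closed\<close>)
  moreover from this have "compact (closure {x. \<phi> x \<noteq> 0})"
    using compact_Int_closed[OF assms(2) closed_closure] by (metis inf.absorb2)
  ultimately show ?thesis
    using assms(1,3) unfolding test_functions_def smooth_def by blast
qed

text \<open>The witness \<open>K\<close> is the closed support. Its complement is open and \<phi> is
  zero there, hence so are its derivatives.\<close>

lemma test_functionsE:
  assumes "\<phi> \<in> test_functions \<Omega>"
  obtains K where "smooth \<phi>" "compact K" "K \<subseteq> \<Omega>" "\<And>x. x \<notin> K \<Longrightarrow> \<phi> x = 0"
    "\<And>x i. x \<notin> K \<Longrightarrow> partial i \<phi> x = 0"
proof
  let ?K = "closure {x. \<phi> x \<noteq> 0}"
  show "smooth \<phi>" "compact ?K" "?K \<subseteq> \<Omega>"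
    using assms unfolding test_functions_def smooth_def by blast+
  show z: "\<phi> x = 0" if "x \<notin> ?K" for x
    using that closure_subset[of "{x. \<phi> x \<noteq> 0}"] by blast
  show "partial i \<phi> x = 0" if "x \<notin> ?K" for x i
  proof -
    have "(\<phi> has_derivative (\<lambda>_. 0)) (at x)"
      by (rule has_derivative_transform_within_open[where s = "- ?K" and f = "\<lambda>_. 0"])
         (rule has_derivative_const, simp add: open_Compl, use that in simp, use z in \<open>metis ComplD\<close>)
    then show ?thesis by (rule partial_eqI)
  qed
qed

lemma test_functions_smooth: "\<phi> \<in> test_functions \<Omega> \<Longrightarrow> smooth \<phi>"
  unfolding test_functions_def smooth_def by blast

lemma test_functions_add:
  assumes "\<phi> \<in> test_functions \<Omega>" "\<psi> \<in> test_functions \<Omega>"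
  shows "(\<lambda>x. \<phi> x + \<psi> x) \<in> test_functions \<Omega>"
proof -
  obtain K where K: "smooth \<phi>" "compact K" "K \<subseteq> \<Omega>" "\<And>x. x \<notin> K \<Longrightarrow> \<phi> x = 0"
    by (rule test_functionsE[OF assms(1)], rule that)
  obtain L where L: "smooth \<psi>" "compact L" "L \<subseteq> \<Omega>" "\<And>x. x \<notin> L \<Longrightarrow> \<psi> x = 0"
    by (rule test_functionsE[OF assms(2)], rule that)
  show ?thesis
  proof (rule test_functionsI[where K = "K \<union> L"])
    show "compact (K \<union> L)" "K \<union> L \<subseteq> \<Omega>" using K L by auto
    show "smooth (\<lambda>x. \<phi> x + \<psi> x)" using K L by (intro smooth_add)
    show "\<phi> x + \<psi> x = 0" if "x \<notin> K \<union> L" for x using that K L by simp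
  qed
qed

lemma test_functions_mult:
  assumes "smooth \<phi>" "\<psi> \<in> test_functions \<Omega>"
  shows "(\<lambda>x. \<phi> x * \<psi> x) \<in> test_functions \<Omega>"
proof -
  obtain L where L: "smooth \<psi>" "compact L" "L \<subseteq> \<Omega>" "\<And>x. x \<notin> L \<Longrightarrow> \<psi> x = 0"
    by (rule test_functionsE[OF assms(2)], rule that)
  show ?thesis
    by (rule test_functionsI[where K = L]) (use assms L in \<open>simp_all add: smooth_mult\<close>)
qed

lemma test_functions_partial:
  assumes "\<phi> \<in> test_functions \<Omega>"
  shows "partial i \<phi> \<in> test_functions \<Omega>"
proof -
  obtain K where "smooth \<phi>" "compact K" "K \<subseteq> \<Omega>" "\<And>x. x \<notin> K \<Longrightarrow> partial i \<phi> x = 0"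
    by (rule test_functionsE[OF assms], rule that)
  then show ?thesis
    by (intro test_functionsI[where K = K] smooth_partial)
qed

lemma test_functions_zero: "(\<lambda>x. 0) \<in> test_functions \<Omega>"
  by (rule test_functionsI[where K = "{}"]) (auto intro: smooth_const)

lemma partial_cmult: "smooth \<phi> \<Longrightarrow> partial i (\<lambda>x. c * \<phi> x) = (\<lambda>x. c * partial i \<phi> x)"
  by (simp add: smooth_partial_mult smooth_const)

subsection \<open>Bump functions\<close>

text \<open>The polynomial parameter makes the family closed under differentiation; the classical
  flat function exp(-1/t), extended by zero, is \<open>flat 1\<close>.\<close>

definition flat :: "real poly \<Rightarrow> real \<Rightarrow> real" where
  "flat p t = (if t > 0 then poly p (1/t) * exp (- (1/t)) else 0)"

lemma poly_times_exp_minus_tendsto_0: "((\<lambda>x::real. poly p x * exp (- x)) \<longlongrightarrow> 0) at_top"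
proof -
  have "((\<lambda>x::real. \<Sum>i\<le>degree p. coeff p i * (x ^ i / exp x)) \<longlongrightarrow> (\<Sum>i\<le>degree p. coeff p i * 0)) at_top"
    by (intro tendsto_intros tendsto_power_div_exp_0)
  then show ?thesis
    by (simp add: poly_altdef sum_distrib_right exp_minus divide_inverse mult.assoc)
qed

lemma flat_tendsto_0: "(flat p \<longlongrightarrow> 0) (at 0)"
proof -
  have "((\<lambda>t::real. poly p (inverse t) * exp (- inverse t)) \<longlongrightarrow> 0) (at_right 0)"
    by (rule filterlim_compose[OF poly_times_exp_minus_tendsto_0 filterlim_inverse_at_top_right])
  then have "(flat p \<longlongrightarrow> 0) (at_right 0)"
    by (rule Lim_transform_eventually)
       (auto simp: flat_def eventually_at_right_field field_simps intro!: exI[of _ 1])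
  moreover have "(flat p \<longlongrightarrow> 0) (at_left 0)"
    by (rule Lim_transform_eventually[OF tendsto_const])
       (auto simp: flat_def eventually_at_left_field intro!: exI[of _ "-1"])
  ultimately show ?thesis by (simp add: filterlim_split_at)
qed

text \<open>With s = 1/t, differentiating p(s) exp(-s) in t gives s^2 (p(s) - p'(s)) exp(-s); the
  two \<open>pCons 0\<close> are the factor s^2.\<close>

lemma flat_has_derivative:
  "(flat p has_real_derivative flat (pCons 0 (pCons 0 (p - pderiv p))) t) (at t)"
proof -
  consider "t > 0" | "t < 0" | "t = 0" by linarith
  then show ?thesis
  proof cases
    case 1
    have "((\<lambda>t. poly p (1/t) * exp (- (1/t))) has_real_derivative
        flat (pCons 0 (pCons 0 (p - pderiv p))) t) (at t)"
      using 1 by (auto intro!: derivative_eq_intros DERIV_chain2[OF poly_DERIV]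
          simp: flat_def field_simps power2_eq_square)
    then show ?thesis
      by (rule has_field_derivative_transform_within_open[where S = "{0<..}"])
         (use 1 in \<open>auto simp: flat_def\<close>)
  next
    case 2
    have "((\<lambda>t. 0) has_real_derivative flat (pCons 0 (pCons 0 (p - pderiv p))) t) (at t)"
      using 2 by (auto simp: flat_def)
    then show ?thesis
      by (rule has_field_derivative_transform_within_open[where S = "{..<0}"])
         (use 2 in \<open>auto simp: flat_def\<close>)
  next
    case 3
    \<comment> \<open>The difference quotient at the origin is again a member of the family, with
      one more factor 1/h, so its limit is already known.\<close>
    have "(\<lambda>h. (flat p (0 + h) - flat p 0) / h) = flat (pCons 0 p)"
      by (auto simp: flat_def fun_eq_iff)
    then show ?thesis
      using 3 flat_tendsto_0[of "pCons 0 p"] by (simp add: DERIV_def) (simp add: flat_def)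
  qed
qed

text \<open>Each derivative changes the polynomial, so the induction on the order is over all
  \<open>p\<close> at once.\<close>

lemma smooth_flat: "smooth (\<lambda>x. flat p (s * x $ i + c))"
proof -
  have "times_differentiable n (\<lambda>x. flat p (s * x $ i + c))" for n
  proof (induction n arbitrary: p)
    case (Suc n)
    have D: "((\<lambda>x. flat p (s * x $ i + c)) has_derivative
        (\<lambda>h. (s * h $ i) * flat (pCons 0 (pCons 0 (p - pderiv p))) (s * x $ i + c))) (at x)" for x
    proof -
      have "((\<lambda>x. s * x $ i + c) has_derivative (\<lambda>h. s * h $ i)) (at x)"
        by (auto intro!: derivative_eq_intros bounded_linear.has_derivative[OF bounded_linear_vec_nth])
      from DERIV_compose_FDERIV[OF flat_has_derivative this] show ?thesis .
    qed
    have "partial j (\<lambda>x. flat p (s * x $ i + c)) =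
        (\<lambda>x. (if i = j then s else 0) * flat (pCons 0 (pCons 0 (p - pderiv p))) (s * x $ i + c))" for j
      by (rule ext, subst partial_eqI[OF D]) (auto simp: axis_def)
    then show ?case
      using Suc.IH differentiableI[OF D]
      by (simp add: times_differentiable_mult times_differentiable_const)
  qed simp
  then show ?thesis by (simp add: smooth_def)
qed

text \<open>The arguments are spelled out as affine functions of a coordinate to match
  \<open>smooth_flat\<close>. The parameter \<open>s\<close> is a steepness: as it grows, the
  function approaches the indicator of the open box.\<close>

definition bump :: "real \<Rightarrow> real^'d \<Rightarrow> real^'d \<Rightarrow> real^'d \<Rightarrow> real" where
  "bump s a b x = (\<Prod>i\<in>UNIV. flat 1 (s * x $ i + (- s * a $ i)) * flat 1 ((- s) * x $ i + s * b $ i))"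

lemma bump_altdef: "bump s a b x = (\<Prod>i\<in>UNIV. flat 1 (s * (x $ i - a $ i)) * flat 1 (s * (b $ i - x $ i)))"
  by (simp add: bump_def right_diff_distrib)

lemma flat_1_bounds: "0 \<le> flat 1 t" "flat 1 t \<le> 1"
  by (auto simp: flat_def)

lemma bump_bounds: "0 \<le> bump s a b x" "bump s a b x \<le> 1"
  unfolding bump_def by (auto intro!: prod_nonneg prod_le_1 mult_le_one flat_1_bounds mult_nonneg_nonneg)

lemma bump_eq_0: "s > 0 \<Longrightarrow> x \<notin> box a b \<Longrightarrow> bump s a b x = 0"
  by (auto simp: bump_def mem_box_cart flat_def mult_less_cancel_left_pos)

lemma bump_pos: "s > 0 \<Longrightarrow> x \<in> box a b \<Longrightarrow> bump s a b x > 0"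
  by (auto simp: bump_def mem_box_cart flat_def intro!: prod_pos mult_pos_pos)

lemma bump_test_function:
  assumes "s > 0" "cbox a b \<subseteq> \<Omega>"
  shows "bump s a b \<in> test_functions \<Omega>"
proof (rule test_functionsI[where K = "cbox a b"])
  show "smooth (bump s a b)"
    unfolding bump_def[abs_def] by (intro smooth_prod smooth_mult smooth_flat)
  show "bump s a b x = 0" if "x \<notin> cbox a b" for x
    using that bump_eq_0[OF assms(1)] box_subset_cbox by blast
qed (use assms in auto)

text \<open>Inside the box every factor is exp(-1/(n t)) with a fixed t > 0 and tends to 1; outside,
  some factor is zero for every n. \<open>Suc n\<close> keeps the steepness positive.\<close>

lemma bump_tendsto_indicator:
  fixes a b x :: "real^'d"
  shows "(\<lambda>n. bump (real (Suc n)) a b x) \<longlonglongrightarrow> indicator (box a b) x"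
proof (cases "x \<in> box a b")
  case True
  have *: "(\<lambda>n. flat 1 (real (Suc n) * t)) \<longlonglongrightarrow> 1" if "t > 0" for t
  proof -
    have "(\<lambda>n. exp (- (inverse (real (Suc n)) * (1 / t)))) \<longlonglongrightarrow> exp (- (0 * (1 / t)))"
      by (intro tendsto_intros LIMSEQ_inverse_real_of_nat)
    moreover have "flat 1 (real (Suc n) * t) = exp (- (inverse (real (Suc n)) * (1 / t)))" for n
      using that by (simp add: flat_def inverse_eq_divide del: of_nat_Suc)
    ultimately show ?thesis by (simp only: mult_zero_left minus_zero exp_zero)
  qed
  have "(\<lambda>n. \<Prod>i\<in>UNIV. flat 1 (real (Suc n) * (x $ i - a $ i)) * flat 1 (real (Suc n) * (b $ i - x $ i)))
      \<longlonglongrightarrow> (\<Prod>i\<in>(UNIV::'d set). 1 * 1)"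
    by (intro tendsto_prod tendsto_mult *) (use True in \<open>auto simp: mem_box_cart\<close>)
  then show ?thesis
    using True by (simp add: bump_altdef del: of_nat_Suc)
next
  case False
  then show ?thesis by (simp add: bump_eq_0)
qed

section \<open>The Lebesgue space as an inner product space\<close>

lemma L2_measurable: "u \<in> L2 \<Omega> \<Longrightarrow> u \<in> borel_measurable (lebesgue_on \<Omega>)"
  by (simp add: L2_def)

lemma L2_inner_integrable:
  assumes "u \<in> L2 \<Omega>" "v \<in> L2 \<Omega>"
  shows "integrable (lebesgue_on \<Omega>) (\<lambda>x. u x \<bullet> v x)"
proof (rule Bochner_Integration.integrable_bound)
  show "integrable (lebesgue_on \<Omega>) (\<lambda>x. (norm (u x))\<^sup>2 + (norm (v x))\<^sup>2)"
    using assms by (simp add: L2_def)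
  show "(\<lambda>x. u x \<bullet> v x) \<in> borel_measurable (lebesgue_on \<Omega>)"
    using assms by (intro borel_measurable_inner L2_measurable)
  have "\<bar>u x \<bullet> v x\<bar> \<le> (norm (u x))\<^sup>2 + (norm (v x))\<^sup>2" for x
  proof -
    have "2 * (norm (u x) * norm (v x)) \<le> (norm (u x))\<^sup>2 + (norm (v x))\<^sup>2"
      using sum_squares_bound[of "norm (u x)" "norm (v x)"] by simp
    moreover have "0 \<le> norm (u x) * norm (v x)" by simp
    ultimately show ?thesis
      using Cauchy_Schwarz_ineq2[of "u x" "v x"] by linarith
  qed
  then show "AE x in lebesgue_on \<Omega>. norm (u x \<bullet> v x) \<le> norm ((norm (u x))\<^sup>2 + (norm (v x))\<^sup>2)"
    by simp
qed

lemma L2I: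
  assumes "u \<in> borel_measurable (lebesgue_on \<Omega>)" "integrable (lebesgue_on \<Omega>) (\<lambda>x. u x \<bullet> u x)"
  shows "u \<in> L2 \<Omega>"
  using assms by (simp add: L2_def power2_norm_eq_inner)

lemma L2_scaleR: "u \<in> L2 \<Omega> \<Longrightarrow> (\<lambda>x. c *\<^sub>R u x) \<in> L2 \<Omega>"
  by (auto simp: L2_def power_mult_distrib)

lemma L2_add:
  assumes "u \<in> L2 \<Omega>" "v \<in> L2 \<Omega>"
  shows "(\<lambda>x. u x + v x) \<in> L2 \<Omega>"
proof (rule L2I)
  show "(\<lambda>x. u x + v x) \<in> borel_measurable (lebesgue_on \<Omega>)"
    using assms by (intro borel_measurable_add L2_measurable)
  show "integrable (lebesgue_on \<Omega>) (\<lambda>x. (u x + v x) \<bullet> (u x + v x))"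
    unfolding inner_add_left inner_add_right
    using assms by (intro Bochner_Integration.integrable_add L2_inner_integrable)
qed

lemma L2_uminus: "u \<in> L2 \<Omega> \<Longrightarrow> (\<lambda>x. - u x) \<in> L2 \<Omega>"
  using L2_scaleR[of u \<Omega> "-1"] by simp

lemma L2_diff: "u \<in> L2 \<Omega> \<Longrightarrow> v \<in> L2 \<Omega> \<Longrightarrow> (\<lambda>x. u x - v x) \<in> L2 \<Omega>"
  using L2_add[of u \<Omega> "\<lambda>x. - v x"] L2_uminus[of v \<Omega>] by simp

lemma L2_inner_commute: "L2_inner \<Omega> u v = L2_inner \<Omega> v u"
  by (simp add: L2_inner_def inner_commute)

lemma L2_inner_add_left:
  "u \<in> L2 \<Omega> \<Longrightarrow> v \<in> L2 \<Omega> \<Longrightarrow> w \<in> L2 \<Omega> \<Longrightarrow>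
    L2_inner \<Omega> (\<lambda>x. u x + v x) w = L2_inner \<Omega> u w + L2_inner \<Omega> v w"
  by (simp add: L2_inner_def inner_add_left L2_inner_integrable)

lemma L2_inner_diff_left:
  "u \<in> L2 \<Omega> \<Longrightarrow> v \<in> L2 \<Omega> \<Longrightarrow> w \<in> L2 \<Omega> \<Longrightarrow>
    L2_inner \<Omega> (\<lambda>x. u x - v x) w = L2_inner \<Omega> u w - L2_inner \<Omega> v w"
  by (simp add: L2_inner_def inner_diff_left L2_inner_integrable)

lemma L2_inner_add_right:
  "u \<in> L2 \<Omega> \<Longrightarrow> v \<in> L2 \<Omega> \<Longrightarrow> w \<in> L2 \<Omega> \<Longrightarrow>
    L2_inner \<Omega> w (\<lambda>x. u x + v x) = L2_inner \<Omega> w u + L2_inner \<Omega> w v"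
  by (simp add: L2_inner_def inner_add_right L2_inner_integrable)

lemma L2_inner_diff_right:
  "u \<in> L2 \<Omega> \<Longrightarrow> v \<in> L2 \<Omega> \<Longrightarrow> w \<in> L2 \<Omega> \<Longrightarrow>
    L2_inner \<Omega> w (\<lambda>x. u x - v x) = L2_inner \<Omega> w u - L2_inner \<Omega> w v"
  by (simp add: L2_inner_def inner_diff_right L2_inner_integrable)

lemma L2_inner_scaleR_left: "L2_inner \<Omega> (\<lambda>x. c *\<^sub>R u x) v = c * L2_inner \<Omega> u v"
  by (simp add: L2_inner_def)

lemma L2_inner_cmult_left: "L2_inner \<Omega> (\<lambda>x. c * u x) v = c * L2_inner \<Omega> u v"
  for u v :: "real^'d \<Rightarrow> real"
  using L2_inner_scaleR_left[of \<Omega> c u v] by simp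

lemma L2_inner_scaleR_right: "L2_inner \<Omega> u (\<lambda>x. c *\<^sub>R v x) = c * L2_inner \<Omega> u v"
  by (simp add: L2_inner_def)

lemma L2_inner_nonneg: "0 \<le> L2_inner \<Omega> u u"
  by (simp add: L2_inner_def)

lemma L2_norm_nonneg [simp]: "0 \<le> L2_norm \<Omega> u"
  by (simp add: L2_norm_def L2_inner_nonneg)

lemma L2_norm_power2: "(L2_norm \<Omega> u)\<^sup>2 = L2_inner \<Omega> u u"
  by (simp add: L2_norm_def L2_inner_nonneg)

lemma L2_norm_scaleR: "L2_norm \<Omega> (\<lambda>x. c *\<^sub>R u x) = \<bar>c\<bar> * L2_norm \<Omega> u"
  by (simp add: L2_norm_def L2_inner_scaleR_left L2_inner_scaleR_right real_sqrt_mult flip: mult.assoc)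

lemma L2_norm_uminus: "L2_norm \<Omega> (\<lambda>x. - u x) = L2_norm \<Omega> u"
  using L2_norm_scaleR[of \<Omega> "-1" u] by simp

text \<open>The quadratic t -> |u + t v|^2 is nonnegative. On representatives the form is only
  semidefinite, so a \<open>v\<close> of norm zero needs its own case.\<close>

lemma L2_Cauchy_Schwarz:
  assumes u: "u \<in> L2 \<Omega>" and v: "v \<in> L2 \<Omega>"
  shows "\<bar>L2_inner \<Omega> u v\<bar> \<le> L2_norm \<Omega> u * L2_norm \<Omega> v"
proof -
  let ?A = "L2_inner \<Omega> u u" and ?B = "L2_inner \<Omega> u v" and ?C = "L2_inner \<Omega> v v"
  have q: "0 \<le> ?A + 2 * t * ?B + t\<^sup>2 * ?C" for t
  proof -
    note tv = L2_scaleR[OF v, of t]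
    have "0 \<le> L2_inner \<Omega> (\<lambda>x. u x + t *\<^sub>R v x) (\<lambda>x. u x + t *\<^sub>R v x)"
      by (rule L2_inner_nonneg)
    also have "\<dots> = ?A + 2 * t * ?B + t\<^sup>2 * ?C"
      using u v tv by (simp add: L2_inner_add_left L2_inner_add_right L2_add
          L2_inner_scaleR_left L2_inner_scaleR_right L2_inner_commute[of \<Omega> v u] power2_eq_square algebra_simps)
    finally show ?thesis .
  qed
  have "?B\<^sup>2 \<le> ?A * ?C"
  proof (cases "?C = 0")
    case True
    have "?B = 0"
    proof (rule ccontr)
      assume "?B \<noteq> 0"
      \<comment> \<open>With \<open>?C = 0\<close> the quadratic is affine in t, and at this t it
        would equal -1.\<close>
      then show False
        using q[of "- (?A + 1) / (2 * ?B)"] True by (simp add: field_simps)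
    qed
    then show ?thesis using True by simp
  next
    case False
    then have "?C > 0" using L2_inner_nonneg[of \<Omega> v] by linarith
    \<comment> \<open>The quadratic is evaluated at its minimizer.\<close>
    then show ?thesis
      using q[of "- ?B / ?C"] by (simp add: field_simps power2_eq_square)
  qed
  then have "\<bar>?B\<bar> \<le> sqrt (?A * ?C)" by (simp add: real_le_rsqrt abs_le_square_iff)
  then show ?thesis by (simp add: L2_norm_def real_sqrt_mult)
qed

lemma L2_norm_triangle:
  assumes u: "u \<in> L2 \<Omega>" and v: "v \<in> L2 \<Omega>"
  shows "L2_norm \<Omega> (\<lambda>x. u x + v x) \<le> L2_norm \<Omega> u + L2_norm \<Omega> v"
proof (rule power2_le_imp_le)
  have "(L2_norm \<Omega> (\<lambda>x. u x + v x))\<^sup>2 = (L2_norm \<Omega> u)\<^sup>2 + 2 * L2_inner \<Omega> u v + (L2_norm \<Omega> v)\<^sup>2"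
    unfolding L2_norm_power2
    using u v by (simp add: L2_inner_add_left L2_inner_add_right L2_add L2_inner_commute[of \<Omega> v u])
  also have "\<dots> \<le> (L2_norm \<Omega> u + L2_norm \<Omega> v)\<^sup>2"
    using L2_Cauchy_Schwarz[OF u v] by (simp add: power2_sum)
  finally show "(L2_norm \<Omega> (\<lambda>x. u x + v x))\<^sup>2 \<le> (L2_norm \<Omega> u + L2_norm \<Omega> v)\<^sup>2" .
qed simp

lemma L2_norm_triangle_diff:
  assumes u: "u \<in> L2 \<Omega>" and v: "v \<in> L2 \<Omega>"
  shows "L2_norm \<Omega> u \<le> L2_norm \<Omega> (\<lambda>x. u x - v x) + L2_norm \<Omega> v"
  using L2_norm_triangle[OF L2_diff[OF u v] v] by simp

lemma L2_inner_cong_AE: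
  assumes "u \<in> borel_measurable (lebesgue_on \<Omega>)" "u' \<in> borel_measurable (lebesgue_on \<Omega>)"
    "v \<in> borel_measurable (lebesgue_on \<Omega>)" "v' \<in> borel_measurable (lebesgue_on \<Omega>)"
    "AE x in lebesgue_on \<Omega>. u x = u' x" "AE x in lebesgue_on \<Omega>. v x = v' x"
  shows "L2_inner \<Omega> u v = L2_inner \<Omega> u' v'"
  unfolding L2_inner_def
  by (rule integral_cong_AE) (use assms in \<open>auto intro: borel_measurable_inner\<close>)

lemma L2_norm_cong_AE:
  assumes "u \<in> borel_measurable (lebesgue_on \<Omega>)" "v \<in> borel_measurable (lebesgue_on \<Omega>)"
    "AE x in lebesgue_on \<Omega>. u x = v x"
  shows "L2_norm \<Omega> u = L2_norm \<Omega> v"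
  unfolding L2_norm_def using L2_inner_cong_AE[OF assms(1,2,1,2,3,3)] by simp

lemma L2_norm_eq_0_AE:
  assumes "u \<in> L2 \<Omega>" "L2_norm \<Omega> u = 0"
  shows "AE x in lebesgue_on \<Omega>. u x = 0"
proof -
  have "L2_inner \<Omega> u u = 0"
    using assms(2) L2_norm_power2[of \<Omega> u] by simp
  then have "AE x in lebesgue_on \<Omega>. u x \<bullet> u x = 0"
    using integral_nonneg_eq_0_iff_AE[OF L2_inner_integrable[OF assms(1,1)]]
    by (simp add: L2_inner_def)
  then show ?thesis by simp
qed

lemma L2_norm_eq_0: "AE x in lebesgue_on \<Omega>. u x = 0 \<Longrightarrow> L2_norm \<Omega> u = 0"
  by (simp add: L2_norm_def L2_inner_def integral_eq_zero_AE)

text \<open>The component type is left general so that one lemma serves vector fields, whose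
  components are real, and matrix fields, whose components are the rows.\<close>

lemma L2_vecI:
  fixes u :: "real^'d \<Rightarrow> ('b::euclidean_space)^'n"
  assumes "\<And>i. (\<lambda>x. u x $ i) \<in> L2 \<Omega>"
  shows "u \<in> L2 \<Omega>"
proof (rule L2I)
  show "u \<in> borel_measurable (lebesgue_on \<Omega>)"
  proof (subst borel_measurable_euclidean_space, safe)
    fix b :: "'b^'n" assume "b \<in> Basis"
    then obtain i c where b: "b = axis i c" by (auto simp: Basis_vec_def)
    have "(\<lambda>x. u x $ i \<bullet> c) \<in> borel_measurable (lebesgue_on \<Omega>)"
      by (intro borel_measurable_inner L2_measurable assms borel_measurable_const)
    then show "(\<lambda>x. u x \<bullet> b) \<in> borel_measurable (lebesgue_on \<Omega>)"
      by (simp add: b inner_axis)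
  qed
  show "integrable (lebesgue_on \<Omega>) (\<lambda>x. u x \<bullet> u x)"
    unfolding inner_vec_def
    by (intro Bochner_Integration.integrable_sum L2_inner_integrable assms)
qed

lemma L2_component:
  fixes u :: "real^'d \<Rightarrow> ('b::euclidean_space)^'n"
  assumes "u \<in> L2 \<Omega>"
  shows "(\<lambda>x. u x $ i) \<in> L2 \<Omega>"
proof -
  have m: "(\<lambda>x. u x $ i) \<in> borel_measurable (lebesgue_on \<Omega>)"
    by (rule borel_measurable_continuous_on[OF _ L2_measurable[OF assms]])
       (auto intro: continuous_intros)
  show ?thesis
  proof (rule L2I[OF m], rule Bochner_Integration.integrable_bound)
    show "integrable (lebesgue_on \<Omega>) (\<lambda>x. u x \<bullet> u x)"
      by (rule L2_inner_integrable[OF assms assms])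
    show "(\<lambda>x. u x $ i \<bullet> u x $ i) \<in> borel_measurable (lebesgue_on \<Omega>)"
      by (intro borel_measurable_inner m)
    have "u x $ i \<bullet> u x $ i \<le> u x \<bullet> u x" for x
      unfolding inner_vec_def by (rule member_le_sum) auto
    then show "AE x in lebesgue_on \<Omega>. norm (u x $ i \<bullet> u x $ i) \<le> norm (u x \<bullet> u x)"
      by simp
  qed
qed

lemma L2_inner_vec:
  fixes u v :: "real^'d \<Rightarrow> ('b::euclidean_space)^'n"
  assumes "u \<in> L2 \<Omega>" "v \<in> L2 \<Omega>"
  shows "L2_inner \<Omega> u v = (\<Sum>i\<in>UNIV. L2_inner \<Omega> (\<lambda>x. u x $ i) (\<lambda>x. v x $ i))"
  unfolding L2_inner_def
  by (subst inner_vec_def, rule Bochner_Integration.integral_sum)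
     (intro L2_inner_integrable L2_component assms)

lemma L2_norm_component_le:
  fixes u :: "real^'d \<Rightarrow> ('b::euclidean_space)^'n"
  assumes "u \<in> L2 \<Omega>"
  shows "L2_norm \<Omega> (\<lambda>x. u x $ i) \<le> L2_norm \<Omega> u"
proof -
  have "L2_inner \<Omega> (\<lambda>x. u x $ i) (\<lambda>x. u x $ i) \<le> L2_inner \<Omega> u u"
    unfolding L2_inner_vec[OF assms assms] by (rule member_le_sum) (auto simp: L2_inner_nonneg)
  then show ?thesis by (simp add: L2_norm_def)
qed

text \<open>L^4 is not introduced as a space; membership means that the square lies in
  \<open>L2\<close>. The product estimate is then Cauchy-Schwarz for the two squares.\<close>

lemma L2_mult:
  fixes a b :: "real^'d \<Rightarrow> real"
  assumes a: "a \<in> borel_measurable (lebesgue_on \<Omega>)" "(\<lambda>x. (a x)\<^sup>2) \<in> L2 \<Omega>"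
    and b: "b \<in> borel_measurable (lebesgue_on \<Omega>)" "(\<lambda>x. (b x)\<^sup>2) \<in> L2 \<Omega>"
  shows "(\<lambda>x. a x * b x) \<in> L2 \<Omega>"
    and "(L2_norm \<Omega> (\<lambda>x. a x * b x))\<^sup>2 \<le> L2_norm \<Omega> (\<lambda>x. (a x)\<^sup>2) * L2_norm \<Omega> (\<lambda>x. (b x)\<^sup>2)"
proof -
  have eq: "(a x * b x) \<bullet> (a x * b x) = (a x)\<^sup>2 \<bullet> (b x)\<^sup>2" for x
    by (simp add: power2_eq_square)
  show "(\<lambda>x. a x * b x) \<in> L2 \<Omega>"
    by (rule L2I) (use a b L2_inner_integrable[OF a(2) b(2)] in \<open>auto simp only: eq intro: borel_measurable_times\<close>)
  have "(L2_norm \<Omega> (\<lambda>x. a x * b x))\<^sup>2 = L2_inner \<Omega> (\<lambda>x. (a x)\<^sup>2) (\<lambda>x. (b x)\<^sup>2)"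
    unfolding L2_norm_power2 L2_inner_def eq ..
  also have "\<dots> \<le> L2_norm \<Omega> (\<lambda>x. (a x)\<^sup>2) * L2_norm \<Omega> (\<lambda>x. (b x)\<^sup>2)"
    using L2_Cauchy_Schwarz[OF a(2) b(2)] by linarith
  finally show "(L2_norm \<Omega> (\<lambda>x. a x * b x))\<^sup>2 \<le> L2_norm \<Omega> (\<lambda>x. (a x)\<^sup>2) * L2_norm \<Omega> (\<lambda>x. (b x)\<^sup>2)" .
qed

section \<open>Integration of test functions\<close>

lemma smooth_borel: "smooth \<phi> \<Longrightarrow> \<phi> \<in> borel_measurable borel"
  by (intro borel_measurable_continuous_onI smooth_continuous)

lemma smooth_line_derivative:
  assumes "smooth \<phi>"
  shows "((\<lambda>t. \<phi> (x + t *\<^sub>R axis i 1)) has_real_derivative partial i \<phi> (x + t *\<^sub>R axis i 1)) (at t)"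
proof -
  let ?D = "frechet_derivative \<phi> (at (x + t *\<^sub>R axis i 1))"
  have D: "(\<phi> has_derivative ?D) (at (x + t *\<^sub>R axis i 1))"
    by (rule differentiable_has_derivative[OF smooth_differentiable[OF assms]])
  have "((\<lambda>t. x + t *\<^sub>R axis i 1) has_derivative (\<lambda>t. t *\<^sub>R axis i 1)) (at t)"
    by (auto intro!: derivative_eq_intros)
  from has_derivative_compose[OF this D]
  have "((\<lambda>t. \<phi> (x + t *\<^sub>R axis i 1)) has_derivative (\<lambda>t. ?D (t *\<^sub>R axis i 1))) (at t)" .
  moreover have "(\<lambda>t. ?D (t *\<^sub>R axis i 1)) = (*) (partial i \<phi> (x + t *\<^sub>R axis i 1))"
    using linear_scale[OF has_derivative_linear[OF D]] by (auto simp: partial_def)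
  ultimately show ?thesis by (simp add: has_field_derivative_def)
qed

lemma test_function_bounded:
  assumes "\<phi> \<in> test_functions \<Omega>"
  obtains B where "B > 0" "\<And>x. \<bar>\<phi> x\<bar> \<le> B"
proof -
  obtain K where K: "smooth \<phi>" "compact K" "\<And>x. x \<notin> K \<Longrightarrow> \<phi> x = 0"
    by (rule test_functionsE[OF assms], rule that)
  have "bounded (\<phi> ` K)"
    by (intro compact_imp_bounded compact_continuous_image smooth_continuous K)
  then obtain B where B: "B > 0" "\<And>x. x \<in> K \<Longrightarrow> \<bar>\<phi> x\<bar> \<le> B"
    unfolding bounded_pos by auto
  show thesis
  proof (rule that[OF B(1)])
    show "\<bar>\<phi> x\<bar> \<le> B" for x using B K(3)[of x] by (cases "x \<in> K") auto
  qed
qed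

lemma test_function_support:
  fixes \<phi> :: "real^'d \<Rightarrow> real"
  assumes "\<phi> \<in> test_functions \<Omega>"
  obtains R where "R > 0" "\<And>x. norm x \<ge> R \<Longrightarrow> \<phi> x = 0"
proof -
  obtain K where K: "smooth \<phi>" "compact K" "\<And>x. x \<notin> K \<Longrightarrow> \<phi> x = 0"
    by (rule test_functionsE[OF assms], rule that)
  obtain R where "R > 0" "\<And>x. x \<in> K \<Longrightarrow> norm x \<le> R"
    using compact_imp_bounded[OF K(2)] unfolding bounded_pos by auto
  then show thesis
    using K(3) that[of "R + 1"] by force
qed

text \<open>The integral is invariant under translation, so the integrals of the difference quotients
  vanish.\<close>

lemma integral_partial_eq_0:
  fixes \<phi> :: "real^'d \<Rightarrow> real"
  assumes \<phi>: "\<phi> \<in> test_functions \<Omega>"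
  shows "(\<integral>x. partial i \<phi> x \<partial>lborel) = 0"
proof -
  let ?e = "axis i 1 :: real^'d"
  define F where "F n x = real (Suc n) * (\<phi> (x + inverse (real (Suc n)) *\<^sub>R ?e) - \<phi> x)" for n x
  have sm: "smooth \<phi>" by (rule test_functions_smooth[OF \<phi>])
  have [measurable]: "\<phi> \<in> borel_measurable borel" "partial i \<phi> \<in> borel_measurable borel"
    using smooth_borel[OF sm] smooth_borel[OF smooth_partial[OF sm]] .
  obtain R where R: "R > 0" "\<And>x. norm x \<ge> R \<Longrightarrow> \<phi> x = 0"
    using test_function_support[OF \<phi>] by blast
  obtain B where B: "B > 0" "\<And>x. \<bar>partial i \<phi> x\<bar> \<le> B"
    using test_function_bounded[OF test_functions_partial[OF \<phi>]] by blast
  obtain B' where B': "B' > 0" "\<And>x. \<bar>\<phi> x\<bar> \<le> B'"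
    using test_function_bounded[OF \<phi>] by blast
  \<comment> \<open>Multiples of ball indicators serve as integrable majorants, for \<phi> itself
    and for its difference quotients.\<close>
  have cb: "integrable lborel (\<lambda>x::real^'d. c * indicator (cball 0 r) x)" for c r :: real
    by (intro integrable_mult_right integrable_real_indicator)
       (use emeasure_lborel_cball_finite[of "0::real^'d" r] in \<open>auto simp: infinity_ennreal_def\<close>)
  have int: "integrable lborel \<phi>"
  proof (rule Bochner_Integration.integrable_bound[OF cb])
    show "AE x in lborel. norm (\<phi> x) \<le> norm (B' * indicator (cball 0 R) x)"
      using B' R by (auto simp: indicator_def not_le less_imp_le)
  qed simp
  have tr: "integrable lborel (\<lambda>x. \<phi> (x + c))" "(\<integral>x. \<phi> (x + c) \<partial>lborel) = (\<integral>x. \<phi> x \<partial>lborel)" for c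
    using int integrable_distr_eq[of "(+) c" lborel borel \<phi>] integral_distr[of "(+) c" lborel borel \<phi>]
    by (simp_all add: lborel_distr_plus add.commute)
  have "(\<lambda>n. \<integral>x. F n x \<partial>lborel) \<longlonglongrightarrow> (\<integral>x. partial i \<phi> x \<partial>lborel)"
  proof (rule integral_dominated_convergence[OF _ _ cb])
    show "AE x in lborel. (\<lambda>n. F n x) \<longlonglongrightarrow> partial i \<phi> x"
    proof (rule AE_I2)
      fix x
      have "((\<lambda>h. (\<phi> (x + (0 + h) *\<^sub>R ?e) - \<phi> (x + 0 *\<^sub>R ?e)) / h) \<longlongrightarrow> partial i \<phi> (x + 0 *\<^sub>R ?e)) (at 0)"
        using smooth_line_derivative[OF sm, of x i 0] unfolding DERIV_def .
      moreover have "filterlim (\<lambda>n. inverse (real (Suc n))) (at 0) sequentially"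
        using LIMSEQ_inverse_real_of_nat by (simp add: filterlim_at)
      ultimately have "(\<lambda>n. (\<phi> (x + (0 + inverse (real (Suc n))) *\<^sub>R ?e) - \<phi> (x + 0 *\<^sub>R ?e)) / inverse (real (Suc n)))
          \<longlonglongrightarrow> partial i \<phi> (x + 0 *\<^sub>R ?e)"
        by (rule filterlim_compose)
      then show "(\<lambda>n. F n x) \<longlonglongrightarrow> partial i \<phi> x"
        by (simp add: F_def divide_inverse mult.commute del: of_nat_Suc)
    qed
    \<comment> \<open>Within radius R + 1 the mean value theorem bounds the quotient by a value of
      the partial derivative. Farther out, a shift by at most 1 still ends where \<phi>
      vanishes.\<close>
    show "AE x in lborel. norm (F n x) \<le> B * indicator (cball 0 (R + 1)) x" for n
    proof (rule AE_I2)
      fix x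
      let ?h = "inverse (real (Suc n))"
      have h: "0 < ?h" "?h \<le> 1" by (auto simp: field_simps)
      show "norm (F n x) \<le> B * indicator (cball 0 (R + 1)) x"
      proof (cases "x \<in> cball 0 (R + 1)")
        case True
        have "\<exists>z. 0 < z \<and> z < ?h \<and> \<phi> (x + ?h *\<^sub>R ?e) - \<phi> (x + 0 *\<^sub>R ?e) = (?h - 0) * partial i \<phi> (x + z *\<^sub>R ?e)"
          by (rule MVT2[OF h(1)]) (rule smooth_line_derivative[OF sm])
        then obtain z where "\<phi> (x + ?h *\<^sub>R ?e) - \<phi> x = ?h * partial i \<phi> (x + z *\<^sub>R ?e)"
          by (auto simp del: of_nat_Suc)
        then have "F n x = partial i \<phi> (x + z *\<^sub>R ?e)"
          unfolding F_def by (simp only: mult.assoc[symmetric] right_inverse[OF of_nat_neq_0] mult_1)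
        then show ?thesis using True B by simp
      next
        case False
        then have x: "norm x > R + 1" by simp
        have "norm (x + ?h *\<^sub>R ?e) \<ge> norm x - norm (?h *\<^sub>R ?e)"
          using norm_diff_ineq[of x "?h *\<^sub>R ?e"] by simp
        moreover have "norm (?h *\<^sub>R ?e) \<le> 1" using h by (simp add: norm_axis_1)
        ultimately have "norm (x + ?h *\<^sub>R ?e) \<ge> R" using x by linarith
        then show ?thesis using x R by (simp add: F_def)
      qed
    qed
  qed (auto simp: F_def)
  moreover have "(\<integral>x. F n x \<partial>lborel) = 0" for n
    unfolding F_def using tr int by (simp del: of_nat_Suc)
  ultimately show ?thesis by (simp add: LIMSEQ_const_iff)
qed

section \<open>Integration by parts over a bounded open domain\<close>

locale bounded_open =
  fixes \<Omega> :: "(real^'d) set"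
  assumes open_domain: "open \<Omega>" and bounded_domain: "bounded \<Omega>"
begin

lemma domain_lebesgue [measurable, simp]: "\<Omega> \<in> sets lebesgue"
  by (simp add: open_domain borel_open)

lemma finite_measure_domain: "finite_measure (lebesgue_on \<Omega>)"
proof (rule finite_measureI)
  have "emeasure lborel \<Omega> < \<infinity>" by (rule emeasure_bounded_finite[OF bounded_domain])
  then show "emeasure (lebesgue_on \<Omega>) (space (lebesgue_on \<Omega>)) \<noteq> \<infinity>"
    by (simp add: emeasure_restrict_space open_domain borel_open)
qed

lemma borel_measurable_domain: "g \<in> borel_measurable borel \<Longrightarrow> g \<in> borel_measurable (lebesgue_on \<Omega>)"
  by (rule measurable_restrict_space1, rule measurable_completion) simp

lemma bounded_L2:
  fixes g :: "real^'d \<Rightarrow> real"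
  assumes "g \<in> borel_measurable (lebesgue_on \<Omega>)" "\<And>x. x \<in> \<Omega> \<Longrightarrow> \<bar>g x\<bar> \<le> B"
  shows "g \<in> L2 \<Omega>"
proof (rule L2I[OF assms(1)])
  have "AE x in lebesgue_on \<Omega>. norm (g x \<bullet> g x) \<le> B\<^sup>2"
  proof (rule AE_I2)
    fix x assume "x \<in> space (lebesgue_on \<Omega>)"
    then have "\<bar>g x\<bar> \<le> B" using assms(2) by simp
    from power_mono[OF this, of 2] show "norm (g x \<bullet> g x) \<le> B\<^sup>2" by (simp add: power2_eq_square)
  qed
  then show "integrable (lebesgue_on \<Omega>) (\<lambda>x. g x \<bullet> g x)"
    by (rule finite_measure.integrable_const_bound[OF finite_measure_domain])
       (intro borel_measurable_inner assms)
qed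

lemma test_function_L2: "\<phi> \<in> test_functions \<Omega> \<Longrightarrow> \<phi> \<in> L2 \<Omega>"
  by (rule test_function_bounded, assumption)
     (blast intro: bounded_L2 borel_measurable_domain smooth_borel test_functions_smooth)

text \<open>Translation invariance and iterated integration are applied to \<open>lborel\<close> on
  the whole space, whereas the function spaces refer to \<open>lebesgue_on \<Omega>\<close>; this
  lemma links the two.\<close>

lemma integral_domain:
  fixes g :: "real^'d \<Rightarrow> real"
  assumes "g \<in> borel_measurable borel" "\<And>x. x \<notin> \<Omega> \<Longrightarrow> g x = 0"
  shows "(\<integral>x. g x \<partial>lebesgue_on \<Omega>) = (\<integral>x. g x \<partial>lborel)"
proof -
  have "(\<integral>x. g x \<partial>lebesgue_on \<Omega>) = (\<integral>x. indicator \<Omega> x *\<^sub>R g x \<partial>lebesgue)"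
    by (rule integral_restrict_space) simp
  also have "(\<lambda>x. indicator \<Omega> x *\<^sub>R g x) = g"
    using assms(2) by (auto simp: indicator_def fun_eq_iff)
  also have "(\<integral>x. g x \<partial>lebesgue) = (\<integral>x. g x \<partial>lborel)"
    using assms(1) by (intro integral_completion) simp
  finally show ?thesis .
qed

lemma test_function_vanishes:
  "\<phi> \<in> test_functions \<Omega> \<Longrightarrow> x \<notin> \<Omega> \<Longrightarrow> \<phi> x = 0"
  by (rule test_functionsE, assumption) blast

text \<open>The product inherits compact support from \<psi> alone, so the integral of its partial
  derivative vanishes, and the product rule splits that integral.\<close>

lemma integration_by_parts:
  assumes \<phi>: "smooth \<phi>" and \<psi>: "\<psi> \<in> test_functions \<Omega>"
  shows "L2_inner \<Omega> \<phi> (partial i \<psi>) = - L2_inner \<Omega> (partial i \<phi>) \<psi>"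
proof -
  have \<psi>': "smooth \<psi>" by (rule test_functions_smooth[OF \<psi>])
  have t: "(\<lambda>x. \<phi> x * partial i \<psi> x) \<in> test_functions \<Omega>" "(\<lambda>x. partial i \<phi> x * \<psi> x) \<in> test_functions \<Omega>"
    by (intro test_functions_mult \<phi> \<psi> test_functions_partial smooth_partial)+
  have int: "integrable (lebesgue_on \<Omega>) \<rho>" if "\<rho> \<in> test_functions \<Omega>" for \<rho>
  proof (rule test_function_bounded[OF that])
    fix B assume "\<And>x. \<bar>\<rho> x\<bar> \<le> B"
    then show ?thesis
      by (intro finite_measure.integrable_const_bound[OF finite_measure_domain, where B = B]
          borel_measurable_domain smooth_borel test_functions_smooth[OF that]) simp
  qed
  have m: "(\<lambda>x. \<phi> x * \<psi> x) \<in> test_functions \<Omega>" by (rule test_functions_mult[OF \<phi> \<psi>])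
  have "0 = (\<integral>x. partial i (\<lambda>x. \<phi> x * \<psi> x) x \<partial>lborel)"
    using integral_partial_eq_0[OF m] by simp
  also have "\<dots> = (\<integral>x. partial i (\<lambda>x. \<phi> x * \<psi> x) x \<partial>lebesgue_on \<Omega>)"
    by (rule integral_domain[symmetric])
       (rule smooth_borel smooth_partial test_functions_smooth[OF m] test_function_vanishes test_functions_partial[OF m] | assumption)+
  also have "\<dots> = (\<integral>x. \<phi> x * partial i \<psi> x + partial i \<phi> x * \<psi> x \<partial>lebesgue_on \<Omega>)"
    by (simp add: smooth_partial_mult[OF \<phi> \<psi>'])
  also have "\<dots> = L2_inner \<Omega> \<phi> (partial i \<psi>) + L2_inner \<Omega> (partial i \<phi>) \<psi>"
    using int[OF t(1)] int[OF t(2)] by (simp add: L2_inner_def)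
  finally show ?thesis by simp
qed

end

section \<open>Weak gradients\<close>

text \<open>Open boxes are stable under intersection and generate the Borel sets, so Dynkin's
  argument extends vanishing integrals to all Borel sets. The assumption \<open>total\<close>
  handles complements.\<close>

lemma AE_eq_0_if_box_integrals_0:
  fixes h :: "'a::euclidean_space \<Rightarrow> real"
  assumes int: "integrable lborel h" and total: "(\<integral>x. h x \<partial>lborel) = 0"
    and box: "\<And>a b. (LINT x:box a b|lborel. h x) = 0"
  shows "AE x in lborel. h x = 0"
proof (rule sigma_finite_measure.density_zero[OF sigma_finite_lborel int])
  fix A assume "A \<in> sets (lborel :: 'a measure)"
  then have A: "A \<in> sigma_sets UNIV (range (\<lambda>(a, b). box a b :: 'a set))"
    by (simp add: borel_eq_box)
  have st: "Int_stable (range (\<lambda>(a, b). box a b :: 'a set))"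
    by (auto simp: Int_stable_def box_Int_box intro!: rangeI)
  have sets: "B \<in> sets lborel" if "B \<in> sigma_sets UNIV (range (\<lambda>(a, b). box a b :: 'a set))" for B
    using that by (simp add: borel_eq_box)
  have si: "set_integrable lborel B h" if "B \<in> sets lborel" for B
    using integrable_mult_indicator[OF that int] by (simp add: set_integrable_def)
  show "(LINT x:A|lborel. h x) = 0"
    using st subset_UNIV[of "range (\<lambda>(a, b). box a b :: 'a set)", folded Pow_UNIV] A
  proof (induct rule: sigma_sets_induct_disjoint)
    case (compl B)
    have B: "B \<in> sets lborel" by (rule sets[OF compl(1)])
    have "(LINT x:UNIV|lborel. h x) = (LINT x:(UNIV - B)|lborel. h x) + (LINT x:B|lborel. h x)"
      using set_integral_Un[of "UNIV - B" B lborel h] si B by auto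
    then show ?case using total compl by (simp add: set_lebesgue_integral_def)
  next
    case (union B)
    have B: "B i \<in> sets lborel" for i using union sets by blast
    then have "(LINT x:(\<Union>i. B i)|lborel. h x) = (\<Sum>i. (LINT x:(B i)|lborel. h x))"
      using union(1) by (intro lebesgue_integral_countable_add si) (auto simp: disjoint_family_on_def)
    then show ?case using union by simp
  qed (use box in \<open>auto simp: set_lebesgue_integral_def\<close>)
qed

definition grad :: "(real^'d \<Rightarrow> real) \<Rightarrow> real^'d \<Rightarrow> real^'d" where
  "grad \<phi> x = (\<chi> i. partial i \<phi> x)"

lemma is_weak_gradient_L2: "is_weak_gradient \<Omega> u G \<Longrightarrow> G \<in> L2 \<Omega>"
  by (simp add: is_weak_gradient_def)

lemma H1_weak_grad: "u \<in> H1 \<Omega> \<Longrightarrow> is_weak_gradient \<Omega> u (weak_grad \<Omega> u)"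
  using someI_ex[of "is_weak_gradient \<Omega> u"] by (simp add: H1_def weak_grad_def)

lemma H10_H1: "u \<in> H10 \<Omega> \<Longrightarrow> u \<in> H1 \<Omega>"
  by (simp add: H10_def)

lemma H1_L2: "u \<in> H1 \<Omega> \<Longrightarrow> u \<in> L2 \<Omega>"
  by (simp add: H1_def)

lemmas H10_L2 = H10_H1[THEN H1_L2]
lemmas H10_weak_grad = H10_H1[THEN H1_weak_grad]
lemmas H10_weak_grad_L2 = H10_weak_grad[THEN is_weak_gradient_L2]

context bounded_open
begin

text \<open>The bump functions of a box converge boundedly to its indicator function, so \<open>g\<close> has integral zero over
  every box whose closure lies in \<open>\<Omega>\<close>.\<close>

lemma fundamental_lemma:
  assumes g: "g \<in> L2 \<Omega>" and orth: "\<And>\<phi>. \<phi> \<in> test_functions \<Omega> \<Longrightarrow> L2_inner \<Omega> g \<phi> = 0"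
  shows "AE x in lebesgue_on \<Omega>. g x = (0::real)"
proof -
  define g0 where "g0 = (\<lambda>x. if x \<in> \<Omega> then g x else 0)"
  have "integrable (lebesgue_on \<Omega>) (\<lambda>x. g x \<bullet> 1)"
    by (intro L2_inner_integrable g bounded_L2[where B = 1]) auto
  then have g0: "integrable lebesgue g0"
    using Lebesgue_Measure.integrable_restrict_UNIV[OF domain_lebesgue, of g] by (simp add: g0_def)
  then have "g0 \<in> borel_measurable lebesgue" by simp
  \<comment> \<open>The extension by zero is only Lebesgue measurable; a Borel representative allows
    the rest to be done with \<open>lborel\<close>.\<close>
  then obtain g' where g'[measurable]: "g' \<in> borel_measurable lborel" and eq: "AE x in lborel. g0 x = g' x"
    using completion_ex_borel_measurable_real by blast
  have eq': "AE x in lebesgue. g0 x = g' x" by (rule AE_completion[OF eq])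
  have "integrable lebesgue g'"
    by (rule integrable_cong_AE_imp[OF g0 _ eq']) (rule measurable_completion[OF g'])
  then have int: "integrable lborel g'" using integrable_completion[OF g'] by simp
  have test: "(\<integral>x. \<phi> x * g' x \<partial>lborel) = 0" if \<phi>: "\<phi> \<in> test_functions \<Omega>" for \<phi>
  proof -
    have [measurable]: "\<phi> \<in> borel_measurable borel" by (rule smooth_borel[OF test_functions_smooth[OF \<phi>]])
    have m: "(\<lambda>x. \<phi> x * g' x) \<in> borel_measurable lborel" by measurable
    have m': "\<phi> \<in> borel_measurable lebesgue" by (rule measurable_completion) simp
    have "(\<integral>x. \<phi> x * g' x \<partial>lborel) = (\<integral>x. \<phi> x * g' x \<partial>lebesgue)"
      by (rule integral_completion[symmetric, OF m])
    also have "\<dots> = (\<integral>x. \<phi> x * g0 x \<partial>lebesgue)"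
      using eq' by (intro integral_cong_AE measurable_completion[OF m] borel_measurable_times m')
        (use g0 in auto)
    also have "(\<lambda>x. \<phi> x * g0 x) = (\<lambda>x. indicator \<Omega> x *\<^sub>R (g x \<bullet> \<phi> x))"
      by (auto simp: g0_def fun_eq_iff)
    also have "(\<integral>x. indicator \<Omega> x *\<^sub>R (g x \<bullet> \<phi> x) \<partial>lebesgue) = L2_inner \<Omega> g \<phi>"
      unfolding L2_inner_def by (rule integral_restrict_space[symmetric]) simp
    finally show ?thesis using orth[OF \<phi>] by simp
  qed
  have cbox0: "(LINT x:box a b|lborel. g' x) = 0" if "cbox a b \<subseteq> \<Omega>" for a b
  proof -
    have "(\<lambda>n. \<integral>x. bump (real (Suc n)) a b x * g' x \<partial>lborel) \<longlonglongrightarrow> (\<integral>x. indicator (box a b) x * g' x \<partial>lborel)"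
    proof (rule integral_dominated_convergence[where w = "\<lambda>x. norm (g' x)"])
      have sm: "smooth (bump (real (Suc n)) a b)" for n
        by (rule test_functions_smooth[OF bump_test_function[OF _ that]]) simp
      show "(\<lambda>x. bump (real (Suc n)) a b x * g' x) \<in> borel_measurable lborel" for n
        using smooth_borel[OF sm] by measurable
      show "AE x in lborel. (\<lambda>n. bump (real (Suc n)) a b x * g' x) \<longlonglongrightarrow> indicator (box a b) x * g' x"
        by (intro AE_I2 tendsto_mult bump_tendsto_indicator tendsto_const)
      have "norm (bump (real (Suc n)) a b x * g' x) \<le> norm (g' x)" for n x
        using mult_right_mono[OF bump_bounds(2)[of "real (Suc n)" a b x], of "\<bar>g' x\<bar>"]
          bump_bounds(1)[of "real (Suc n)" a b x]
        by (simp add: abs_mult del: of_nat_Suc)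
      then show "AE x in lborel. norm (bump (real (Suc n)) a b x * g' x) \<le> norm (g' x)" for n
        by (rule AE_I2)
    qed (use int in \<open>auto intro: integrable_norm\<close>)
    moreover have "(\<integral>x. bump (real (Suc n)) a b x * g' x \<partial>lborel) = 0" for n
      by (intro test bump_test_function that) simp
    ultimately have "(\<integral>x. indicator (box a b) x * g' x \<partial>lborel) = 0"
      by (simp add: LIMSEQ_const_iff del: of_nat_Suc)
    then show ?thesis by (simp add: set_lebesgue_integral_def)
  qed
  \<comment> \<open>The Dynkin argument needs integrals over all boxes, including those that leave
    \<Omega>. It is therefore applied to g' cut off to one box: every intersection with that box
    stays inside \<Omega>.\<close>
  have zero_box: "AE x in lborel. x \<in> box p q \<longrightarrow> g' x = 0" if pq: "cbox p q \<subseteq> \<Omega>" for p q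
  proof -
    have "AE x in lborel. indicator (box p q) x * g' x = 0"
    proof (rule AE_eq_0_if_box_integrals_0)
      show "integrable lborel (\<lambda>x. indicator (box p q) x * g' x)"
        using integrable_mult_indicator[OF _ int, of "box p q"] by simp
      show "(\<integral>x. indicator (box p q) x * g' x \<partial>lborel) = 0"
        using cbox0[OF pq] by (simp add: set_lebesgue_integral_def)
      fix a b
      obtain c d where cd: "box a b \<inter> box p q = box c d" using box_Int_box[of a b p q] by blast
      have "(LINT x:box c d|lborel. g' x) = 0"
      \<comment> \<open>An empty open box may still have a nonempty \<open>cbox\<close>, which need
        not lie in \<Omega>; only for a nonempty one is \<open>cbox c d\<close> the closure.\<close>
      proof (cases "box c d = {}")
        case False
        then have "cbox c d = closure (box c d)" by (simp add: closure_box)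
        also have "\<dots> \<subseteq> cbox p q"
          using cd box_subset_cbox[of p q] by (intro closure_minimal) auto
        finally show ?thesis using pq by (intro cbox0) auto
      qed (simp add: set_lebesgue_integral_def)
      moreover have "(\<lambda>x. indicator (box a b) x *\<^sub>R (indicator (box p q) x * g' x)) = (\<lambda>x. indicator (box c d) x *\<^sub>R g' x)"
        unfolding cd[symmetric] by (rule ext) (auto simp: indicator_def)
      ultimately show "(LINT x:box a b|lborel. indicator (box p q) x * g' x) = 0"
        by (simp only: set_lebesgue_integral_def)
    qed
    then show ?thesis by (rule AE_mp) (auto simp: indicator_def)
  qed
  \<comment> \<open>Closed boxes are wanted because \<Omega> is a countable union of them; their
    boundaries are null sets.\<close>
  have zero_cbox: "AE x in lebesgue. x \<in> cbox p q \<longrightarrow> g' x = 0" if pq: "cbox p q \<subseteq> \<Omega>" for p q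
  proof -
    have "cbox p q - box p q \<in> null_sets lebesgue"
      using negligible_frontier_interval negligible_iff_null_sets by blast
    then have "AE x in lebesgue. x \<notin> cbox p q - box p q" by (rule AE_not_in)
    with AE_completion[OF zero_box[OF pq]] show ?thesis by eventually_elim auto
  qed
  obtain \<D> where D: "countable \<D>" "\<D> \<subseteq> Pow \<Omega>" "\<And>X. X \<in> \<D> \<Longrightarrow> \<exists>a b. X = cbox a b" "\<Union>\<D> = \<Omega>"
    by (rule open_countable_Union_open_cbox[OF open_domain], rule that)
  have "AE x in lebesgue. \<forall>X\<in>\<D>. x \<in> X \<longrightarrow> g' x = 0"
    unfolding AE_ball_countable[OF D(1)]
  proof
    fix X assume "X \<in> \<D>"
    then obtain a b where "X = cbox a b" "X \<subseteq> \<Omega>" using D by blast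
    then show "AE x in lebesgue. x \<in> X \<longrightarrow> g' x = 0" using zero_cbox by simp
  qed
  with eq' have "AE x in lebesgue. x \<in> \<Omega> \<longrightarrow> g x = 0"
  proof eventually_elim
    case (elim x)
    show ?case
    proof
      assume "x \<in> \<Omega>"
      moreover from this obtain X where "X \<in> \<D>" "x \<in> X" using D(4) by blast
      ultimately show "g x = 0" using elim by (simp add: g0_def)
    qed
  qed
  then show ?thesis by (simp add: AE_restrict_space_iff)
qed

text \<open>Both gradients have the same pairing with every test function, so each component of
  their difference falls under \<open>fundamental_lemma\<close>.\<close>

lemma weak_gradient_unique:
  assumes G: "is_weak_gradient \<Omega> u G" and H: "is_weak_gradient \<Omega> u H"
  shows "AE x in lebesgue_on \<Omega>. G x = H x"
proof -
  have L: "G \<in> L2 \<Omega>" "H \<in> L2 \<Omega>" using G H by (auto dest: is_weak_gradient_L2)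
  have "AE x in lebesgue_on \<Omega>. G x $ i - H x $ i = 0" for i
  proof (rule fundamental_lemma)
    show "(\<lambda>x. G x $ i - H x $ i) \<in> L2 \<Omega>" by (intro L2_diff L2_component L)
    show "L2_inner \<Omega> (\<lambda>x. G x $ i - H x $ i) \<phi> = 0" if "\<phi> \<in> test_functions \<Omega>" for \<phi>
    proof -
      have "L2_inner \<Omega> (\<lambda>x. G x $ i) \<phi> = L2_inner \<Omega> (\<lambda>x. H x $ i) \<phi>"
        using G H that unfolding is_weak_gradient_def by (metis neg_equal_iff_equal)
      then show ?thesis
        by (subst L2_inner_diff_left) (auto intro: L2_component L test_function_L2 that)
    qed
  qed
  then have "AE x in lebesgue_on \<Omega>. \<forall>i. G x $ i - H x $ i = 0"
    using AE_finite_all[of "UNIV :: 'd set" "\<lambda>x i. G x $ i - H x $ i = 0" "ae_filter (lebesgue_on \<Omega>)"] by simp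
  then show ?thesis by (simp add: vec_eq_iff)
qed

text \<open>This identifies the value chosen by \<open>SOME\<close> with any gradient that can be
  exhibited.\<close>

lemma weak_grad_eqI:
  assumes "is_weak_gradient \<Omega> u G"
  shows "AE x in lebesgue_on \<Omega>. weak_grad \<Omega> u x = G x"
  unfolding weak_grad_def
  by (rule weak_gradient_unique[OF someI[of "is_weak_gradient \<Omega> u", OF assms] assms])

lemma L2_norm_weak_grad:
  assumes "is_weak_gradient \<Omega> u G"
  shows "L2_norm \<Omega> (weak_grad \<Omega> u) = L2_norm \<Omega> G"
proof (rule L2_norm_cong_AE[OF _ _ weak_grad_eqI[OF assms]])
  have "is_weak_gradient \<Omega> u (weak_grad \<Omega> u)"
    unfolding weak_grad_def by (rule someI[of "is_weak_gradient \<Omega> u", OF assms])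
  then show "weak_grad \<Omega> u \<in> borel_measurable (lebesgue_on \<Omega>)" "G \<in> borel_measurable (lebesgue_on \<Omega>)"
    using assms by (auto intro!: L2_measurable is_weak_gradient_L2)
qed

text \<open>Formulated for explicit gradients, because the chosen representatives depend linearly on
  the function only almost everywhere.\<close>

lemma is_weak_gradient_lincomb:
  assumes u: "u \<in> L2 \<Omega>" "is_weak_gradient \<Omega> u G" and v: "v \<in> L2 \<Omega>" "is_weak_gradient \<Omega> v H"
  shows "is_weak_gradient \<Omega> (\<lambda>x. a * u x + b * v x) (\<lambda>x. a *\<^sub>R G x + b *\<^sub>R H x)"
  unfolding is_weak_gradient_def
proof (intro conjI ballI allI)
  have L: "G \<in> L2 \<Omega>" "H \<in> L2 \<Omega>" using u v by (auto dest: is_weak_gradient_L2)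
  then show "(\<lambda>x. a *\<^sub>R G x + b *\<^sub>R H x) \<in> L2 \<Omega>" by (intro L2_add L2_scaleR)
  fix \<phi> i assume \<phi>: "\<phi> \<in> test_functions \<Omega>"
  note p = test_function_L2[OF \<phi>] test_function_L2[OF test_functions_partial[OF \<phi>, of i]]
  have cm: "(\<lambda>x. c * w x) \<in> L2 \<Omega>" if "w \<in> L2 \<Omega>" for c and w :: "real^'d \<Rightarrow> real"
    using L2_scaleR[OF that, of c] by simp
  have *: "L2_inner \<Omega> (\<lambda>x. a * w x + b * z x) \<psi> = a * L2_inner \<Omega> w \<psi> + b * L2_inner \<Omega> z \<psi>"
    if "w \<in> L2 \<Omega>" "z \<in> L2 \<Omega>" "\<psi> \<in> L2 \<Omega>" for w z \<psi> :: "real^'d \<Rightarrow> real"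
    by (subst L2_inner_add_left) (auto simp: that cm L2_inner_cmult_left)
  have "L2_inner \<Omega> (\<lambda>x. a * u x + b * v x) (partial i \<phi>)
      = - (a * L2_inner \<Omega> (\<lambda>x. G x $ i) \<phi> + b * L2_inner \<Omega> (\<lambda>x. H x $ i) \<phi>)"
    unfolding *[OF u(1) v(1) p(2)] using u(2) v(2) \<phi> by (simp add: is_weak_gradient_def)
  also have "\<dots> = - L2_inner \<Omega> (\<lambda>x. a * G x $ i + b * H x $ i) \<phi>"
    using *[OF L2_component[OF L(1)] L2_component[OF L(2)] p(1)] by simp
  finally show "L2_inner \<Omega> (\<lambda>x. a * u x + b * v x) (partial i \<phi>)
      = - L2_inner \<Omega> (\<lambda>x. (a *\<^sub>R G x + b *\<^sub>R H x) $ i) \<phi>" by simp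
qed

lemma grad_L2: "\<phi> \<in> test_functions \<Omega> \<Longrightarrow> grad \<phi> \<in> L2 \<Omega>"
  by (rule L2_vecI) (simp add: grad_def test_function_L2 test_functions_partial)

lemma is_weak_gradient_test_function:
  "\<phi> \<in> test_functions \<Omega> \<Longrightarrow> is_weak_gradient \<Omega> \<phi> (grad \<phi>)"
  unfolding is_weak_gradient_def
  by (auto intro: grad_L2) (simp add: grad_def integration_by_parts test_functions_smooth)

lemma is_weak_gradient_cong:
  assumes "is_weak_gradient \<Omega> u G" "u \<in> borel_measurable (lebesgue_on \<Omega>)" "v \<in> borel_measurable (lebesgue_on \<Omega>)"
    "AE x in lebesgue_on \<Omega>. u x = v x"
  shows "is_weak_gradient \<Omega> v G"
  unfolding is_weak_gradient_def
proof (intro conjI ballI allI)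
  show "G \<in> L2 \<Omega>" by (rule is_weak_gradient_L2[OF assms(1)])
  fix \<phi> i assume \<phi>: "\<phi> \<in> test_functions \<Omega>"
  have "L2_inner \<Omega> v (partial i \<phi>) = L2_inner \<Omega> u (partial i \<phi>)"
    using L2_measurable[OF test_function_L2[OF test_functions_partial[OF \<phi>]]] assms
    by (intro L2_inner_cong_AE) auto
  then show "L2_inner \<Omega> v (partial i \<phi>) = - L2_inner \<Omega> (\<lambda>x. G x $ i) \<phi>"
    using assms(1) \<phi> by (simp add: is_weak_gradient_def)
qed

lemma is_weak_gradient_diff_test_function:
  assumes "u \<in> L2 \<Omega>" "is_weak_gradient \<Omega> u G" "\<phi> \<in> test_functions \<Omega>"
  shows "is_weak_gradient \<Omega> (\<lambda>x. u x - \<phi> x) (\<lambda>x. G x - grad \<phi> x)"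
  using is_weak_gradient_lincomb[OF assms(1,2) test_function_L2[OF assms(3)]
      is_weak_gradient_test_function[OF assms(3)], of 1 "-1"] by simp

text \<open>The defining condition involves the chosen gradient of u - \<phi>, a new choice for
  every \<phi>. Here one explicit gradient of u serves all \<phi>, and the two parts of the norm are
  separated.\<close>

lemma H10_iff:
  assumes u: "u \<in> L2 \<Omega>" "is_weak_gradient \<Omega> u G"
  shows "u \<in> H10 \<Omega> \<longleftrightarrow> (\<forall>\<epsilon>>0. \<exists>\<phi>\<in>test_functions \<Omega>.
    L2_norm \<Omega> (\<lambda>x. u x - \<phi> x) < \<epsilon> \<and> L2_norm \<Omega> (\<lambda>x. G x - grad \<phi> x) < \<epsilon>)" (is "_ \<longleftrightarrow> ?R")
proof -
  have n: "H1_norm \<Omega> (\<lambda>x. u x - \<phi> x)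
      = sqrt ((L2_norm \<Omega> (\<lambda>x. u x - \<phi> x))\<^sup>2 + (L2_norm \<Omega> (\<lambda>x. G x - grad \<phi> x))\<^sup>2)"
    if "\<phi> \<in> test_functions \<Omega>" for \<phi>
    using L2_norm_weak_grad[OF is_weak_gradient_diff_test_function[OF u that]] by (simp add: H1_norm_def)
  have le: "a \<le> sqrt (a\<^sup>2 + b\<^sup>2)" "b \<le> sqrt (a\<^sup>2 + b\<^sup>2)" for a b :: real
    by (auto intro: real_le_rsqrt)
  show ?thesis
  proof
    assume "u \<in> H10 \<Omega>"
    then show ?R unfolding H10_def by (simp cong: bex_cong add: n) (meson le order_le_less_trans)
  next
    assume R: ?R
    have "\<exists>\<phi>\<in>test_functions \<Omega>. H1_norm \<Omega> (\<lambda>x. u x - \<phi> x) < \<epsilon>" if "\<epsilon> > 0" for \<epsilon>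
    proof -
      have "\<epsilon> / 2 > 0" using that by simp
      with R obtain \<phi> where \<phi>: "\<phi> \<in> test_functions \<Omega>"
        "L2_norm \<Omega> (\<lambda>x. u x - \<phi> x) < \<epsilon> / 2" "L2_norm \<Omega> (\<lambda>x. G x - grad \<phi> x) < \<epsilon> / 2"
        by blast
      have "H1_norm \<Omega> (\<lambda>x. u x - \<phi> x) \<le> L2_norm \<Omega> (\<lambda>x. u x - \<phi> x) + L2_norm \<Omega> (\<lambda>x. G x - grad \<phi> x)"
        unfolding n[OF \<phi>(1)] by (rule sqrt_sum_squares_le_sum) auto
      then show ?thesis using \<phi> by (intro bexI[of _ \<phi>]) auto
    qed
    then show "u \<in> H10 \<Omega>" using u by (auto simp: H10_def H1_def)
  qed
qed

lemma H10_approx: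
  assumes "u \<in> H10 \<Omega>"
  obtains \<phi> where "\<And>n. \<phi> n \<in> test_functions \<Omega>"
    "(\<lambda>n. L2_norm \<Omega> (\<lambda>x. u x - \<phi> n x)) \<longlonglongrightarrow> 0"
    "(\<lambda>n. L2_norm \<Omega> (\<lambda>x. weak_grad \<Omega> u x - grad (\<phi> n) x)) \<longlonglongrightarrow> 0"
proof -
  have "\<exists>\<phi>\<in>test_functions \<Omega>. L2_norm \<Omega> (\<lambda>x. u x - \<phi> x) < inverse (real (Suc n)) \<and>
      L2_norm \<Omega> (\<lambda>x. weak_grad \<Omega> u x - grad \<phi> x) < inverse (real (Suc n))" for n
    using assms H10_iff[OF H10_L2[OF assms] H10_weak_grad[OF assms]] by (simp del: of_nat_Suc)
  then obtain \<phi> where \<phi>: "\<And>n. \<phi> n \<in> test_functions \<Omega>"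
    "\<And>n. L2_norm \<Omega> (\<lambda>x. u x - \<phi> n x) < inverse (real (Suc n))"
    "\<And>n. L2_norm \<Omega> (\<lambda>x. weak_grad \<Omega> u x - grad (\<phi> n) x) < inverse (real (Suc n))"
    by metis
  have *: "X \<longlonglongrightarrow> 0" if "\<And>n. 0 \<le> X n" "\<And>n. X n < inverse (real (Suc n))" for X
    by (rule tendsto_sandwich[OF _ _ tendsto_const LIMSEQ_inverse_real_of_nat])
       (use that(1) that(2)[THEN less_imp_le] in \<open>simp_all del: of_nat_Suc\<close>)
  show thesis
    by (rule that[OF \<phi>(1)]) (auto intro!: * \<phi>)
qed

lemma H10_lincomb:
  assumes u: "u \<in> H10 \<Omega>" and v: "v \<in> H10 \<Omega>"
  shows "(\<lambda>x. a * u x + b * v x) \<in> H10 \<Omega>"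
proof -
  note uL = H10_L2[OF u] H10_weak_grad[OF u] and vL = H10_L2[OF v] H10_weak_grad[OF v]
  note uG = is_weak_gradient_L2[OF uL(2)] and vG = is_weak_gradient_L2[OF vL(2)]
  have L: "(\<lambda>x. a * u x + b * v x) \<in> L2 \<Omega>"
    using L2_add[OF L2_scaleR[OF uL(1), of a] L2_scaleR[OF vL(1), of b]] by simp
  obtain \<phi> where \<phi>: "\<And>n. \<phi> n \<in> test_functions \<Omega>"
    "(\<lambda>n. L2_norm \<Omega> (\<lambda>x. u x - \<phi> n x)) \<longlonglongrightarrow> 0"
    "(\<lambda>n. L2_norm \<Omega> (\<lambda>x. weak_grad \<Omega> u x - grad (\<phi> n) x)) \<longlonglongrightarrow> 0"
    using H10_approx[OF u] by blast
  obtain \<psi> where \<psi>: "\<And>n. \<psi> n \<in> test_functions \<Omega>"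
    "(\<lambda>n. L2_norm \<Omega> (\<lambda>x. v x - \<psi> n x)) \<longlonglongrightarrow> 0"
    "(\<lambda>n. L2_norm \<Omega> (\<lambda>x. weak_grad \<Omega> v x - grad (\<psi> n) x)) \<longlonglongrightarrow> 0"
    using H10_approx[OF v] by blast
  \<comment> \<open>\<open>sum0\<close> and \<open>tri\<close> are polymorphic in the codomain: they
    are applied both to the functions and to their gradients.\<close>
  have sum0: "(\<lambda>n. \<bar>a\<bar> * L2_norm \<Omega> (p n) + \<bar>b\<bar> * L2_norm \<Omega> (q n)) \<longlonglongrightarrow> 0"
    if "(\<lambda>n. L2_norm \<Omega> (p n)) \<longlonglongrightarrow> 0" "(\<lambda>n. L2_norm \<Omega> (q n)) \<longlonglongrightarrow> 0"
    for p q :: "nat \<Rightarrow> real^'d \<Rightarrow> 'b::euclidean_space"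
    using tendsto_add[OF tendsto_mult_left[OF that(1), of "\<bar>a\<bar>"] tendsto_mult_left[OF that(2), of "\<bar>b\<bar>"]] by simp
  have tri: "L2_norm \<Omega> (\<lambda>x. a *\<^sub>R p x + b *\<^sub>R q x) \<le> \<bar>a\<bar> * L2_norm \<Omega> p + \<bar>b\<bar> * L2_norm \<Omega> q"
    if "p \<in> L2 \<Omega>" "q \<in> L2 \<Omega>" for p q :: "real^'d \<Rightarrow> 'b::euclidean_space"
    using L2_norm_triangle[OF L2_scaleR[OF that(1), of a] L2_scaleR[OF that(2), of b]]
    by (simp add: L2_norm_scaleR)
  let ?\<chi> = "\<lambda>n x. a * \<phi> n x + b * \<psi> n x"
  have \<chi>: "?\<chi> n \<in> test_functions \<Omega>" for n
    by (intro test_functions_add test_functions_mult smooth_const \<phi> \<psi>)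
  have grad_\<chi>: "grad (?\<chi> n) = (\<lambda>x. a *\<^sub>R grad (\<phi> n) x + b *\<^sub>R grad (\<psi> n) x)" for n
    using test_functions_smooth[OF \<phi>(1)] test_functions_smooth[OF \<psi>(1)]
    by (simp add: grad_def vec_eq_iff fun_eq_iff smooth_partial_add smooth_mult smooth_const partial_cmult)
  show ?thesis
    unfolding H10_iff[OF L is_weak_gradient_lincomb[OF uL vL]]
  proof (intro allI impI)
    fix \<epsilon> :: real assume "\<epsilon> > 0"
    then have "\<forall>\<^sub>F n in sequentially.
        \<bar>a\<bar> * L2_norm \<Omega> (\<lambda>x. u x - \<phi> n x) + \<bar>b\<bar> * L2_norm \<Omega> (\<lambda>x. v x - \<psi> n x) < \<epsilon> \<and>
        \<bar>a\<bar> * L2_norm \<Omega> (\<lambda>x. weak_grad \<Omega> u x - grad (\<phi> n) x)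
        + \<bar>b\<bar> * L2_norm \<Omega> (\<lambda>x. weak_grad \<Omega> v x - grad (\<psi> n) x) < \<epsilon>"
      using order_tendstoD(2)[OF sum0[OF \<phi>(2) \<psi>(2)]] order_tendstoD(2)[OF sum0[OF \<phi>(3) \<psi>(3)]]
      by (auto intro: eventually_conj)
    then obtain n where n:
      "\<bar>a\<bar> * L2_norm \<Omega> (\<lambda>x. u x - \<phi> n x) + \<bar>b\<bar> * L2_norm \<Omega> (\<lambda>x. v x - \<psi> n x) < \<epsilon>"
      "\<bar>a\<bar> * L2_norm \<Omega> (\<lambda>x. weak_grad \<Omega> u x - grad (\<phi> n) x)
        + \<bar>b\<bar> * L2_norm \<Omega> (\<lambda>x. weak_grad \<Omega> v x - grad (\<psi> n) x) < \<epsilon>"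
      by (auto dest: eventually_happens)
    have 1: "L2_norm \<Omega> (\<lambda>x. a * u x + b * v x - ?\<chi> n x) < \<epsilon>"
      using tri[OF L2_diff[OF uL(1) test_function_L2[OF \<phi>(1)]] L2_diff[OF vL(1) test_function_L2[OF \<psi>(1)]], of n n] n(1)
      by (simp add: algebra_simps)
    have 2: "L2_norm \<Omega> (\<lambda>x. (a *\<^sub>R weak_grad \<Omega> u x + b *\<^sub>R weak_grad \<Omega> v x) - grad (?\<chi> n) x) < \<epsilon>"
      using tri[OF L2_diff[OF uG grad_L2[OF \<phi>(1)]] L2_diff[OF vG grad_L2[OF \<psi>(1)]], of n n] n(2)
      unfolding grad_\<chi> by (simp add: algebra_simps)
    show "\<exists>\<rho>\<in>test_functions \<Omega>. L2_norm \<Omega> (\<lambda>x. a * u x + b * v x - \<rho> x) < \<epsilon> \<and>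
       L2_norm \<Omega> (\<lambda>x. (a *\<^sub>R weak_grad \<Omega> u x + b *\<^sub>R weak_grad \<Omega> v x) - grad \<rho> x) < \<epsilon>"
      by (intro bexI[OF _ \<chi>[of n]] conjI 1 2)
  qed
qed

text \<open>This is completeness of Lebesgue measure: a change on a null set cannot destroy
  measurability.\<close>

lemma borel_measurable_domain_AE:
  fixes u v :: "real^'d \<Rightarrow> 'b::euclidean_space"
  assumes "u \<in> borel_measurable (lebesgue_on \<Omega>)" "AE x in lebesgue_on \<Omega>. u x = v x"
  shows "v \<in> borel_measurable (lebesgue_on \<Omega>)"
proof -
  have "(\<lambda>x. if x \<in> \<Omega> then u x else 0) \<in> borel_measurable lebesgue"
    using assms(1) by (simp add: borel_measurable_if)
  moreover have "AE x in lebesgue. (if x \<in> \<Omega> then u x else 0) = (if x \<in> \<Omega> then v x else 0)"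
    using assms(2) by (auto simp: AE_restrict_space_iff elim!: eventually_mono)
  ultimately have "(\<lambda>x. if x \<in> \<Omega> then v x else 0) \<in> borel_measurable lebesgue"
    by (rule borel_measurable_AE)
  then show ?thesis by (simp add: borel_measurable_if)
qed

lemma H10_cong:
  assumes u: "u \<in> H10 \<Omega>" and eq: "AE x in lebesgue_on \<Omega>. u x = v x"
  shows "v \<in> H10 \<Omega>" and "AE x in lebesgue_on \<Omega>. weak_grad \<Omega> v x = weak_grad \<Omega> u x"
proof -
  have mu: "u \<in> borel_measurable (lebesgue_on \<Omega>)" by (intro L2_measurable H10_L2 u)
  have mv: "v \<in> borel_measurable (lebesgue_on \<Omega>)" by (rule borel_measurable_domain_AE[OF mu eq])
  have G: "is_weak_gradient \<Omega> v (weak_grad \<Omega> u)"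
    by (rule is_weak_gradient_cong[OF H10_weak_grad[OF u] mu mv eq])
  have vL: "v \<in> L2 \<Omega>"
  proof (rule L2I[OF mv])
    show "integrable (lebesgue_on \<Omega>) (\<lambda>x. v x \<bullet> v x)"
      by (rule integrable_cong_AE_imp[OF L2_inner_integrable[OF H10_L2[OF u] H10_L2[OF u]]])
         (use eq mv in \<open>auto intro: borel_measurable_inner\<close>)
  qed
  show "AE x in lebesgue_on \<Omega>. weak_grad \<Omega> v x = weak_grad \<Omega> u x" by (rule weak_grad_eqI[OF G])
  have "L2_norm \<Omega> (\<lambda>x. v x - \<phi> x) = L2_norm \<Omega> (\<lambda>x. u x - \<phi> x)" if "\<phi> \<in> test_functions \<Omega>" for \<phi>
    using mu mv eq L2_measurable[OF test_function_L2[OF that]]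
    by (intro L2_norm_cong_AE borel_measurable_diff) auto
  then show "v \<in> H10 \<Omega>"
    using u unfolding H10_iff[OF vL G] H10_iff[OF H10_L2[OF u] H10_weak_grad[OF u]] by simp
qed

lemma test_function_H10: "\<phi> \<in> test_functions \<Omega> \<Longrightarrow> \<phi> \<in> H10 \<Omega>"
  by (subst H10_iff[OF test_function_L2 is_weak_gradient_test_function])
     (auto intro!: bexI[of _ \<phi>] simp: L2_norm_eq_0)

subsection \<open>The Poincare inequality\<close>

lemma L2_norm_mono:
  fixes u v :: "real^'d \<Rightarrow> real"
  assumes "u \<in> L2 \<Omega>" "v \<in> L2 \<Omega>" "\<And>x. x \<in> \<Omega> \<Longrightarrow> \<bar>u x\<bar> \<le> \<bar>v x\<bar>"
  shows "L2_norm \<Omega> u \<le> L2_norm \<Omega> v"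
  unfolding L2_norm_def L2_inner_def
  by (intro real_sqrt_le_mono integral_mono L2_inner_integrable assms)
     (use assms(3) in \<open>auto simp: abs_le_square_iff power2_eq_square\<close>)

text \<open>Integrate \<open>\<partial>\<^sub>i (x\<^sub>i \<phi>\<^sup>2)\<close> over \<open>\<Omega>\<close>.\<close>

lemma Poincare_test_function:
  assumes R: "\<And>x. x \<in> \<Omega> \<Longrightarrow> norm x \<le> R" "R > 0" and \<phi>: "\<phi> \<in> test_functions \<Omega>"
  shows "L2_norm \<Omega> \<phi> \<le> 2 * R * L2_norm \<Omega> (grad \<phi>)"
proof -
  \<comment> \<open>One arbitrary coordinate direction suffices.\<close>
  fix i :: 'd
  have sm: "smooth \<phi>" by (rule test_functions_smooth[OF \<phi>])
  have x\<phi>: "(\<lambda>x. x $ i * \<phi> x) \<in> L2 \<Omega>"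
    by (intro test_function_L2 test_functions_mult smooth_coord \<phi>)
  have xd: "(\<lambda>x. x $ i * partial i \<phi> x) \<in> L2 \<Omega>"
    by (intro test_function_L2 test_functions_mult smooth_coord test_functions_partial \<phi>)
  note L = test_function_L2[OF \<phi>] test_function_L2[OF test_functions_partial[OF \<phi>, of i]]
  have "partial i (\<lambda>x. x $ i * \<phi> x) = (\<lambda>x. x $ i * partial i \<phi> x + \<phi> x)"
    using smooth_partial_mult[OF smooth_coord sm, of i i] by (simp add: partial_coord)
  \<comment> \<open>Moving the derivative off \<phi> reproduces the same mixed term with opposite
    sign, so it can be solved for the squared norm of \<phi>.\<close>
  then have "L2_inner \<Omega> (\<lambda>x. x $ i * \<phi> x) (partial i \<phi>) = - L2_inner \<Omega> (\<lambda>x. x $ i * partial i \<phi> x + \<phi> x) \<phi>"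
    using integration_by_parts[OF smooth_mult[OF smooth_coord sm] \<phi>, of i i] by simp
  also have "\<dots> = - (L2_inner \<Omega> (\<lambda>x. x $ i * \<phi> x) (partial i \<phi>) + L2_inner \<Omega> \<phi> \<phi>)"
    by (subst L2_inner_add_left[OF xd L(1) L(1)]) (simp add: L2_inner_def mult_ac)
  finally have "(L2_norm \<Omega> \<phi>)\<^sup>2 = - 2 * L2_inner \<Omega> (\<lambda>x. x $ i * \<phi> x) (partial i \<phi>)"
    by (simp add: L2_norm_power2)
  also have "\<dots> \<le> 2 * (L2_norm \<Omega> (\<lambda>x. x $ i * \<phi> x) * L2_norm \<Omega> (partial i \<phi>))"
    using L2_Cauchy_Schwarz[OF x\<phi> L(2)] by linarith
  also have "\<dots> \<le> 2 * ((R * L2_norm \<Omega> \<phi>) * L2_norm \<Omega> (grad \<phi>))"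
  proof (intro mult_left_mono mult_mono)
    have "L2_norm \<Omega> (\<lambda>x. x $ i * \<phi> x) \<le> L2_norm \<Omega> (\<lambda>x. R *\<^sub>R \<phi> x)"
    proof (rule L2_norm_mono[OF x\<phi> L2_scaleR[OF L(1)]])
      fix x assume "x \<in> \<Omega>"
      then have "\<bar>x $ i\<bar> \<le> R" using R(1) component_le_norm_cart[of x i] by (meson order_trans)
      then show "\<bar>x $ i * \<phi> x\<bar> \<le> \<bar>R *\<^sub>R \<phi> x\<bar>"
        using R(2) by (simp add: abs_mult mult_right_mono)
    qed
    then show "L2_norm \<Omega> (\<lambda>x. x $ i * \<phi> x) \<le> R * L2_norm \<Omega> \<phi>"
      using R(2) by (simp only: L2_norm_scaleR abs_of_pos)
    show "L2_norm \<Omega> (partial i \<phi>) \<le> L2_norm \<Omega> (grad \<phi>)"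
      using L2_norm_component_le[OF grad_L2[OF \<phi>], of i] by (simp add: grad_def)
  qed (use R in auto)
  finally have "L2_norm \<Omega> \<phi> * L2_norm \<Omega> \<phi> \<le> (2 * R * L2_norm \<Omega> (grad \<phi>)) * L2_norm \<Omega> \<phi>"
    by (simp add: power2_eq_square mult_ac)
  then show ?thesis
    using R(2) by (cases "L2_norm \<Omega> \<phi> = 0") (auto simp: mult_le_cancel_right less_le)
qed

text \<open>The bound for test functions survives the limit, since both sides are continuous along
  the approximating sequence; R is the radius of a ball around \<Omega>.\<close>

lemma Poincare:
  obtains C where "C > 0" "\<And>u. u \<in> H10 \<Omega> \<Longrightarrow> L2_norm \<Omega> u \<le> C * L2_norm \<Omega> (weak_grad \<Omega> u)"
proof -
  obtain R where R: "R > 0" "\<And>x. x \<in> \<Omega> \<Longrightarrow> norm x \<le> R"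
    using bounded_domain unfolding bounded_pos by blast
  have "L2_norm \<Omega> u \<le> 2 * R * L2_norm \<Omega> (weak_grad \<Omega> u)" if u: "u \<in> H10 \<Omega>" for u
  proof -
    obtain \<phi> where \<phi>: "\<And>n. \<phi> n \<in> test_functions \<Omega>"
      "(\<lambda>n. L2_norm \<Omega> (\<lambda>x. u x - \<phi> n x)) \<longlonglongrightarrow> 0"
      "(\<lambda>n. L2_norm \<Omega> (\<lambda>x. weak_grad \<Omega> u x - grad (\<phi> n) x)) \<longlonglongrightarrow> 0"
      using H10_approx[OF u] by blast
    let ?b = "\<lambda>n. L2_norm \<Omega> (\<lambda>x. u x - \<phi> n x) + 2 * R * (L2_norm \<Omega> (\<lambda>x. weak_grad \<Omega> u x - grad (\<phi> n) x)
      + L2_norm \<Omega> (weak_grad \<Omega> u))"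
    have "L2_norm \<Omega> u \<le> ?b n" for n
    proof -
      note G = grad_L2[OF \<phi>(1), of n] and H = H10_weak_grad_L2[OF u]
      have "L2_norm \<Omega> u \<le> L2_norm \<Omega> (\<lambda>x. u x - \<phi> n x) + L2_norm \<Omega> (\<phi> n)"
        by (rule L2_norm_triangle_diff[OF H10_L2[OF u] test_function_L2[OF \<phi>(1)]])
      also have "L2_norm \<Omega> (\<phi> n) \<le> 2 * R * L2_norm \<Omega> (grad (\<phi> n))"
        by (rule Poincare_test_function[OF R(2,1) \<phi>(1)])
      also have "L2_norm \<Omega> (grad (\<phi> n)) \<le> L2_norm \<Omega> (\<lambda>x. grad (\<phi> n) x - weak_grad \<Omega> u x) + L2_norm \<Omega> (weak_grad \<Omega> u)"
        by (rule L2_norm_triangle_diff[OF G H])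
      also have "L2_norm \<Omega> (\<lambda>x. grad (\<phi> n) x - weak_grad \<Omega> u x) = L2_norm \<Omega> (\<lambda>x. weak_grad \<Omega> u x - grad (\<phi> n) x)"
        using L2_norm_uminus[of \<Omega> "\<lambda>x. grad (\<phi> n) x - weak_grad \<Omega> u x"] by simp
      finally show ?thesis using R(1) by simp
    qed
    moreover have "?b \<longlonglongrightarrow> 0 + 2 * R * (0 + L2_norm \<Omega> (weak_grad \<Omega> u))"
      by (intro tendsto_intros \<phi>)
    ultimately have "L2_norm \<Omega> u \<le> 0 + 2 * R * (0 + L2_norm \<Omega> (weak_grad \<Omega> u))"
      by (intro LIMSEQ_le_const) auto
    then show ?thesis by simp
  qed
  with R show thesis by (intro that[of "2 * R"]) auto
qed

end

section \<open>Ladyzhenskaya's inequality\<close>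

lemma nn_integral_lborel_Basis:
  fixes f :: "'a::euclidean_space \<Rightarrow> ennreal"
  assumes [measurable]: "f \<in> borel_measurable borel"
  shows "(\<integral>\<^sup>+x. f x \<partial>lborel) = (\<integral>\<^sup>+y. f (\<Sum>b\<in>Basis. y b *\<^sub>R b) \<partial>Pi\<^sub>M Basis (\<lambda>_. lborel))"
  by (subst lborel_eq, subst nn_integral_distr) auto

text \<open>The dimension is known only through a cardinality, so the directions of the iterated
  integral are an enumeration of \<open>Basis\<close>.\<close>

lemma nn_integral_lborel_2:
  fixes f :: "'a::euclidean_space \<Rightarrow> ennreal"
  assumes B: "Basis = {a, b}" "a \<noteq> b" and f[measurable]: "f \<in> borel_measurable borel"
  shows "(\<integral>\<^sup>+x. f x \<partial>lborel) = (\<integral>\<^sup>+t. \<integral>\<^sup>+s. f (s *\<^sub>R a + t *\<^sub>R b) \<partial>lborel \<partial>lborel)"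
proof -
  interpret P: product_sigma_finite "\<lambda>_::'a. lborel :: real measure" ..
  have "(\<integral>\<^sup>+x. f x \<partial>lborel) = (\<integral>\<^sup>+y. f (y a *\<^sub>R a + y b *\<^sub>R b) \<partial>Pi\<^sub>M {a, b} (\<lambda>_. lborel))"
    unfolding nn_integral_lborel_Basis[OF f] B(1) using B(2) by simp
  also have "\<dots> = (\<integral>\<^sup>+y. \<integral>\<^sup>+s. f (s *\<^sub>R a + y b *\<^sub>R b) \<partial>lborel \<partial>Pi\<^sub>M {b} (\<lambda>_. lborel))"
  proof -
    have "(\<lambda>y. f (y a *\<^sub>R a + y b *\<^sub>R b)) \<in> borel_measurable (Pi\<^sub>M {a, b} (\<lambda>_. lborel))" by measurable
    from P.product_nn_integral_insert[OF _ _ this] show ?thesis using B(2) by simp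
  qed
  also have "\<dots> = (\<integral>\<^sup>+t. \<integral>\<^sup>+s. f (s *\<^sub>R a + t *\<^sub>R b) \<partial>lborel \<partial>lborel)"
    by (rule P.product_nn_integral_singleton[where f = "\<lambda>t. \<integral>\<^sup>+s. f (s *\<^sub>R a + t *\<^sub>R b) \<partial>lborel"]) measurable
  finally show ?thesis .
qed

lemma nn_integral_lborel_3:
  fixes f :: "'a::euclidean_space \<Rightarrow> ennreal"
  assumes B: "Basis = {a, b, c}" "a \<noteq> b" "a \<noteq> c" "b \<noteq> c" and f[measurable]: "f \<in> borel_measurable borel"
  shows "(\<integral>\<^sup>+x. f x \<partial>lborel) = (\<integral>\<^sup>+r. \<integral>\<^sup>+t. \<integral>\<^sup>+s. f (s *\<^sub>R a + t *\<^sub>R b + r *\<^sub>R c) \<partial>lborel \<partial>lborel \<partial>lborel)"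
proof -
  interpret P: product_sigma_finite "\<lambda>_::'a. lborel :: real measure" ..
  have "(\<integral>\<^sup>+x. f x \<partial>lborel) = (\<integral>\<^sup>+y. f (y a *\<^sub>R a + y b *\<^sub>R b + y c *\<^sub>R c) \<partial>Pi\<^sub>M {a, b, c} (\<lambda>_. lborel))"
    unfolding nn_integral_lborel_Basis[OF f] B(1) using B(2-4) by (simp add: add.assoc)
  also have "\<dots> = (\<integral>\<^sup>+y. \<integral>\<^sup>+s. f (s *\<^sub>R a + y b *\<^sub>R b + y c *\<^sub>R c) \<partial>lborel \<partial>Pi\<^sub>M {b, c} (\<lambda>_. lborel))"
  proof -
    have "(\<lambda>y. f (y a *\<^sub>R a + y b *\<^sub>R b + y c *\<^sub>R c)) \<in> borel_measurable (Pi\<^sub>M {a, b, c} (\<lambda>_. lborel))"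
      by measurable
    from P.product_nn_integral_insert[OF _ _ this] show ?thesis using B(2-4) by simp
  qed
  also have "\<dots> = (\<integral>\<^sup>+y. \<integral>\<^sup>+t. \<integral>\<^sup>+s. f (s *\<^sub>R a + t *\<^sub>R b + y c *\<^sub>R c) \<partial>lborel \<partial>lborel \<partial>Pi\<^sub>M {c} (\<lambda>_. lborel))"
  proof -
    have "(\<lambda>y. \<integral>\<^sup>+s. f (s *\<^sub>R a + y b *\<^sub>R b + y c *\<^sub>R c) \<partial>lborel) \<in> borel_measurable (Pi\<^sub>M {b, c} (\<lambda>_. lborel))"
      by measurable
    from P.product_nn_integral_insert[OF _ _ this] show ?thesis using B(2-4) by simp
  qed
  also have "\<dots> = (\<integral>\<^sup>+r. \<integral>\<^sup>+t. \<integral>\<^sup>+s. f (s *\<^sub>R a + t *\<^sub>R b + r *\<^sub>R c) \<partial>lborel \<partial>lborel \<partial>lborel)"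
    by (rule P.product_nn_integral_singleton[where
      f = "\<lambda>r. \<integral>\<^sup>+t. \<integral>\<^sup>+s. f (s *\<^sub>R a + t *\<^sub>R b + r *\<^sub>R c) \<partial>lborel \<partial>lborel"]) measurable
  finally show ?thesis .
qed

text \<open>Far out on the line \<phi> vanishes, so \<phi>^2 is the integral of its derivative up to
  t; absolute values and the full line only enlarge it. The right-hand side is independent of t,
  which is what separates the variables later.\<close>

lemma square_le_line_integral:
  fixes \<phi> :: "real^'d \<Rightarrow> real"
  assumes \<phi>: "\<phi> \<in> test_functions \<Omega>"
  shows "ennreal ((\<phi> (x + t *\<^sub>R axis i 1))\<^sup>2)
    \<le> (\<integral>\<^sup>+s. ennreal (2 * \<bar>\<phi> (x + s *\<^sub>R axis i 1)\<bar> * \<bar>partial i \<phi> (x + s *\<^sub>R axis i 1)\<bar>) \<partial>lborel)"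
proof -
  let ?e = "axis i 1 :: real^'d"
  define g where "g s = 2 * \<phi> (x + s *\<^sub>R ?e) * partial i \<phi> (x + s *\<^sub>R ?e)" for s
  have sm: "smooth \<phi>" by (rule test_functions_smooth[OF \<phi>])
  have cont: "continuous_on S (\<lambda>s. \<rho> (x + s *\<^sub>R ?e))" if "smooth \<rho>" for \<rho> S
    by (rule continuous_on_compose2[OF smooth_continuous[OF that, of UNIV]]) (auto intro!: continuous_intros)
  have cg: "continuous_on S g" for S
    unfolding g_def by (intro continuous_intros cont sm smooth_partial)
  obtain R where R: "R > 0" "\<And>x. norm x \<ge> R \<Longrightarrow> \<phi> x = 0"
    using test_function_support[OF \<phi>] by blast
  \<comment> \<open>Chosen so that s0 is at most t and the point x + s0 e has norm at least
    R.\<close>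
  define s0 where "s0 = - (R + norm x + \<bar>t\<bar>)"
  have s0: "s0 \<le> t" using R(1) norm_ge_zero[of x] unfolding s0_def by linarith
  have "norm (s0 *\<^sub>R ?e + x) \<ge> norm (s0 *\<^sub>R ?e) - norm x" by (rule norm_diff_ineq)
  moreover have "s0 \<le> 0" using R(1) norm_ge_zero[of x] unfolding s0_def by linarith
  then have "norm (s0 *\<^sub>R ?e) = R + norm x + \<bar>t\<bar>" by (simp add: norm_axis_1) (simp add: s0_def)
  ultimately have z: "\<phi> (x + s0 *\<^sub>R ?e) = 0" by (intro R(2)) (simp add: add.commute)
  have "(\<integral>s. indicator {s0..t} s *\<^sub>R g s \<partial>lborel) = (\<phi> (x + t *\<^sub>R ?e))\<^sup>2 - (\<phi> (x + s0 *\<^sub>R ?e))\<^sup>2"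
  proof (rule integral_FTC_atLeastAtMost[OF s0 _ cg])
    fix s
    have "((\<lambda>s. (\<phi> (x + s *\<^sub>R ?e))\<^sup>2) has_real_derivative g s) (at s within {s0..t})"
      unfolding g_def
      by (auto intro!: derivative_eq_intros DERIV_subset[OF smooth_line_derivative[OF sm]])
    then show "((\<lambda>s. (\<phi> (x + s *\<^sub>R ?e))\<^sup>2) has_vector_derivative g s) (at s within {s0..t})"
      by (simp add: has_real_derivative_iff_has_vector_derivative)
  qed
  then have "ennreal ((\<phi> (x + t *\<^sub>R ?e))\<^sup>2) = ennreal (norm (\<integral>s. indicator {s0..t} s *\<^sub>R g s \<partial>lborel))"
    using z by simp
  also have "\<dots> \<le> (\<integral>\<^sup>+s. norm (indicator {s0..t} s *\<^sub>R g s) \<partial>lborel)"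
    by (rule integral_norm_bound_ennreal) (intro borel_integrable_compact compact_Icc cg)
  also have "\<dots> \<le> (\<integral>\<^sup>+s. ennreal (2 * \<bar>\<phi> (x + s *\<^sub>R ?e)\<bar> * \<bar>partial i \<phi> (x + s *\<^sub>R ?e)\<bar>) \<partial>lborel)"
    by (intro nn_integral_mono ennreal_leI) (auto simp: g_def indicator_def abs_mult)
  finally show ?thesis .
qed

text \<open>A substitute for square roots in \<open>ennreal\<close>: the product is at most the
  square of the larger factor.\<close>

lemma mult_le_if_power2_le:
  fixes A B C :: ennreal
  assumes "A\<^sup>2 \<le> C" "B\<^sup>2 \<le> C"
  shows "A * B \<le> C"
proof (cases "A \<le> B")
  case True
  then have "A * B \<le> B * B" by (intro mult_right_mono) auto
  then show ?thesis using assms by (simp add: power2_eq_square)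
next
  case False
  then have "A * B \<le> A * A" by (intro mult_left_mono) auto
  then show ?thesis using assms by (simp add: power2_eq_square)
qed

text \<open>On the plane through \<open>p\<close> in the directions \<open>i\<close> and \<open>j\<close>, the function \<open>\<phi>\<^sup>2\<close> is bounded both by a
  function of the first and by a function of the second coordinate.\<close>

lemma Ladyzhenskaya_plane:
  fixes \<phi> :: "real^'d \<Rightarrow> real" and p :: "real^'d" and i j :: 'd
  assumes \<phi>: "\<phi> \<in> test_functions \<Omega>"
  defines "pt \<equiv> \<lambda>s t. p + s *\<^sub>R axis i 1 + t *\<^sub>R axis j 1"
  shows "(\<integral>\<^sup>+t. \<integral>\<^sup>+s. ennreal ((\<phi> (pt s t))^4) \<partial>lborel \<partial>lborel)
    \<le> 4 * (\<integral>\<^sup>+t. \<integral>\<^sup>+s. ennreal ((\<phi> (pt s t))\<^sup>2) \<partial>lborel \<partial>lborel)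
        * (\<integral>\<^sup>+t. \<integral>\<^sup>+s. ennreal ((norm (grad \<phi> (pt s t)))\<^sup>2) \<partial>lborel \<partial>lborel)"
proof -
  have sm: "smooth \<phi>" by (rule test_functions_smooth[OF \<phi>])
  have [measurable]: "\<phi> \<in> borel_measurable borel" by (rule smooth_borel[OF sm])
  have pm[measurable]: "partial k \<phi> \<in> borel_measurable borel" for k
    by (rule smooth_borel[OF smooth_partial[OF sm]])
  define A where "A k s t = ennreal (2 * \<bar>\<phi> (pt s t)\<bar> * \<bar>partial k \<phi> (pt s t)\<bar>)" for k s t
  define S where "S = (\<integral>\<^sup>+t. \<integral>\<^sup>+s. ennreal ((\<phi> (pt s t))\<^sup>2) \<partial>lborel \<partial>lborel)"
  define D where "D = (\<integral>\<^sup>+t. \<integral>\<^sup>+s. ennreal ((norm (grad \<phi> (pt s t)))\<^sup>2) \<partial>lborel \<partial>lborel)"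
  define P where "P t = (\<integral>\<^sup>+s. A i s t \<partial>lborel)" for t
  define Q where "Q s = (\<integral>\<^sup>+t. A j s t \<partial>lborel)" for s
  have [measurable]: "(\<lambda>(t, s). A k s t) \<in> borel_measurable (lborel \<Otimes>\<^sub>M lborel)"
    "(\<lambda>(s, t). A k s t) \<in> borel_measurable (lborel \<Otimes>\<^sub>M lborel)" for k
    unfolding A_def pt_def by measurable
  have [measurable]: "P \<in> borel_measurable lborel" "Q \<in> borel_measurable lborel"
    unfolding P_def[abs_def] Q_def[abs_def] by measurable
  have "ennreal ((\<phi> (pt s t))^4) \<le> P t * Q s" for s t
  proof -
    have "ennreal ((\<phi> (pt s t))^4) = ennreal ((\<phi> (pt s t))\<^sup>2) * ennreal ((\<phi> (pt s t))\<^sup>2)"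
      by (simp add: ennreal_mult[symmetric] flip: power_add)
    also have "\<dots> \<le> P t * Q s"
    proof (rule mult_mono)
      show "ennreal ((\<phi> (pt s t))\<^sup>2) \<le> P t"
        using square_le_line_integral[OF \<phi>, of "p + t *\<^sub>R axis j 1" s i]
        by (simp add: P_def A_def pt_def add_ac)
      show "ennreal ((\<phi> (pt s t))\<^sup>2) \<le> Q s"
        using square_le_line_integral[OF \<phi>, of "p + s *\<^sub>R axis i 1" t j]
        by (simp add: Q_def A_def pt_def add_ac)
    qed auto
    finally show ?thesis .
  qed
  then have "(\<integral>\<^sup>+t. \<integral>\<^sup>+s. ennreal ((\<phi> (pt s t))^4) \<partial>lborel \<partial>lborel) \<le> (\<integral>\<^sup>+t. \<integral>\<^sup>+s. P t * Q s \<partial>lborel \<partial>lborel)"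
    by (intro nn_integral_mono)
  also have "\<dots> = (\<integral>\<^sup>+t. P t \<partial>lborel) * (\<integral>\<^sup>+s. Q s \<partial>lborel)"
    by (simp add: nn_integral_cmult nn_integral_multc)
  also have "\<dots> \<le> 4 * S * D"
  proof (rule mult_le_if_power2_le)
    \<comment> \<open>Cauchy-Schwarz on the plane with the factors 2 |\<phi>| and |\<partial>_k
      \<phi>|; squaring the 2 gives the constant 4.\<close>
    have CS: "(\<integral>\<^sup>+t. \<integral>\<^sup>+s. A k s t \<partial>lborel \<partial>lborel)\<^sup>2 \<le> 4 * S * D" for k
    proof -
      define f where "f = (\<lambda>(t, s). ennreal (2 * \<bar>\<phi> (pt s t)\<bar>))"
      define g where "g = (\<lambda>(t, s). ennreal \<bar>partial k \<phi> (pt s t)\<bar>)"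
      have [measurable]: "f \<in> borel_measurable (lborel \<Otimes>\<^sub>M lborel)" "g \<in> borel_measurable (lborel \<Otimes>\<^sub>M lborel)"
        unfolding f_def g_def pt_def by measurable
      have fst: "(\<integral>\<^sup>+z. h z \<partial>(lborel \<Otimes>\<^sub>M lborel)) = (\<integral>\<^sup>+t. \<integral>\<^sup>+s. h (t, s) \<partial>lborel \<partial>lborel)"
        if "h \<in> borel_measurable (lborel \<Otimes>\<^sub>M lborel)" for h :: "real \<times> real \<Rightarrow> ennreal"
        by (rule lborel.nn_integral_fst[symmetric, OF that])
      have "(\<integral>\<^sup>+z. f z * g z \<partial>(lborel \<Otimes>\<^sub>M lborel)) = (\<integral>\<^sup>+t. \<integral>\<^sup>+s. f (t, s) * g (t, s) \<partial>lborel \<partial>lborel)"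
        by (rule fst) measurable
      then have "(\<integral>\<^sup>+t. \<integral>\<^sup>+s. A k s t \<partial>lborel \<partial>lborel) = (\<integral>\<^sup>+z. f z * g z \<partial>(lborel \<Otimes>\<^sub>M lborel))"
        by (simp add: f_def g_def A_def ennreal_mult)
      then have "(\<integral>\<^sup>+t. \<integral>\<^sup>+s. A k s t \<partial>lborel \<partial>lborel)\<^sup>2
          \<le> (\<integral>\<^sup>+z. (f z)\<^sup>2 \<partial>(lborel \<Otimes>\<^sub>M lborel)) * (\<integral>\<^sup>+z. (g z)\<^sup>2 \<partial>(lborel \<Otimes>\<^sub>M lborel))"
        by (simp add: Cauchy_Schwarz_nn_integral)
      also have "(\<integral>\<^sup>+z. (f z)\<^sup>2 \<partial>(lborel \<Otimes>\<^sub>M lborel)) = (\<integral>\<^sup>+t. \<integral>\<^sup>+s. (f (t, s))\<^sup>2 \<partial>lborel \<partial>lborel)"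
        by (rule fst) measurable
      also have "\<dots> = (\<integral>\<^sup>+t. \<integral>\<^sup>+s. 4 * ennreal ((\<phi> (pt s t))\<^sup>2) \<partial>lborel \<partial>lborel)"
        by (simp add: f_def power_mult_distrib ennreal_power ennreal_mult)
      also have "\<dots> = 4 * S"
        unfolding S_def pt_def by (simp add: nn_integral_cmult)
      also have "(\<integral>\<^sup>+z. (g z)\<^sup>2 \<partial>(lborel \<Otimes>\<^sub>M lborel)) = (\<integral>\<^sup>+t. \<integral>\<^sup>+s. (g (t, s))\<^sup>2 \<partial>lborel \<partial>lborel)"
        by (rule fst) measurable
      also have "\<dots> = (\<integral>\<^sup>+t. \<integral>\<^sup>+s. ennreal ((partial k \<phi> (pt s t))\<^sup>2) \<partial>lborel \<partial>lborel)"
        by (simp add: g_def ennreal_power)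
      also have "\<dots> \<le> D"
        unfolding D_def
      proof (intro nn_integral_mono ennreal_leI)
        fix s t
        have "\<bar>grad \<phi> (pt s t) $ k\<bar> \<le> norm (grad \<phi> (pt s t))" by (rule component_le_norm_cart)
        from power_mono[OF this, of 2] show "(partial k \<phi> (pt s t))\<^sup>2 \<le> (norm (grad \<phi> (pt s t)))\<^sup>2"
          by (simp add: grad_def)
      qed
      finally show ?thesis by (simp add: mult_left_mono)
    qed
    show "(\<integral>\<^sup>+t. P t \<partial>lborel)\<^sup>2 \<le> 4 * S * D" unfolding P_def by (rule CS)
    \<comment> \<open>\<open>Q\<close> integrates first in the other variable, so the order has to
      be exchanged before \<open>CS\<close> applies.\<close>
    have "(\<integral>\<^sup>+s. Q s \<partial>lborel) = (\<integral>\<^sup>+t. \<integral>\<^sup>+s. A j s t \<partial>lborel \<partial>lborel)"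
      unfolding Q_def by (rule lborel_pair.Fubini') measurable
    then show "(\<integral>\<^sup>+s. Q s \<partial>lborel)\<^sup>2 \<le> 4 * S * D" using CS by simp
  qed
  finally show ?thesis unfolding S_def D_def .
qed

text \<open>In dimension two the planar estimate covers the whole space. In dimension three, the
  line estimate in the remaining direction bounds the integral of \<phi>^2 over every slice by
  \<open>N\<close>, uniformly; only the gradient factor is left to integrate over the
  slices.\<close>

lemma Ladyzhenskaya_nn:
  fixes \<phi> :: "real^'d \<Rightarrow> real"
  assumes dim: "CARD('d) \<in> {2, 3}" and \<phi>: "\<phi> \<in> test_functions \<Omega>"
  defines "N \<equiv> (\<integral>\<^sup>+x. ennreal ((\<phi> x)\<^sup>2 + (norm (grad \<phi> x))\<^sup>2) \<partial>lborel)"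
  shows "(\<integral>\<^sup>+x. ennreal ((\<phi> x)^4) \<partial>lborel) \<le> 4 * N * N"
proof -
  have sm: "smooth \<phi>" by (rule test_functions_smooth[OF \<phi>])
  have [measurable]: "\<phi> \<in> borel_measurable borel" by (rule smooth_borel[OF sm])
  have [measurable]: "partial k \<phi> \<in> borel_measurable borel" for k
    by (rule smooth_borel[OF smooth_partial[OF sm]])
  have [measurable]: "grad \<phi> \<in> borel_measurable borel"
    unfolding grad_def[abs_def]
    by (intro borel_measurable_continuous_onI continuous_on_vec_lambda smooth_continuous smooth_partial sm)
  have leN: "(\<integral>\<^sup>+x. ennreal ((\<phi> x)\<^sup>2) \<partial>lborel) \<le> N" "(\<integral>\<^sup>+x. ennreal ((norm (grad \<phi> x))\<^sup>2) \<partial>lborel) \<le> N"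
    unfolding N_def by (auto intro!: nn_integral_mono ennreal_leI)
  have axis: "\<exists>i. b = axis i 1" if "b \<in> Basis" for b :: "real^'d"
    using that by (auto simp: Basis_vec_def)
  from dim consider "card (Basis :: (real^'d) set) = 2" | "card (Basis :: (real^'d) set) = 3" by auto
  then show ?thesis
  proof cases
    case 1
    then obtain a b :: "real^'d" where B: "Basis = {a, b}" "a \<noteq> b" unfolding card_2_iff by blast
    obtain i j where ij: "a = axis i 1" "b = axis j 1" using axis[of a] axis[of b] B by blast
    have slice: "(\<integral>\<^sup>+x. h x \<partial>lborel)
        = (\<integral>\<^sup>+t. \<integral>\<^sup>+s. h (0 + s *\<^sub>R axis i 1 + t *\<^sub>R axis j 1) \<partial>lborel \<partial>lborel)"
      if "h \<in> borel_measurable borel" for h :: "real^'d \<Rightarrow> ennreal"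
      using nn_integral_lborel_2[OF B that] unfolding ij add_0 .
    have "(\<integral>\<^sup>+x. ennreal ((\<phi> x)^4) \<partial>lborel)
        = (\<integral>\<^sup>+t. \<integral>\<^sup>+s. ennreal ((\<phi> (0 + s *\<^sub>R axis i 1 + t *\<^sub>R axis j 1))^4) \<partial>lborel \<partial>lborel)"
      by (rule slice) measurable
    also note Ladyzhenskaya_plane[OF \<phi>, of 0 i j]
    also have "(\<integral>\<^sup>+t. \<integral>\<^sup>+s. ennreal ((\<phi> (0 + s *\<^sub>R axis i 1 + t *\<^sub>R axis j 1))\<^sup>2) \<partial>lborel \<partial>lborel)
        = (\<integral>\<^sup>+x. ennreal ((\<phi> x)\<^sup>2) \<partial>lborel)"
      by (rule slice[symmetric]) measurable
    also have "(\<integral>\<^sup>+t. \<integral>\<^sup>+s. ennreal ((norm (grad \<phi> (0 + s *\<^sub>R axis i 1 + t *\<^sub>R axis j 1)))\<^sup>2) \<partial>lborel \<partial>lborel)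
        = (\<integral>\<^sup>+x. ennreal ((norm (grad \<phi> x))\<^sup>2) \<partial>lborel)"
      by (rule slice[symmetric]) measurable
    also have "4 * (\<integral>\<^sup>+x. ennreal ((\<phi> x)\<^sup>2) \<partial>lborel) * (\<integral>\<^sup>+x. ennreal ((norm (grad \<phi> x))\<^sup>2) \<partial>lborel) \<le> 4 * N * N"
      by (intro mult_mono leN) auto
    finally show ?thesis .
  next
    case 2
    then obtain a b c :: "real^'d" where B: "Basis = {a, b, c}" "a \<noteq> b" "a \<noteq> c" "b \<noteq> c"
      unfolding card_3_iff by blast
    obtain i j k where ijk: "a = axis i 1" "b = axis j 1" "c = axis k 1"
      using axis[of a] axis[of b] axis[of c] B by blast
    note slice = nn_integral_lborel_3[OF B]
    let ?S = "\<lambda>r. \<integral>\<^sup>+t. \<integral>\<^sup>+s. ennreal ((\<phi> (s *\<^sub>R a + t *\<^sub>R b + r *\<^sub>R c))\<^sup>2) \<partial>lborel \<partial>lborel"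
    let ?D = "\<lambda>r. \<integral>\<^sup>+t. \<integral>\<^sup>+s. ennreal ((norm (grad \<phi> (s *\<^sub>R a + t *\<^sub>R b + r *\<^sub>R c)))\<^sup>2) \<partial>lborel \<partial>lborel"
    define A where "A x = ennreal (2 * \<bar>\<phi> x\<bar> * \<bar>partial k \<phi> x\<bar>)" for x
    have [measurable]: "A \<in> borel_measurable borel" unfolding A_def[abs_def] by measurable
    have S: "?S r \<le> N" for r
    proof -
      have "?S r \<le> (\<integral>\<^sup>+t. \<integral>\<^sup>+s. \<integral>\<^sup>+r. A (s *\<^sub>R a + t *\<^sub>R b + r *\<^sub>R c) \<partial>lborel \<partial>lborel \<partial>lborel)"
        unfolding A_def ijk by (intro nn_integral_mono square_le_line_integral[OF \<phi>])
      \<comment> \<open>Two exchanges move the third direction outermost, the order used by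
        \<open>slice\<close>.\<close>
      also have "\<dots> = (\<integral>\<^sup>+t. \<integral>\<^sup>+r. \<integral>\<^sup>+s. A (s *\<^sub>R a + t *\<^sub>R b + r *\<^sub>R c) \<partial>lborel \<partial>lborel \<partial>lborel)"
        by (intro nn_integral_cong lborel_pair.Fubini') measurable
      also have "\<dots> = (\<integral>\<^sup>+r. \<integral>\<^sup>+t. \<integral>\<^sup>+s. A (s *\<^sub>R a + t *\<^sub>R b + r *\<^sub>R c) \<partial>lborel \<partial>lborel \<partial>lborel)"
        by (rule lborel_pair.Fubini') measurable
      also have "\<dots> = (\<integral>\<^sup>+x. A x \<partial>lborel)" by (rule slice[symmetric]) measurable
      also have "\<dots> \<le> N"
        unfolding N_def A_def
      proof (intro nn_integral_mono ennreal_leI)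
        fix x
        have "\<bar>partial k \<phi> x\<bar> \<le> norm (grad \<phi> x)"
          using component_le_norm_cart[of "grad \<phi> x" k] by (simp add: grad_def)
        then have "2 * \<bar>\<phi> x\<bar> * \<bar>partial k \<phi> x\<bar> \<le> 2 * \<bar>\<phi> x\<bar> * norm (grad \<phi> x)"
          by (intro mult_left_mono) auto
        also have "\<dots> \<le> (\<phi> x)\<^sup>2 + (norm (grad \<phi> x))\<^sup>2"
          using sum_squares_bound[of "\<bar>\<phi> x\<bar>" "norm (grad \<phi> x)"] by simp
        finally show "2 * \<bar>\<phi> x\<bar> * \<bar>partial k \<phi> x\<bar> \<le> (\<phi> x)\<^sup>2 + (norm (grad \<phi> x))\<^sup>2" .
      qed
      finally show ?thesis .
    qed
    have "(\<integral>\<^sup>+x. ennreal ((\<phi> x)^4) \<partial>lborel)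
        = (\<integral>\<^sup>+r. \<integral>\<^sup>+t. \<integral>\<^sup>+s. ennreal ((\<phi> (s *\<^sub>R a + t *\<^sub>R b + r *\<^sub>R c))^4) \<partial>lborel \<partial>lborel \<partial>lborel)"
      by (rule slice) measurable
    also have "\<dots> \<le> (\<integral>\<^sup>+r. 4 * N * ?D r \<partial>lborel)"
    proof (rule nn_integral_mono)
      fix r
      have "(\<integral>\<^sup>+t. \<integral>\<^sup>+s. ennreal ((\<phi> (s *\<^sub>R a + t *\<^sub>R b + r *\<^sub>R c))^4) \<partial>lborel \<partial>lborel) \<le> 4 * ?S r * ?D r"
        using Ladyzhenskaya_plane[OF \<phi>, of "r *\<^sub>R c" i j] by (simp add: add_ac flip: ijk)
      also have "\<dots> \<le> 4 * N * ?D r" by (intro mult_mono S) auto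
      finally show "(\<integral>\<^sup>+t. \<integral>\<^sup>+s. ennreal ((\<phi> (s *\<^sub>R a + t *\<^sub>R b + r *\<^sub>R c))^4) \<partial>lborel \<partial>lborel) \<le> 4 * N * ?D r" .
    qed
    also have "\<dots> = 4 * N * (\<integral>\<^sup>+r. ?D r \<partial>lborel)"
      by (rule nn_integral_cmult) measurable
    also have "(\<integral>\<^sup>+r. ?D r \<partial>lborel) = (\<integral>\<^sup>+x. ennreal ((norm (grad \<phi> x))\<^sup>2) \<partial>lborel)"
      by (rule slice[symmetric]) measurable
    also have "4 * N * \<dots> \<le> 4 * N * N" by (intro mult_left_mono leN) auto
    finally show ?thesis .
  qed
qed

lemma integrable_test_function:
  assumes "\<phi> \<in> test_functions \<Omega>"
  shows "integrable lborel \<phi>"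
proof -
  obtain K where K: "smooth \<phi>" "compact K" "\<And>x. x \<notin> K \<Longrightarrow> \<phi> x = 0"
    by (rule test_functionsE[OF assms], rule that)
  have "integrable lborel (\<lambda>x. indicator K x *\<^sub>R \<phi> x)"
    by (intro borel_integrable_compact K smooth_continuous)
  moreover have "(\<lambda>x. indicator K x *\<^sub>R \<phi> x) = \<phi>"
    using K(3) by (auto simp: indicator_def fun_eq_iff)
  ultimately show ?thesis by simp
qed

context bounded_open
begin

lemma nn_integral_test_function:
  assumes "\<phi> \<in> test_functions \<Omega>" "\<And>x. 0 \<le> \<phi> x"
  shows "(\<integral>\<^sup>+x. ennreal (\<phi> x) \<partial>lborel) = ennreal (\<integral>x. \<phi> x \<partial>lebesgue_on \<Omega>)"
proof -
  have "(\<integral>x. \<phi> x \<partial>lebesgue_on \<Omega>) = (\<integral>x. \<phi> x \<partial>lborel)"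
    by (rule integral_domain[OF smooth_borel[OF test_functions_smooth[OF assms(1)]]
        test_function_vanishes[OF assms(1)]])
  then show ?thesis
    using nn_integral_eq_integral[OF integrable_test_function[OF assms(1)]] assms(2) by simp
qed

text \<open>The integrands \<phi>^4 and \<phi>^2 + |grad \<phi>|^2 are themselves test functions, so
  both integrals are finite and become L2 quantities. The factor 2 is the square root of the 4
  above.\<close>

lemma Ladyzhenskaya_test_function:
  assumes dim: "CARD('d) \<in> {2, 3}" and \<phi>: "\<phi> \<in> test_functions \<Omega>"
  shows "L2_norm \<Omega> (\<lambda>x. (\<phi> x)\<^sup>2) \<le> 2 * ((L2_norm \<Omega> \<phi>)\<^sup>2 + (L2_norm \<Omega> (grad \<phi>))\<^sup>2)"
proof -
  let ?n = "(L2_norm \<Omega> \<phi>)\<^sup>2 + (L2_norm \<Omega> (grad \<phi>))\<^sup>2"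
  have sm: "smooth \<phi>" by (rule test_functions_smooth[OF \<phi>])
  have t2: "(\<lambda>x. (\<phi> x)\<^sup>2) \<in> test_functions \<Omega>"
    unfolding power2_eq_square by (rule test_functions_mult[OF sm \<phi>])
  have t4: "(\<lambda>x. (\<phi> x)^4) \<in> test_functions \<Omega>"
    using test_functions_mult[OF test_functions_smooth[OF t2] t2] by (simp flip: power_add)
  have tg: "(\<lambda>x. \<Sum>i\<in>UNIV. (partial i \<phi> x)\<^sup>2) \<in> test_functions \<Omega>"
  proof -
    have "(\<lambda>x. \<Sum>i\<in>I. (partial i \<phi> x)\<^sup>2) \<in> test_functions \<Omega>" for I
      unfolding power2_eq_square
      by (induction I rule: infinite_finite_induct)
         (auto intro!: test_functions_zero test_functions_add test_functions_mult test_functions_partial \<phi> smooth_partial sm)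
    then show ?thesis .
  qed
  have ng: "(norm (grad \<phi> x))\<^sup>2 = (\<Sum>i\<in>UNIV. (partial i \<phi> x)\<^sup>2)" for x
    unfolding power2_norm_eq_inner by (simp add: grad_def inner_vec_def power2_eq_square)
  have tN: "(\<lambda>x. (\<phi> x)\<^sup>2 + (norm (grad \<phi> x))\<^sup>2) \<in> test_functions \<Omega>"
    unfolding ng by (rule test_functions_add[OF t2 tg])
  have i1: "(\<integral>x. (\<phi> x)^4 \<partial>lebesgue_on \<Omega>) = (L2_norm \<Omega> (\<lambda>x. (\<phi> x)\<^sup>2))\<^sup>2"
    by (simp add: L2_norm_power2 L2_inner_def flip: power_add)
  have i2: "(\<integral>x. (\<phi> x)\<^sup>2 + (norm (grad \<phi> x))\<^sup>2 \<partial>lebesgue_on \<Omega>) = ?n"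
    using L2_inner_integrable[OF test_function_L2[OF \<phi>] test_function_L2[OF \<phi>]]
      L2_inner_integrable[OF grad_L2[OF \<phi>] grad_L2[OF \<phi>]]
    by (simp add: L2_norm_power2 L2_inner_def power2_norm_eq_inner power2_eq_square[of "\<phi> _"])
  have n: "(\<integral>\<^sup>+x. ennreal ((\<phi> x)^4) \<partial>lborel) = ennreal (\<integral>x. (\<phi> x)^4 \<partial>lebesgue_on \<Omega>)"
    "(\<integral>\<^sup>+x. ennreal ((\<phi> x)\<^sup>2 + (norm (grad \<phi> x))\<^sup>2) \<partial>lborel)
      = ennreal (\<integral>x. (\<phi> x)\<^sup>2 + (norm (grad \<phi> x))\<^sup>2 \<partial>lebesgue_on \<Omega>)"
    by (rule nn_integral_test_function[OF t4], simp, rule nn_integral_test_function[OF tN], simp)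
  have "ennreal ((L2_norm \<Omega> (\<lambda>x. (\<phi> x)\<^sup>2))\<^sup>2) \<le> 4 * ennreal ?n * ennreal ?n"
    using Ladyzhenskaya_nn[OF dim \<phi>]
    unfolding n i1 i2 .
  also have "\<dots> = ennreal ((2 * ?n)\<^sup>2)"
  proof -
    have *: "4 * ennreal r * ennreal r = ennreal ((2 * r)\<^sup>2)" if "0 \<le> r" for r :: real
    proof -
      have "(2 * r)\<^sup>2 = 4 * r * r" by (simp add: power2_eq_square)
      then show ?thesis using that by (simp add: ennreal_mult mult.assoc)
    qed
    show ?thesis by (rule *) simp
  qed
  finally have "(L2_norm \<Omega> (\<lambda>x. (\<phi> x)\<^sup>2))\<^sup>2 \<le> (2 * ?n)\<^sup>2"
    by (simp add: ennreal_le_iff)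
  then show ?thesis by (rule power2_le_imp_le) simp
qed

end

section \<open>The convective form on H10\<close>

lemma L2_norm_tendsto:
  assumes "u \<in> L2 \<Omega>" "\<And>n. f n \<in> L2 \<Omega>" "(\<lambda>n. L2_norm \<Omega> (\<lambda>x. u x - f n x)) \<longlonglongrightarrow> 0"
  shows "(\<lambda>n. L2_norm \<Omega> (f n)) \<longlonglongrightarrow> L2_norm \<Omega> u"
proof (rule LIM_zero_cancel, rule Lim_null_comparison[OF _ assms(3)], rule always_eventually, rule allI)
  fix n
  have "L2_norm \<Omega> (f n) \<le> L2_norm \<Omega> (\<lambda>x. f n x - u x) + L2_norm \<Omega> u"
    by (rule L2_norm_triangle_diff[OF assms(2,1)])
  moreover have "L2_norm \<Omega> (\<lambda>x. f n x - u x) = L2_norm \<Omega> (\<lambda>x. u x - f n x)"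
    using L2_norm_uminus[of \<Omega> "\<lambda>x. u x - f n x"] by simp
  moreover have "L2_norm \<Omega> u \<le> L2_norm \<Omega> (\<lambda>x. u x - f n x) + L2_norm \<Omega> (f n)"
    by (rule L2_norm_triangle_diff[OF assms(1,2)])
  ultimately show "norm (L2_norm \<Omega> (f n) - L2_norm \<Omega> u) \<le> L2_norm \<Omega> (\<lambda>x. u x - f n x)"
    unfolding real_norm_def by linarith
qed

lemma L2_inner_tendsto:
  assumes f: "f \<in> L2 \<Omega>" "\<And>n. fs n \<in> L2 \<Omega>" "(\<lambda>n. L2_norm \<Omega> (\<lambda>x. f x - fs n x)) \<longlonglongrightarrow> 0"
    and g: "g \<in> L2 \<Omega>" "\<And>n. gs n \<in> L2 \<Omega>" "(\<lambda>n. L2_norm \<Omega> (\<lambda>x. g x - gs n x)) \<longlonglongrightarrow> 0"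
  shows "(\<lambda>n. L2_inner \<Omega> (fs n) (gs n)) \<longlonglongrightarrow> L2_inner \<Omega> f g"
proof (rule LIM_zero_cancel, rule Lim_null_comparison)
  let ?b = "\<lambda>n. L2_norm \<Omega> (\<lambda>x. f x - fs n x) * L2_norm \<Omega> g + L2_norm \<Omega> (fs n) * L2_norm \<Omega> (\<lambda>x. g x - gs n x)"
  show "\<forall>\<^sub>F n in sequentially. norm (L2_inner \<Omega> (fs n) (gs n) - L2_inner \<Omega> f g) \<le> ?b n"
  proof (rule always_eventually, rule allI)
    fix n
    have "L2_inner \<Omega> f g - L2_inner \<Omega> (fs n) (gs n)
        = L2_inner \<Omega> (\<lambda>x. f x - fs n x) g + L2_inner \<Omega> (fs n) (\<lambda>x. g x - gs n x)"
      using f g by (simp add: L2_inner_diff_left L2_inner_diff_right)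
    then show "norm (L2_inner \<Omega> (fs n) (gs n) - L2_inner \<Omega> f g) \<le> ?b n"
      using L2_Cauchy_Schwarz[OF L2_diff[OF f(1) f(2)[of n]] g(1)]
        L2_Cauchy_Schwarz[OF f(2)[of n] L2_diff[OF g(1) g(2)[of n]]]
      unfolding real_norm_def by linarith
  qed
  have "?b \<longlonglongrightarrow> 0 * L2_norm \<Omega> g + L2_norm \<Omega> f * 0"
    by (intro tendsto_intros f(3) g(3) L2_norm_tendsto[OF f])
  then show "?b \<longlonglongrightarrow> 0" by simp
qed

context bounded_open
begin

text \<open>L2 convergence yields almost everywhere convergence of a subsequence of the test
  functions. Fatou's lemma along it carries over the bounds \<open>cs n\<close>, which converge to
  \<open>c\<close>.\<close>

lemma H10_L4:
  assumes dim: "CARD('d) \<in> {2, 3}" and u: "u \<in> H10 \<Omega>"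
  shows "(\<lambda>x. (u x)\<^sup>2) \<in> L2 \<Omega>"
    and "L2_norm \<Omega> (\<lambda>x. (u x)\<^sup>2) \<le> 2 * ((L2_norm \<Omega> u)\<^sup>2 + (L2_norm \<Omega> (weak_grad \<Omega> u))\<^sup>2)"
proof -
  let ?M = "lebesgue_on \<Omega>"
  obtain \<phi> where \<phi>: "\<And>n. \<phi> n \<in> test_functions \<Omega>"
    "(\<lambda>n. L2_norm \<Omega> (\<lambda>x. u x - \<phi> n x)) \<longlonglongrightarrow> 0"
    "(\<lambda>n. L2_norm \<Omega> (\<lambda>x. weak_grad \<Omega> u x - grad (\<phi> n) x)) \<longlonglongrightarrow> 0"
    using H10_approx[OF u] by blast
  note uL = H10_L2[OF u] and \<phi>L = test_function_L2[OF \<phi>(1)]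
  define c where "c = 2 * ((L2_norm \<Omega> u)\<^sup>2 + (L2_norm \<Omega> (weak_grad \<Omega> u))\<^sup>2)"
  define cs where "cs n = 2 * ((L2_norm \<Omega> (\<phi> n))\<^sup>2 + (L2_norm \<Omega> (grad (\<phi> n)))\<^sup>2)" for n
  have cs: "cs \<longlonglongrightarrow> c"
    unfolding cs_def c_def
    by (intro tendsto_intros L2_norm_tendsto[OF uL \<phi>L \<phi>(2)]
        L2_norm_tendsto[OF H10_weak_grad_L2[OF u] grad_L2[OF \<phi>(1)] \<phi>(3)])
  have int: "integrable ?M (\<lambda>x. (u x - \<phi> n x)\<^sup>2)" for n
    using L2_inner_integrable[OF L2_diff[OF uL \<phi>L] L2_diff[OF uL \<phi>L], of n n] by (simp add: power2_eq_square)
  have "(\<integral>x. norm ((u x - \<phi> n x)\<^sup>2) \<partial>?M) = (L2_norm \<Omega> (\<lambda>x. u x - \<phi> n x))\<^sup>2" for n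
    unfolding L2_norm_power2 L2_inner_def by (simp add: power2_eq_square)
  moreover have "(\<lambda>n. (L2_norm \<Omega> (\<lambda>x. u x - \<phi> n x))\<^sup>2) \<longlonglongrightarrow> 0"
    using tendsto_power[OF \<phi>(2), of 2] by simp
  ultimately have "(\<lambda>n. \<integral>x. norm ((u x - \<phi> n x)\<^sup>2) \<partial>?M) \<longlonglongrightarrow> 0" by simp
  from tendsto_L1_AE_subseq[OF int this] obtain r :: "nat \<Rightarrow> nat" where r: "strict_mono r"
    "AE x in ?M. (\<lambda>n. (u x - \<phi> (r n) x)\<^sup>2) \<longlonglongrightarrow> 0" by blast
  have mu: "u \<in> borel_measurable ?M" and m\<phi>: "\<phi> n \<in> borel_measurable ?M" for n
    by (intro L2_measurable uL \<phi>L)+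
  note [measurable] = mu m\<phi>
  have lim: "AE x in ?M. liminf (\<lambda>n. ennreal ((\<phi> (r n) x)^4)) = ennreal ((u x)^4)"
    using r(2)
  proof eventually_elim
    case (elim x)
    have "(\<lambda>n. \<bar>u x - \<phi> (r n) x\<bar>) \<longlonglongrightarrow> 0" using tendsto_real_sqrt[OF elim] by simp
    then have "(\<lambda>n. u x - \<phi> (r n) x) \<longlonglongrightarrow> 0" by (rule tendsto_rabs_zero_cancel)
    from tendsto_diff[OF tendsto_const[of "u x"] this] have "(\<lambda>n. \<phi> (r n) x) \<longlonglongrightarrow> u x" by simp
    then have "(\<lambda>n. ennreal ((\<phi> (r n) x)^4)) \<longlonglongrightarrow> ennreal ((u x)^4)"
      by (intro tendsto_ennrealI tendsto_power)
    then show ?case by (intro lim_imp_Liminf) auto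
  qed
  have int4: "(\<integral>\<^sup>+x. ennreal ((\<phi> n x)^4) \<partial>?M) \<le> ennreal ((cs n)\<^sup>2)" for n
  proof -
    have t: "(\<lambda>x. (\<phi> n x)\<^sup>2) \<in> L2 \<Omega>"
      unfolding power2_eq_square
      by (rule test_function_L2[OF test_functions_mult[OF test_functions_smooth[OF \<phi>(1)] \<phi>(1)]])
    have "(\<integral>\<^sup>+x. ennreal ((\<phi> n x)^4) \<partial>?M) = ennreal (\<integral>x. (\<phi> n x)^4 \<partial>?M)"
      using L2_inner_integrable[OF t t] by (intro nn_integral_eq_integral) (auto simp flip: power_add)
    also have "(\<integral>x. (\<phi> n x)^4 \<partial>?M) = (L2_norm \<Omega> (\<lambda>x. (\<phi> n x)\<^sup>2))\<^sup>2"
      by (simp add: L2_norm_power2 L2_inner_def flip: power_add)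
    also have "\<dots> \<le> (cs n)\<^sup>2"
      unfolding cs_def by (intro power_mono Ladyzhenskaya_test_function dim \<phi>) simp
    finally show ?thesis by (simp add: ennreal_leI)
  qed
  have "(\<integral>\<^sup>+x. ennreal ((u x)^4) \<partial>?M) = (\<integral>\<^sup>+x. liminf (\<lambda>n. ennreal ((\<phi> (r n) x)^4)) \<partial>?M)"
    using lim by (intro nn_integral_cong_AE) auto
  also have "\<dots> \<le> liminf (\<lambda>n. \<integral>\<^sup>+x. ennreal ((\<phi> (r n) x)^4) \<partial>?M)"
    by (rule nn_integral_liminf) measurable
  also have "\<dots> \<le> liminf (\<lambda>n. ennreal ((cs (r n))\<^sup>2))"
    by (intro Liminf_mono always_eventually allI int4)
  also have "\<dots> = ennreal (c\<^sup>2)"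
  proof (rule lim_imp_Liminf)
    show "(\<lambda>n. ennreal ((cs (r n))\<^sup>2)) \<longlonglongrightarrow> ennreal (c\<^sup>2)"
      using LIMSEQ_subseq_LIMSEQ[OF cs r(1)] by (intro tendsto_ennrealI tendsto_power) (simp add: comp_def)
  qed simp
  finally have u4: "(\<integral>\<^sup>+x. ennreal ((u x)^4) \<partial>?M) \<le> ennreal (c\<^sup>2)" .
  have i4: "integrable ?M (\<lambda>x. (u x)^4)"
  proof (rule integrableI_bounded)
    show "(\<integral>\<^sup>+x. ennreal (norm ((u x)^4)) \<partial>?M) < \<infinity>"
      using le_less_trans[OF u4 ennreal_less_top] by simp
  qed measurable
  show L: "(\<lambda>x. (u x)\<^sup>2) \<in> L2 \<Omega>"
    by (rule L2I) (use i4 in \<open>simp_all flip: power_add\<close>)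
  have "ennreal (\<integral>x. (u x)^4 \<partial>?M) \<le> ennreal (c\<^sup>2)"
    using u4 nn_integral_eq_integral[OF i4] by simp
  then have "(L2_norm \<Omega> (\<lambda>x. (u x)\<^sup>2))\<^sup>2 \<le> c\<^sup>2"
    by (simp add: L2_norm_power2 L2_inner_def ennreal_le_iff flip: power_add)
  then show "L2_norm \<Omega> (\<lambda>x. (u x)\<^sup>2) \<le> 2 * ((L2_norm \<Omega> u)\<^sup>2 + (L2_norm \<Omega> (weak_grad \<Omega> u))\<^sup>2)"
    unfolding c_def[symmetric] by (rule power2_le_imp_le) (simp add: c_def)
qed

lemma H10_mult_L2:
  assumes dim: "CARD('d) \<in> {2, 3}" and "a \<in> H10 \<Omega>" "b \<in> H10 \<Omega>"
  shows "(\<lambda>x. a x * b x) \<in> L2 \<Omega>"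
    and "(L2_norm \<Omega> (\<lambda>x. a x * b x))\<^sup>2 \<le> L2_norm \<Omega> (\<lambda>x. (a x)\<^sup>2) * L2_norm \<Omega> (\<lambda>x. (b x)\<^sup>2)"
proof -
  note L = L2_measurable[OF H10_L2[OF assms(2)]] H10_L4(1)[OF dim assms(2)]
    L2_measurable[OF H10_L2[OF assms(3)]] H10_L4(1)[OF dim assms(3)]
  show "(\<lambda>x. a x * b x) \<in> L2 \<Omega>"
    "(L2_norm \<Omega> (\<lambda>x. a x * b x))\<^sup>2 \<le> L2_norm \<Omega> (\<lambda>x. (a x)\<^sup>2) * L2_norm \<Omega> (\<lambda>x. (b x)\<^sup>2)"
    using L2_mult[OF L] by auto
qed

text \<open>For a test function \<open>b\<close> this is the definition of the weak derivative of \<open>a\<close>, tested with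
  \<open>b\<^sup>2\<close>.\<close>

lemma H10_skew_symmetry:
  assumes dim: "CARD('d) \<in> {2, 3}" and a: "a \<in> H10 \<Omega>" and b: "b \<in> H10 \<Omega>"
  shows "2 * L2_inner \<Omega> (\<lambda>x. a x * b x) (\<lambda>x. weak_grad \<Omega> b x $ j)
    = - L2_inner \<Omega> (\<lambda>x. weak_grad \<Omega> a x $ j) (\<lambda>x. (b x)\<^sup>2)"
proof -
  obtain \<psi> where \<psi>: "\<And>n. \<psi> n \<in> test_functions \<Omega>"
    "(\<lambda>n. L2_norm \<Omega> (\<lambda>x. b x - \<psi> n x)) \<longlonglongrightarrow> 0"
    "(\<lambda>n. L2_norm \<Omega> (\<lambda>x. weak_grad \<Omega> b x - grad (\<psi> n) x)) \<longlonglongrightarrow> 0"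
    using H10_approx[OF b] by blast
  have \<psi>H: "\<psi> n \<in> H10 \<Omega>" for n by (rule test_function_H10[OF \<psi>(1)])
  have dH: "(\<lambda>x. b x - \<psi> n x) \<in> H10 \<Omega>" for n
    using H10_lincomb[OF b \<psi>H, of 1 "-1" n] by simp
  let ?q = "\<lambda>n. L2_norm \<Omega> (\<lambda>x. (b x - \<psi> n x)\<^sup>2)"
  \<comment> \<open>The embedding applied to b - \<psi>_n turns convergence in H^1 into convergence
    in L^4.\<close>
  have q: "?q \<longlonglongrightarrow> 0"
  proof (rule Lim_null_comparison)
    let ?c = "\<lambda>n. 2 * ((L2_norm \<Omega> (\<lambda>x. b x - \<psi> n x))\<^sup>2 + (L2_norm \<Omega> (\<lambda>x. weak_grad \<Omega> b x - grad (\<psi> n) x))\<^sup>2)"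
    have "?q n \<le> ?c n" for n
      using H10_L4(2)[OF dim dH[of n]]
        L2_norm_weak_grad[OF is_weak_gradient_diff_test_function[OF H10_L2[OF b] H10_weak_grad[OF b] \<psi>(1)[of n]]]
      by simp
    then show "\<forall>\<^sub>F n in sequentially. norm (?q n) \<le> ?c n" by simp
    have "?c \<longlonglongrightarrow> 2 * (0\<^sup>2 + 0\<^sup>2)" by (intro tendsto_intros \<psi>)
    then show "?c \<longlonglongrightarrow> 0" by simp
  qed
  have prod: "(\<lambda>n. L2_norm \<Omega> (\<lambda>x. w x * (b x - \<psi> n x))) \<longlonglongrightarrow> 0" if w: "w \<in> H10 \<Omega>" for w
  proof (rule Lim_null_comparison)
    let ?s = "\<lambda>n. sqrt (L2_norm \<Omega> (\<lambda>x. (w x)\<^sup>2) * ?q n)"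
    have "L2_norm \<Omega> (\<lambda>x. w x * (b x - \<psi> n x)) \<le> ?s n" for n
      by (rule real_le_rsqrt) (rule H10_mult_L2[OF dim w dH])
    then show "\<forall>\<^sub>F n in sequentially. norm (L2_norm \<Omega> (\<lambda>x. w x * (b x - \<psi> n x))) \<le> ?s n" by simp
    have "?s \<longlonglongrightarrow> sqrt (L2_norm \<Omega> (\<lambda>x. (w x)\<^sup>2) * 0)" by (intro tendsto_intros q)
    then show "?s \<longlonglongrightarrow> 0" by simp
  qed
  have lim1: "(\<lambda>n. L2_inner \<Omega> (\<lambda>x. a x * \<psi> n x) (partial j (\<psi> n)))
      \<longlonglongrightarrow> L2_inner \<Omega> (\<lambda>x. a x * b x) (\<lambda>x. weak_grad \<Omega> b x $ j)"
  proof (rule L2_inner_tendsto)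
    show "(\<lambda>n. L2_norm \<Omega> (\<lambda>x. a x * b x - a x * \<psi> n x)) \<longlonglongrightarrow> 0"
      using prod[OF a] by (simp add: right_diff_distrib)
    show "(\<lambda>n. L2_norm \<Omega> (\<lambda>x. weak_grad \<Omega> b x $ j - partial j (\<psi> n) x)) \<longlonglongrightarrow> 0"
    proof (rule Lim_null_comparison[OF _ \<psi>(3)], rule always_eventually, rule allI)
      fix n
      show "norm (L2_norm \<Omega> (\<lambda>x. weak_grad \<Omega> b x $ j - partial j (\<psi> n) x))
          \<le> L2_norm \<Omega> (\<lambda>x. weak_grad \<Omega> b x - grad (\<psi> n) x)"
        using L2_norm_component_le[OF L2_diff[OF H10_weak_grad_L2[OF b] grad_L2[OF \<psi>(1)[of n]]], of j]
        by (simp add: grad_def)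
    qed
  qed (intro H10_mult_L2[OF dim] a b \<psi>H L2_component H10_weak_grad_L2 test_function_L2[OF test_functions_partial[OF \<psi>(1)]])+
  have lim2: "(\<lambda>n. L2_inner \<Omega> (\<lambda>x. weak_grad \<Omega> a x $ j) (\<lambda>x. (\<psi> n x)\<^sup>2))
      \<longlonglongrightarrow> L2_inner \<Omega> (\<lambda>x. weak_grad \<Omega> a x $ j) (\<lambda>x. (b x)\<^sup>2)"
  proof (rule L2_inner_tendsto)
    show "(\<lambda>n. L2_norm \<Omega> (\<lambda>x. (b x)\<^sup>2 - (\<psi> n x)\<^sup>2)) \<longlonglongrightarrow> 0"
    proof (rule Lim_null_comparison)
      let ?c = "\<lambda>n. 2 * L2_norm \<Omega> (\<lambda>x. b x * (b x - \<psi> n x)) + ?q n"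
      have "L2_norm \<Omega> (\<lambda>x. (b x)\<^sup>2 - (\<psi> n x)\<^sup>2) \<le> ?c n" for n
      proof -
        \<comment> \<open>Expanding around b leaves only terms covered by \<open>prod\<close> and
          \<open>q\<close>, so no uniform L^4 bound on \<psi>_n is required.\<close>
        have "(\<lambda>x. (b x)\<^sup>2 - (\<psi> n x)\<^sup>2) = (\<lambda>x. 2 *\<^sub>R (b x * (b x - \<psi> n x)) + - ((b x - \<psi> n x)\<^sup>2))"
          by (simp add: fun_eq_iff power2_eq_square algebra_simps)
        then show ?thesis
          using L2_norm_triangle[OF L2_scaleR[OF H10_mult_L2(1)[OF dim b dH[of n]], of 2]
              L2_uminus[OF H10_L4(1)[OF dim dH[of n]]]]
          unfolding L2_norm_scaleR L2_norm_uminus by simp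
      qed
      then show "\<forall>\<^sub>F n in sequentially. norm (L2_norm \<Omega> (\<lambda>x. (b x)\<^sup>2 - (\<psi> n x)\<^sup>2)) \<le> ?c n" by simp
      have "?c \<longlonglongrightarrow> 2 * 0 + 0" by (intro tendsto_intros prod[OF b] q)
      then show "?c \<longlonglongrightarrow> 0" by simp
    qed
  qed (intro H10_L4(1)[OF dim] b \<psi>H L2_component H10_weak_grad_L2 a | simp add: L2_norm_eq_0)+
  have eq: "2 * L2_inner \<Omega> (\<lambda>x. a x * \<psi> n x) (partial j (\<psi> n))
      = - L2_inner \<Omega> (\<lambda>x. weak_grad \<Omega> a x $ j) (\<lambda>x. (\<psi> n x)\<^sup>2)" for n
  proof -
    have sm: "smooth (\<psi> n)" by (rule test_functions_smooth[OF \<psi>(1)])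
    have t: "(\<lambda>x. \<psi> n x * \<psi> n x) \<in> test_functions \<Omega>" by (rule test_functions_mult[OF sm \<psi>(1)])
    have "2 * L2_inner \<Omega> (\<lambda>x. a x * \<psi> n x) (partial j (\<psi> n))
        = L2_inner \<Omega> (\<lambda>x. 2 *\<^sub>R (a x * \<psi> n x)) (partial j (\<psi> n))"
      by (rule L2_inner_scaleR_left[symmetric])
    also have "\<dots> = L2_inner \<Omega> a (partial j (\<lambda>x. \<psi> n x * \<psi> n x))"
      unfolding smooth_partial_mult[OF sm sm] L2_inner_def by (simp add: algebra_simps)
    also have "\<dots> = - L2_inner \<Omega> (\<lambda>x. weak_grad \<Omega> a x $ j) (\<lambda>x. \<psi> n x * \<psi> n x)"
      using H10_weak_grad[OF a] t by (simp add: is_weak_gradient_def)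
    finally show ?thesis by (simp add: power2_eq_square)
  qed
  show ?thesis
    using LIMSEQ_unique[OF tendsto_mult_left[OF lim1, of 2] tendsto_minus[OF lim2, folded eq]] .
qed

lemma vel_space_H10: "v \<in> vel_space \<Omega> \<Longrightarrow> (\<lambda>x. v x $ i) \<in> H10 \<Omega>"
  by (simp add: vel_space_def)

lemma vel_space_weak_grad_L2: "v \<in> vel_space \<Omega> \<Longrightarrow> (\<lambda>x. weak_grad \<Omega> (\<lambda>x. v x $ i) x $ j) \<in> L2 \<Omega>"
  by (intro L2_component H10_weak_grad_L2 vel_space_H10)

text \<open>For each pair of components, \<open>H10_skew_symmetry\<close> makes half of the
  divergence term cancel the convective term; this is the purpose of the factor 1/2 in
  \<open>bstar\<close>.\<close>

lemma bstar_skew_symmetric: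
  assumes dim: "CARD('d) \<in> {2, 3}" and u: "u \<in> vel_space \<Omega>" and v: "v \<in> vel_space \<Omega>"
  shows "bstar \<Omega> u v v = 0"
proof -
  let ?U = "\<lambda>j x. u x $ j" and ?V = "\<lambda>i x. v x $ i"
  let ?dU = "\<lambda>j x. weak_grad \<Omega> (?U j) x $ j" and ?dV = "\<lambda>i j x. weak_grad \<Omega> (?V i) x $ j"
  note U = vel_space_H10[OF u] and V = vel_space_H10[OF v]
  \<comment> \<open>These integrability facts allow the finite sums to leave the integral.\<close>
  note I1 = L2_inner_integrable[OF H10_mult_L2(1)[OF dim U V] vel_space_weak_grad_L2[OF v]]
  note I2 = L2_inner_integrable[OF vel_space_weak_grad_L2[OF u] H10_L4(1)[OF dim V]]
  have "L2_inner \<Omega> (\<lambda>x. vgrad \<Omega> v x *v u x) v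
      = (\<integral>x. (\<Sum>i\<in>UNIV. \<Sum>j\<in>UNIV. (?U j x * ?V i x) \<bullet> ?dV i j x) \<partial>lebesgue_on \<Omega>)"
    unfolding L2_inner_def
    by (rule arg_cong[where f = "integral\<^sup>L (lebesgue_on \<Omega>)"])
       (auto simp: fun_eq_iff inner_vec_def matrix_vector_mult_def vgrad_def sum_distrib_left mult_ac intro!: sum.cong)
  also have "\<dots> = (\<Sum>i\<in>UNIV. \<Sum>j\<in>UNIV. L2_inner \<Omega> (\<lambda>x. ?U j x * ?V i x) (?dV i j))"
    unfolding L2_inner_def by (simp only: Bochner_Integration.integral_sum Bochner_Integration.integrable_sum I1)
  finally have 1: "L2_inner \<Omega> (\<lambda>x. vgrad \<Omega> v x *v u x) v
      = (\<Sum>i\<in>UNIV. \<Sum>j\<in>UNIV. L2_inner \<Omega> (\<lambda>x. ?U j x * ?V i x) (?dV i j))" .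
  have "L2_inner \<Omega> (\<lambda>x. divergence \<Omega> u x *\<^sub>R v x) v
      = (\<integral>x. (\<Sum>i\<in>UNIV. \<Sum>j\<in>UNIV. ?dU j x \<bullet> (?V i x)\<^sup>2) \<partial>lebesgue_on \<Omega>)"
    unfolding L2_inner_def
    by (rule arg_cong[where f = "integral\<^sup>L (lebesgue_on \<Omega>)"])
       (auto simp: fun_eq_iff inner_vec_def divergence_def trace_def vgrad_def sum_distrib_left sum_distrib_right
         power2_eq_square mult_ac intro!: sum.cong)
  also have "\<dots> = (\<Sum>i\<in>UNIV. \<Sum>j\<in>UNIV. L2_inner \<Omega> (?dU j) (\<lambda>x. (?V i x)\<^sup>2))"
    unfolding L2_inner_def by (simp only: Bochner_Integration.integral_sum Bochner_Integration.integrable_sum I2)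
  finally have 2: "L2_inner \<Omega> (\<lambda>x. divergence \<Omega> u x *\<^sub>R v x) v
      = (\<Sum>i\<in>UNIV. \<Sum>j\<in>UNIV. L2_inner \<Omega> (?dU j) (\<lambda>x. (?V i x)\<^sup>2))" .
  have "L2_inner \<Omega> (?dU j) (\<lambda>x. (?V i x)\<^sup>2) = - 2 * L2_inner \<Omega> (\<lambda>x. ?U j x * ?V i x) (?dV i j)" for i j
    using H10_skew_symmetry[OF dim U V, of j i j] by simp
  then show ?thesis
    unfolding bstar_def 1 2 by (simp add: sum_distrib_left[symmetric] sum_negf)
qed

end

section \<open>The dual norm\<close>

context bounded_open
begin

section \<open>Velocity fields and their gradient norm\<close>

lemma vgrad_L2: "v \<in> vel_space \<Omega> \<Longrightarrow> vgrad \<Omega> v \<in> L2 \<Omega>"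
  by (rule L2_vecI) (simp add: vgrad_def H10_weak_grad_L2 vel_space_H10)

lemma vel_space_L2: "v \<in> vel_space \<Omega> \<Longrightarrow> v \<in> L2 \<Omega>"
  by (rule L2_vecI) (intro H10_L2 vel_space_H10)

lemma AE_vec_eqI:
  fixes F G :: "real^'d \<Rightarrow> 'b^'n"
  assumes "\<And>i. AE x in lebesgue_on \<Omega>. F x $ i = G x $ i"
  shows "AE x in lebesgue_on \<Omega>. F x = G x"
  using AE_finite_all[of "UNIV :: 'n set" "\<lambda>x i. F x $ i = G x $ i" "ae_filter (lebesgue_on \<Omega>)"] assms
  by (simp add: vec_eq_iff)

lemma vel_space_lincomb:
  assumes v: "v \<in> vel_space \<Omega>" and w: "w \<in> vel_space \<Omega>"
  shows "(\<lambda>x. a *\<^sub>R v x + b *\<^sub>R w x) \<in> vel_space \<Omega>" (is "?z \<in> _")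
    and "L2_norm \<Omega> (vgrad \<Omega> (\<lambda>x. a *\<^sub>R v x + b *\<^sub>R w x))
      \<le> \<bar>a\<bar> * L2_norm \<Omega> (vgrad \<Omega> v) + \<bar>b\<bar> * L2_norm \<Omega> (vgrad \<Omega> w)"
proof -
  show z: "?z \<in> vel_space \<Omega>"
    unfolding vel_space_def using H10_lincomb[OF vel_space_H10[OF v] vel_space_H10[OF w]] by simp
  have "AE x in lebesgue_on \<Omega>. vgrad \<Omega> ?z x $ i = (a *\<^sub>R vgrad \<Omega> v x + b *\<^sub>R vgrad \<Omega> w x) $ i" for i
    using weak_grad_eqI[OF is_weak_gradient_lincomb[OF H10_L2 H10_weak_grad H10_L2 H10_weak_grad,
        OF vel_space_H10[OF v] vel_space_H10[OF v] vel_space_H10[OF w] vel_space_H10[OF w], of a i b i]]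
    by (simp add: vgrad_def)
  then have eq: "AE x in lebesgue_on \<Omega>. vgrad \<Omega> ?z x = a *\<^sub>R vgrad \<Omega> v x + b *\<^sub>R vgrad \<Omega> w x"
    by (rule AE_vec_eqI)
  note L = L2_scaleR[OF vgrad_L2[OF v], of a] L2_scaleR[OF vgrad_L2[OF w], of b]
  have "L2_norm \<Omega> (vgrad \<Omega> ?z) = L2_norm \<Omega> (\<lambda>x. a *\<^sub>R vgrad \<Omega> v x + b *\<^sub>R vgrad \<Omega> w x)"
    by (rule L2_norm_cong_AE[OF L2_measurable[OF vgrad_L2[OF z]] L2_measurable[OF L2_add[OF L]] eq])
  also have "\<dots> \<le> \<bar>a\<bar> * L2_norm \<Omega> (vgrad \<Omega> v) + \<bar>b\<bar> * L2_norm \<Omega> (vgrad \<Omega> w)"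
    using L2_norm_triangle[OF L] by (simp only: L2_norm_scaleR)
  finally show "L2_norm \<Omega> (vgrad \<Omega> ?z) \<le> \<bar>a\<bar> * L2_norm \<Omega> (vgrad \<Omega> v) + \<bar>b\<bar> * L2_norm \<Omega> (vgrad \<Omega> w)" .
qed

text \<open>Carries membership and gradient norm from the explicit Anderson combination to
  \<open>uh\<close>, which equals it only almost everywhere.\<close>

lemma vel_space_cong:
  assumes v: "v \<in> vel_space \<Omega>" and eq: "AE x in lebesgue_on \<Omega>. v x = w x"
  shows "w \<in> vel_space \<Omega>" and "L2_norm \<Omega> (vgrad \<Omega> w) = L2_norm \<Omega> (vgrad \<Omega> v)"
proof -
  have eq_i: "AE x in lebesgue_on \<Omega>. v x $ i = w x $ i" for i using eq by eventually_elim simp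
  show w: "w \<in> vel_space \<Omega>"
    unfolding vel_space_def using H10_cong(1)[OF vel_space_H10[OF v] eq_i] by simp
  have "AE x in lebesgue_on \<Omega>. vgrad \<Omega> w x $ i = vgrad \<Omega> v x $ i" for i
    using H10_cong(2)[OF vel_space_H10[OF v] eq_i] by (simp add: vgrad_def)
  then show "L2_norm \<Omega> (vgrad \<Omega> w) = L2_norm \<Omega> (vgrad \<Omega> v)"
    by (rule L2_norm_cong_AE[OF L2_measurable[OF vgrad_L2[OF w]] L2_measurable[OF vgrad_L2[OF v]] AE_vec_eqI])
qed

lemma vel_space_uminus:
  assumes v: "v \<in> vel_space \<Omega>"
  shows "(\<lambda>x. - v x) \<in> vel_space \<Omega>" and "L2_norm \<Omega> (vgrad \<Omega> (\<lambda>x. - v x)) = L2_norm \<Omega> (vgrad \<Omega> v)"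
proof -
  have *: "(\<lambda>x. - w x) \<in> vel_space \<Omega>" "L2_norm \<Omega> (vgrad \<Omega> (\<lambda>x. - w x)) \<le> L2_norm \<Omega> (vgrad \<Omega> w)"
    if "w \<in> vel_space \<Omega>" for w
    using vel_space_lincomb[OF that that, of "-1" 0] by simp_all
  show "(\<lambda>x. - v x) \<in> vel_space \<Omega>" by (rule *[OF v])
  show "L2_norm \<Omega> (vgrad \<Omega> (\<lambda>x. - v x)) = L2_norm \<Omega> (vgrad \<Omega> v)"
    \<comment> \<open>The inequality for the field -v is the reverse estimate.\<close>
    using *(2)[OF v] *(2)[OF *(1)[OF v]] by simp
qed

lemma Poincare_vel_space:
  obtains C where "C > 0" "\<And>v. v \<in> vel_space \<Omega> \<Longrightarrow> L2_norm \<Omega> v \<le> C * L2_norm \<Omega> (vgrad \<Omega> v)"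
proof -
  obtain C where C: "C > 0" "\<And>u. u \<in> H10 \<Omega> \<Longrightarrow> L2_norm \<Omega> u \<le> C * L2_norm \<Omega> (weak_grad \<Omega> u)"
    by (rule Poincare, rule that)
  have "L2_norm \<Omega> v \<le> C * L2_norm \<Omega> (vgrad \<Omega> v)" if v: "v \<in> vel_space \<Omega>" for v
  proof (rule power2_le_imp_le)
    have "(L2_norm \<Omega> v)\<^sup>2 = (\<Sum>i\<in>UNIV. (L2_norm \<Omega> (\<lambda>x. v x $ i))\<^sup>2)"
      by (simp only: L2_norm_power2 L2_inner_vec[OF vel_space_L2[OF v] vel_space_L2[OF v]])
    also have "\<dots> \<le> (\<Sum>i\<in>UNIV. C\<^sup>2 * (L2_norm \<Omega> (\<lambda>x. vgrad \<Omega> v x $ i))\<^sup>2)"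
    proof (rule sum_mono)
      fix i
      have "L2_norm \<Omega> (\<lambda>x. v x $ i) \<le> C * L2_norm \<Omega> (\<lambda>x. vgrad \<Omega> v x $ i)"
        using C(2)[OF vel_space_H10[OF v, of i]] by (simp add: vgrad_def)
      from power_mono[OF this, of 2]
      show "(L2_norm \<Omega> (\<lambda>x. v x $ i))\<^sup>2 \<le> C\<^sup>2 * (L2_norm \<Omega> (\<lambda>x. vgrad \<Omega> v x $ i))\<^sup>2"
        by (simp add: power_mult_distrib)
    qed
    also have "\<dots> = (C * L2_norm \<Omega> (vgrad \<Omega> v))\<^sup>2"
      by (simp only: L2_norm_power2 power_mult_distrib sum_distrib_left L2_inner_vec[OF vgrad_L2[OF v] vgrad_L2[OF v]])
    finally show "(L2_norm \<Omega> v)\<^sup>2 \<le> (C * L2_norm \<Omega> (vgrad \<Omega> v))\<^sup>2" .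
  qed (use C in simp)
  with C(1) show thesis by (rule that)
qed

text \<open>The field \<open>w\<close> supplies the zero field, as 0 w + 0 w; invariance under null
  sets then transfers its gradient norm to \<open>v\<close>.\<close>

lemma vgrad_eq_0:
  assumes "AE x in lebesgue_on \<Omega>. v x = 0" "w \<in> vel_space \<Omega>"
  shows "L2_norm \<Omega> (vgrad \<Omega> v) = 0"
proof -
  have 0: "(\<lambda>x. 0) \<in> vel_space \<Omega>" "L2_norm \<Omega> (vgrad \<Omega> (\<lambda>x. 0)) = 0"
    using vel_space_lincomb[OF assms(2) assms(2), of 0 0] by (auto intro: antisym)
  have "AE x in lebesgue_on \<Omega>. 0 = v x" using assms(1) by eventually_elim simp
  from vel_space_cong(2)[OF 0(1) this] 0(2) show ?thesis by simp
qed

text \<open>Ensures that the supremum in \<open>dual_norm\<close> is over a nonempty set, and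
  provides the field that determines the signs of \<open>dual_norm\<close> and \<open>M\<close>. A
  bump in every component does it.\<close>

lemma ex_nonzero_velocity:
  assumes "\<Omega> \<noteq> {}"
  obtains v where "v \<in> vel_space \<Omega>" "\<not> (AE x in lebesgue_on \<Omega>. v x = 0)"
proof -
  obtain x where "x \<in> \<Omega>" using assms by blast
  then obtain a b where ab: "x \<in> box a b" "cbox a b \<subseteq> \<Omega>"
    using open_contains_cbox[OF open_domain] by metis
  define v :: "real^'d \<Rightarrow> real^'d" where "v x = (\<chi> i. bump 1 a b x)" for x
  have "v \<in> vel_space \<Omega>"
    unfolding vel_space_def v_def using test_function_H10[OF bump_test_function[OF _ ab(2)]] by simp
  moreover have "\<not> (AE x in lebesgue_on \<Omega>. v x = 0)"
  proof
    assume "AE x in lebesgue_on \<Omega>. v x = 0"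
    then have "AE x in lebesgue. x \<in> \<Omega> \<longrightarrow> v x = 0" by (simp add: AE_restrict_space_iff)
    then have "AE x in lebesgue. x \<notin> box a b"
    proof eventually_elim
      case (elim x)
      show ?case
      proof
        assume x: "x \<in> box a b"
        then have "v x = 0" using elim ab(2) box_subset_cbox by blast
        then show False using bump_pos[OF _ x, of 1] by (simp add: v_def vec_eq_iff)
      qed
    qed
    then have "box a b \<in> null_sets lebesgue" by (subst AE_iff_null_sets) auto
    then have "negligible (box a b)" by (simp add: negligible_iff_null_sets)
    then show False using open_not_negligible[OF open_box, of a b] ab(1) by auto
  qed
  ultimately show thesis by (rule that)
qed

text \<open>By the Poincare inequality a zero gradient norm forces the field to vanish almost
  everywhere. Hence the quotients in \<open>dual_norm\<close> have positive denominators.\<close>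

lemma vgrad_pos:
  assumes "v \<in> vel_space \<Omega>" "\<not> (AE x in lebesgue_on \<Omega>. v x = 0)"
  shows "L2_norm \<Omega> (vgrad \<Omega> v) > 0"
proof (rule ccontr)
  assume "\<not> ?thesis"
  then have "L2_norm \<Omega> (vgrad \<Omega> v) = 0" using L2_norm_nonneg[of \<Omega> "vgrad \<Omega> v"] by linarith
  moreover obtain C where "\<And>v. v \<in> vel_space \<Omega> \<Longrightarrow> L2_norm \<Omega> v \<le> C * L2_norm \<Omega> (vgrad \<Omega> v)"
    by (rule Poincare_vel_space, rule that)
  ultimately have "L2_norm \<Omega> v \<le> 0" using assms(1) by fastforce
  then have "L2_norm \<Omega> v = 0" using L2_norm_nonneg[of \<Omega> v] by linarith
  then show False using L2_norm_eq_0_AE[OF vel_space_L2[OF assms(1)]] assms(2) by blast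
qed

text \<open>The Poincare inequality absorbs the zeroth-order part of the norm into the gradient
  part. The constant uses |B| because no sign is given for \<open>B\<close>.\<close>

lemma Hminus1_bound:
  assumes f: "f \<in> Hminus1 \<Omega>"
  obtains K where "\<And>v. v \<in> vel_space \<Omega> \<Longrightarrow> \<bar>f v\<bar> \<le> K * L2_norm \<Omega> (vgrad \<Omega> v)"
proof -
  obtain B where B: "\<And>v. v \<in> vel_space \<Omega> \<Longrightarrow>
      \<bar>f v\<bar> \<le> B * sqrt ((L2_norm \<Omega> v)\<^sup>2 + (L2_norm \<Omega> (vgrad \<Omega> v))\<^sup>2)"
    using f unfolding Hminus1_def by blast
  obtain C where C: "C > 0" "\<And>v. v \<in> vel_space \<Omega> \<Longrightarrow> L2_norm \<Omega> v \<le> C * L2_norm \<Omega> (vgrad \<Omega> v)"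
    by (rule Poincare_vel_space, rule that)
  have "\<bar>f v\<bar> \<le> (\<bar>B\<bar> * (C + 1)) * L2_norm \<Omega> (vgrad \<Omega> v)" if v: "v \<in> vel_space \<Omega>" for v
  proof -
    let ?s = "sqrt ((L2_norm \<Omega> v)\<^sup>2 + (L2_norm \<Omega> (vgrad \<Omega> v))\<^sup>2)"
    have "?s \<le> L2_norm \<Omega> v + L2_norm \<Omega> (vgrad \<Omega> v)"
      by (rule sqrt_sum_squares_le_sum) auto
    also have "\<dots> \<le> (C + 1) * L2_norm \<Omega> (vgrad \<Omega> v)" using C(2)[OF v] by (simp add: algebra_simps)
    finally have s: "?s \<le> (C + 1) * L2_norm \<Omega> (vgrad \<Omega> v)" .
    have "\<bar>f v\<bar> \<le> B * ?s" by (rule B[OF v])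
    also have "\<dots> \<le> \<bar>B\<bar> * ?s" by (intro mult_right_mono) auto
    also have "\<dots> \<le> \<bar>B\<bar> * ((C + 1) * L2_norm \<Omega> (vgrad \<Omega> v))" by (intro mult_left_mono s) auto
    finally show ?thesis by (simp add: mult.assoc)
  qed
  then show thesis by (rule that)
qed

text \<open>\<open>Sup\<close> on the reals is meaningful only for sets bounded above;
  \<open>Hminus1_bound\<close> supplies the bound.\<close>

lemma dual_norm_upper:
  assumes f: "f \<in> Hminus1 \<Omega>" and v: "v \<in> vel_space \<Omega>" and nz: "\<not> (AE x in lebesgue_on \<Omega>. v x = 0)"
  shows "f v / L2_norm \<Omega> (vgrad \<Omega> v) \<le> dual_norm \<Omega> f"
  unfolding dual_norm_def
proof (rule cSup_upper)
  obtain K where K: "\<And>v. v \<in> vel_space \<Omega> \<Longrightarrow> \<bar>f v\<bar> \<le> K * L2_norm \<Omega> (vgrad \<Omega> v)"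
    by (rule Hminus1_bound[OF f], rule that)
  show "bdd_above {f v / L2_norm \<Omega> (vgrad \<Omega> v) |v. v \<in> vel_space \<Omega> \<and> \<not> (AE x in lebesgue_on \<Omega>. v x = 0)}"
  proof (rule bdd_aboveI)
    fix q assume "q \<in> {f v / L2_norm \<Omega> (vgrad \<Omega> v) |v. v \<in> vel_space \<Omega> \<and> \<not> (AE x in lebesgue_on \<Omega>. v x = 0)}"
    then obtain w where w: "q = f w / L2_norm \<Omega> (vgrad \<Omega> w)" "w \<in> vel_space \<Omega>"
      "\<not> (AE x in lebesgue_on \<Omega>. w x = 0)" by blast
    have "f w \<le> K * L2_norm \<Omega> (vgrad \<Omega> w)" using K[OF w(2)] by linarith
    then show "q \<le> K" using vgrad_pos[OF w(2,3)] w(1) by (simp add: pos_divide_le_eq)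
  qed
qed (use v nz in blast)

lemma dual_norm_bound:
  assumes f: "f \<in> Hminus1 \<Omega>" and v: "v \<in> vel_space \<Omega>"
  shows "f v \<le> dual_norm \<Omega> f * L2_norm \<Omega> (vgrad \<Omega> v)"
proof (cases "AE x in lebesgue_on \<Omega>. v x = 0")
  \<comment> \<open>Such fields are excluded from the supremum; here boundedness of f forces f v =
    0, and both sides vanish.\<close>
  case True
  obtain K where "\<And>v. v \<in> vel_space \<Omega> \<Longrightarrow> \<bar>f v\<bar> \<le> K * L2_norm \<Omega> (vgrad \<Omega> v)"
    by (rule Hminus1_bound[OF f], rule that)
  then have "\<bar>f v\<bar> \<le> K * L2_norm \<Omega> (vgrad \<Omega> v)" using v by blast
  then show ?thesis using vgrad_eq_0[OF True v] by simp
next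
  case False
  then show ?thesis
    using dual_norm_upper[OF f v False] vgrad_pos[OF v False] by (simp add: pos_divide_le_eq)
qed

text \<open>The estimates for v and -v have opposite left-hand sides, so their sum gives the
  sign.\<close>

lemma dual_norm_nonneg:
  assumes f: "f \<in> Hminus1 \<Omega>" and "\<Omega> \<noteq> {}"
  shows "0 \<le> dual_norm \<Omega> f"
proof -
  obtain v where v: "v \<in> vel_space \<Omega>" "\<not> (AE x in lebesgue_on \<Omega>. v x = 0)"
    by (rule ex_nonzero_velocity[OF assms(2)], rule that)
  have "f (\<lambda>x. (-1) *\<^sub>R v x) = (-1) * f v"
    using f v(1) unfolding Hminus1_def by blast
  then have "- f v \<le> dual_norm \<Omega> f * L2_norm \<Omega> (vgrad \<Omega> v)"
    using dual_norm_bound[OF f vel_space_uminus(1)[OF v(1)]] vel_space_uminus(2)[OF v(1)] by simp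
  with dual_norm_bound[OF f v(1)] have "0 \<le> dual_norm \<Omega> f * L2_norm \<Omega> (vgrad \<Omega> v)" by linarith
  then show ?thesis using vgrad_pos[OF v] by (simp add: zero_le_mult_iff)
qed

section \<open>Bounds for the Picard and Newton steps\<close>

lemma bstar_uminus_right: "bstar \<Omega> v w (\<lambda>x. - z x) = - bstar \<Omega> v w z"
  by (simp add: bstar_def L2_inner_def)

lemma picard_step_bound:
  assumes dim: "CARD('d) \<in> {2, 3}" and nonempty: "\<Omega> \<noteq> {}" and \<nu>: "\<nu> > 0" and f: "f \<in> Hminus1 \<Omega>"
    and u: "u \<in> vel_space \<Omega>" and step: "picard_step \<Omega> \<nu> f u ut"
  shows "L2_norm \<Omega> (vgrad \<Omega> ut) \<le> dual_norm \<Omega> f / \<nu>"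
proof -
  let ?p = "L2_norm \<Omega> (vgrad \<Omega> ut)"
  have ut: "ut \<in> divfree_space \<Omega>" "ut \<in> vel_space \<Omega>"
    using step by (auto simp: picard_step_def divfree_space_def)
  have "\<nu> * L2_inner \<Omega> (vgrad \<Omega> ut) (vgrad \<Omega> ut) + bstar \<Omega> u ut ut = f ut"
    using step ut(1) unfolding picard_step_def by blast
  then have "\<nu> * ?p\<^sup>2 \<le> dual_norm \<Omega> f * ?p"
    using dual_norm_bound[OF f ut(2)] bstar_skew_symmetric[OF dim u ut(2)] by (simp add: L2_norm_power2)
  then have le: "(\<nu> * ?p) * ?p \<le> dual_norm \<Omega> f * ?p" by (simp add: power2_eq_square mult.assoc)
  have "\<nu> * ?p \<le> dual_norm \<Omega> f"
  proof (cases "?p = 0")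
    \<comment> \<open>Cancelling \<open>?p\<close> is impossible here; the sign of the dual norm
      gives the claim.\<close>
    case True
    then show ?thesis using dual_norm_nonneg[OF f nonempty] by simp
  next
    case False
    then have "?p > 0" using L2_norm_nonneg[of \<Omega> "vgrad \<Omega> ut"] by linarith
    then show ?thesis using le by simp
  qed
  then show ?thesis using \<nu> by (simp add: pos_le_divide_eq mult.commute)
qed

text \<open>Kept in product form: the sign of the coefficient on the left is settled only after
  \<open>uh\<close> has been bounded.\<close>

lemma newton_step_bound:
  assumes dim: "CARD('d) \<in> {2, 3}" and nonempty: "\<Omega> \<noteq> {}" and f: "f \<in> Hminus1 \<Omega>"
    and M_bound: "\<And>v w z. v \<in> vel_space \<Omega> \<Longrightarrow> w \<in> vel_space \<Omega> \<Longrightarrow> z \<in> vel_space \<Omega> \<Longrightarrow>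
        bstar \<Omega> v w z \<le> M * L2_norm \<Omega> (vgrad \<Omega> v) * L2_norm \<Omega> (vgrad \<Omega> w) * L2_norm \<Omega> (vgrad \<Omega> z)"
    and M: "M \<ge> 0" and uh: "uh \<in> vel_space \<Omega>" and step: "newton_step \<Omega> \<nu> f uh u"
  shows "(\<nu> - M * L2_norm \<Omega> (vgrad \<Omega> uh)) * L2_norm \<Omega> (vgrad \<Omega> u)
    \<le> dual_norm \<Omega> f + M * (L2_norm \<Omega> (vgrad \<Omega> uh))\<^sup>2"
proof -
  let ?p = "L2_norm \<Omega> (vgrad \<Omega> u)" and ?q = "L2_norm \<Omega> (vgrad \<Omega> uh)"
  have u: "u \<in> divfree_space \<Omega>" "u \<in> vel_space \<Omega>"
    using step by (auto simp: newton_step_def divfree_space_def)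
  have "\<nu> * L2_inner \<Omega> (vgrad \<Omega> u) (vgrad \<Omega> u) + bstar \<Omega> uh u u + bstar \<Omega> u uh u - bstar \<Omega> uh uh u = f u"
    using step u(1) unfolding newton_step_def by blast
  then have eq: "\<nu> * ?p\<^sup>2 = f u - bstar \<Omega> u uh u + bstar \<Omega> uh uh u"
    using bstar_skew_symmetric[OF dim uh u(2)] by (simp add: L2_norm_power2)
  \<comment> \<open>\<open>M_bound\<close> gives upper bounds only; with -u as test field it bounds
    the term from the other side.\<close>
  have "- bstar \<Omega> u uh u \<le> M * ?p * ?q * ?p"
    using M_bound[OF u(2) uh vel_space_uminus(1)[OF u(2)]]
    by (simp add: bstar_uminus_right vel_space_uminus(2)[OF u(2)])
  then have "\<nu> * ?p\<^sup>2 \<le> dual_norm \<Omega> f * ?p + M * ?p * ?q * ?p + M * ?q * ?q * ?p"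
    using eq dual_norm_bound[OF f u(2)] M_bound[OF uh uh u(2)] by linarith
  then have le: "((\<nu> - M * ?q) * ?p) * ?p \<le> (dual_norm \<Omega> f + M * ?q\<^sup>2) * ?p"
    by (simp add: power2_eq_square algebra_simps)
  show ?thesis
  proof (cases "?p = 0")
    case True
    then show ?thesis using dual_norm_nonneg[OF f nonempty] M by simp
  next
    case False
    then have "?p > 0" using L2_norm_nonneg[of \<Omega> "vgrad \<Omega> u"] by linarith
    then show ?thesis using le by (rule mult_right_le_imp_le[rotated])
  qed
qed

end

section \<open>Combining the bounds along the iteration\<close>

theorem mainTheorem1:
  fixes \<Omega> :: "(real^'d) set"
    and \<nu> M \<sigma> C\<^sub>A :: real
    and f :: "(real^'d \<Rightarrow> real^'d) \<Rightarrow> real"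
    and \<alpha> \<beta> :: "nat \<Rightarrow> real"
    and u ut uh :: "nat \<Rightarrow> real^'d \<Rightarrow> real^'d"
  assumes dim: "CARD('d) \<in> {2, 3}"
    and domain: "open \<Omega>" "connected \<Omega>" "bounded \<Omega>" "\<Omega> \<noteq> {}"
    and viscosity: "\<nu> > 0"
    and force: "f \<in> Hminus1 \<Omega>"
    and M_bound: "\<And>v w z. v \<in> vel_space \<Omega> \<Longrightarrow> w \<in> vel_space \<Omega> \<Longrightarrow> z \<in> vel_space \<Omega> \<Longrightarrow>
        bstar \<Omega> v w z \<le> M * L2_norm \<Omega> (vgrad \<Omega> v) * L2_norm \<Omega> (vgrad \<Omega> w) * L2_norm \<Omega> (vgrad \<Omega> z)"
    and sigma: "\<sigma> = M * (1 / \<nu>\<^sup>2) * dual_norm \<Omega> f"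
    and iteration: "AAPicard_Newton \<Omega> \<nu> f \<beta> \<alpha> u ut uh"
    and undamped: "\<And>k. \<beta> (k + 1) = 1"
    and C\<^sub>A_pos: "C\<^sub>A > 0"
    and alpha_bound: "\<And>k. k \<ge> 1 \<Longrightarrow> \<bar>1 - \<alpha> k\<bar> + \<bar>\<alpha> k\<bar> \<le> C\<^sub>A"
    and small: "\<sigma> < 1" "\<sigma> * C\<^sub>A < 1"
  shows "\<forall>k. L2_norm \<Omega> (vgrad \<Omega> (uh (k + 1))) \<le> C\<^sub>A * (1 / \<nu>) * dual_norm \<Omega> f \<and>
             L2_norm \<Omega> (vgrad \<Omega> (u (k + 1)))
               \<le> (1 + \<sigma> * C\<^sub>A\<^sup>2) / (1 - \<sigma> * C\<^sub>A) * (1 / \<nu>) * dual_norm \<Omega> f"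
proof (rule allI)
  interpret bounded_open \<Omega> by unfold_locales (use domain in auto)
  fix k
  define F where "F = dual_norm \<Omega> f"
  define r where "r = C\<^sub>A * (1 / \<nu>) * F"
  let ?n = "\<lambda>v. L2_norm \<Omega> (vgrad \<Omega> v)"
  have F: "F \<ge> 0" unfolding F_def by (rule dual_norm_nonneg[OF force domain(4)])
  \<comment> \<open>With three equal arguments \<open>bstar\<close> vanishes, so \<open>M\<close>
    times a positive number is nonnegative.\<close>
  have M: "M \<ge> 0"
  proof -
    obtain v where v: "v \<in> vel_space \<Omega>" "\<not> (AE x in lebesgue_on \<Omega>. v x = 0)"
      by (rule ex_nonzero_velocity[OF domain(4)], rule that)
    have "0 \<le> M * (?n v * ?n v * ?n v)"
      using M_bound[OF v(1) v(1) v(1)] bstar_skew_symmetric[OF dim v(1) v(1)] by (simp add: mult.assoc)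
    moreover have "0 < ?n v * ?n v * ?n v" using vgrad_pos[OF v] by simp
    ultimately show ?thesis by (simp add: zero_le_mult_iff)
  qed
  have it: "picard_step \<Omega> \<nu> f (u k) (ut (k + 1))" "anderson_step \<Omega> \<beta> \<alpha> u ut uh k"
    "newton_step \<Omega> \<nu> f (uh (k + 1)) (u (k + 1))" for k
    using iteration unfolding AAPicard_Newton_def by blast+
  have u: "u k \<in> vel_space \<Omega>" for k
  proof (cases k)
    case 0
    then show ?thesis using iteration by (simp add: AAPicard_Newton_def divfree_space_def)
  next
    case (Suc n)
    then show ?thesis using it(3)[of n] by (simp add: newton_step_def divfree_space_def)
  qed
  have ut: "ut (k + 1) \<in> vel_space \<Omega>" for k
    using it(1)[of k] by (simp add: picard_step_def divfree_space_def)
  have ut_bound: "?n (ut (k + 1)) \<le> F / \<nu>" for k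
    unfolding F_def by (rule picard_step_bound[OF dim domain(4) viscosity force u it(1)])
  let ?a = "\<alpha> (k + 1)"
  text \<open>The iteration does not constrain \<open>ut 0\<close>; for \<open>k = 0\<close> any field can take its place since
    \<open>\<alpha> 1 = 0\<close>.\<close>
  define l where "l = (if k = 0 then k + 1 else k)"
  define z where "z x = (1 - ?a) *\<^sub>R ut (k + 1) x + ?a *\<^sub>R ut l x" for x
  \<comment> \<open>In both cases l is at least 1, so l - 1 is an iteration index to which the
    Picard facts apply.\<close>
  have l: "ut l \<in> vel_space \<Omega>" "?n (ut l) \<le> F / \<nu>"
    using ut[of "l - 1"] ut_bound[of "l - 1"] by (auto simp: l_def split: if_splits)
  have z: "z \<in> vel_space \<Omega>" "?n z \<le> \<bar>1 - ?a\<bar> * ?n (ut (k + 1)) + \<bar>?a\<bar> * ?n (ut l)"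
    unfolding z_def by (rule vel_space_lincomb[OF ut l(1)])+
  have "AE x in lebesgue_on \<Omega>. uh (k + 1) x = z x"
  proof (cases "k = 0")
    case True
    then have "\<alpha> 1 = 0" "AE x in lebesgue_on \<Omega>. uh 1 x = ut 1 x"
      using it(2)[of k] by (simp_all add: anderson_step_def)
    then show ?thesis using True by (simp add: z_def l_def)
  next
    case False
    then have "AE x in lebesgue_on \<Omega>. uh (k + 1) x = (1 - ?a) *\<^sub>R ut (k + 1) x + ?a *\<^sub>R ut k x
        - (1 - \<beta> (k + 1)) *\<^sub>R residual_comb u ut k ?a x"
      using it(2)[of k] unfolding anderson_step_def by (simp only: if_False)
    \<comment> \<open>With \<beta> equal to 1 the residual term drops out and the plain combination
      remains.\<close>
    then show ?thesis using False undamped[of k] by (simp add: z_def l_def)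
  qed
  then have "AE x in lebesgue_on \<Omega>. z x = uh (k + 1) x" by eventually_elim simp
  from vel_space_cong[OF z(1) this]
  have uh: "uh (k + 1) \<in> vel_space \<Omega>" "?n (uh (k + 1)) = ?n z" by auto
  have uh_bound: "?n (uh (k + 1)) \<le> r"
  proof -
    have "?n (uh (k + 1)) \<le> \<bar>1 - ?a\<bar> * ?n (ut (k + 1)) + \<bar>?a\<bar> * ?n (ut l)" using uh(2) z(2) by simp
    also have "\<dots> \<le> \<bar>1 - ?a\<bar> * (F / \<nu>) + \<bar>?a\<bar> * (F / \<nu>)"
      by (intro add_mono mult_left_mono ut_bound l) auto
    also have "\<dots> = (\<bar>1 - ?a\<bar> + \<bar>?a\<bar>) * (F / \<nu>)" by (rule distrib_right[symmetric])
    also have "\<dots> \<le> C\<^sub>A * (F / \<nu>)"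
      using alpha_bound[of "k + 1"] F viscosity by (intro mult_right_mono) auto
    finally show ?thesis by (simp add: r_def)
  qed
  have Mr: "M * r = \<nu> * (\<sigma> * C\<^sub>A)" "F + M * r\<^sup>2 = (1 + \<sigma> * C\<^sub>A\<^sup>2) * F"
    using viscosity by (simp_all add: sigma F_def r_def power2_eq_square field_simps)
  have d: "0 < \<nu> * (1 - \<sigma> * C\<^sub>A)" using viscosity small(2) by simp
  \<comment> \<open>The coefficient \<nu> - M |grad uh| decreases in the norm of the gradient of
    \<open>uh\<close>, so inserting the bound \<open>r\<close> gives a lower bound for it, positive
    by \<open>d\<close>.\<close>
  have "(\<nu> * (1 - \<sigma> * C\<^sub>A)) * ?n (u (k + 1)) \<le> (\<nu> - M * ?n (uh (k + 1))) * ?n (u (k + 1))"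
    using mult_left_mono[OF uh_bound M] Mr(1) by (intro mult_right_mono) (auto simp: algebra_simps)
  also have "\<dots> \<le> F + M * (?n (uh (k + 1)))\<^sup>2"
    unfolding F_def by (rule newton_step_bound[OF dim domain(4) force M_bound M uh(1) it(3)])
  also have "\<dots> \<le> F + M * r\<^sup>2"
    by (intro add_left_mono mult_left_mono power_mono uh_bound M) simp
  finally have "?n (u (k + 1)) \<le> ((1 + \<sigma> * C\<^sub>A\<^sup>2) * F) / (\<nu> * (1 - \<sigma> * C\<^sub>A))"
    unfolding Mr(2) using d by (simp only: pos_le_divide_eq mult.commute)
  then have "?n (u (k + 1)) \<le> (1 + \<sigma> * C\<^sub>A\<^sup>2) / (1 - \<sigma> * C\<^sub>A) * (1 / \<nu>) * F"
    by (simp add: mult_ac)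
  with uh_bound show "?n (uh (k + 1)) \<le> C\<^sub>A * (1 / \<nu>) * dual_norm \<Omega> f \<and>
      ?n (u (k + 1)) \<le> (1 + \<sigma> * C\<^sub>A\<^sup>2) / (1 - \<sigma> * C\<^sub>A) * (1 / \<nu>) * dual_norm \<Omega> f"
    by (simp add: r_def F_def)
qed

end
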